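(* Almost surely, for all $t\in\mathbb{R}$, $$\lim_{n\to\infty}\frac{\log\tilde Z_n(t)}{n}=\tilde\Lambda(t):=\begin{cases}\Lambda(t)&\text{if } t\in(t_-,t_+),\\ t\Lambda'(t_+)&\text{if } t\ge t_+,\\ t\Lambda'(t_-)&\text{if } t\le t_-.\end{cases}$$
   Context: Branching random walk in a random environment in time. Let $\xi=(\xi_n)_{n\ge 0}$ be a stationary and ergodic sequence of random variables with values in a measurable space $\Theta$; each realization of $\xi_n$ determines a probability distribution $\eta_n=\eta(\xi_n)$ on $\mathbb{N}\times\mathbb{R}\times\mathbb{R}\times\cdots$. Given $\xi$ (quenched law $\mathbb{P}_\xi$, expectation $\mathbb{E}_\xi$), let $X(u)=(N(u),L_1(u),L_2(u),\dots)$, indexed by finite sequences $u\in\{\emptyset\}\cup\bigcup_{n\ge1}\mathbb{N}^n$, be independent random vectors, $X(u)$ having law $\eta_n$ when the length $|u|$ equals $n$ (values $L_i(u)$ with $i>N(u)$ play no role in the process). The initial particle $\emptyset$ is at $S_\emptyset=0$; each particle $u$ of generation $n$, located at $S_u$, is replaced by $N(u)$ particles $ui$ of generation $n+1$ located at $S_{ui}=S_u+L_i(u)$, $1\le i\le N(u)$. Let $\mathbb{T}_n$ be the set of particles of generation $n$. The annealed law $\mathbb{P}$ (expectation $\mathbb{E}$) is $\mathbb{P}_\xi$ integrated against the law of $\xi$; "a.s." refers to $\mathbb{P}$. Write $N=N(\emptyset)$, $L_i=L_i(\emptyset)$, and $m_n=\mathbb{E}_\xi N(u)$ for $|u|=n$.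 Standing assumptions: $\mathbb{E}\log m_0\in(0,\infty)$ and $\mathbb{E}\frac{N}{m_0}\log^+N<\infty$; $N\ge1$ a.s.; and, with $m_0(t)=\mathbb{E}_\xi\sum_{i=1}^{N}e^{tL_i}$, $\mathbb{E}|L_1|<\infty$, $\mathbb{E}|\log m_0(t)|<\infty$ and $\mathbb{E}\left|\frac{m_0'(t)}{m_0(t)}\right|<\infty$ for all $t\in\mathbb{R}$. Notation: the partition function is $\tilde Z_n(t)=\sum_{u\in\mathbb{T}_n}e^{tS_u}$. $\Lambda(t)=\mathbb{E}\log m_0(t)$, which is differentiable with $\Lambda'(t)=\mathbb{E}\frac{m_0'(t)}{m_0(t)}$; $t_-=\inf\{t\in\mathbb{R}:t\Lambda'(t)-\Lambda(t)\le0\}$, $t_+=\sup\{t\in\mathbb{R}:t\Lambda'(t)-\Lambda(t)\le0\}$, so $-\infty\le t_-<0<t_+\le\infty$ (if $t_+=\infty$ or $t_-=-\infty$ the corresponding case in the definition of $\tilde\Lambda$ is void). *)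

theory Defs
  imports "HOL-Probability.Probability"
begin

text \<open>The measurable space of the random vectors \<open>(N, L\<^sub>1, L\<^sub>2, \<dots>)\<close>. Everything is indexed
  from 0: \<open>L\<^sub>i\<close> is the coordinate \<open>i - 1\<close> of the second component.\<close>

definition offspring_space :: "(nat \<times> (nat \<Rightarrow> real)) measure" where
  "offspring_space = count_space UNIV \<Otimes>\<^sub>M (\<Pi>\<^sub>M i\<in>UNIV. borel)"

definition stationary :: "'w measure \<Rightarrow> 'e measure \<Rightarrow> (nat \<Rightarrow> 'w \<Rightarrow> 'e) \<Rightarrow> bool" where
  "stationary M \<Theta> \<xi> \<longleftrightarrow>
     (\<forall>k. distr M (\<Pi>\<^sub>M n\<in>UNIV. \<Theta>) (\<lambda>\<omega> n. \<xi> (k + n) \<omega>) = distr M (\<Pi>\<^sub>M n\<in>UNIV. \<Theta>) (\<lambda>\<omega> n. \<xi> n \<omega>))"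

text \<open>Triviality of the shift-invariant events; meant for a stationary \<open>\<xi>\<close>.\<close>

definition ergodic :: "'w measure \<Rightarrow> 'e measure \<Rightarrow> (nat \<Rightarrow> 'w \<Rightarrow> 'e) \<Rightarrow> bool" where
  "ergodic M \<Theta> \<xi> \<longleftrightarrow>
     (\<forall>A\<in>sets (\<Pi>\<^sub>M n\<in>UNIV. \<Theta>).
        (\<lambda>e n. e (Suc n)) -` A \<inter> space (\<Pi>\<^sub>M n\<in>UNIV. \<Theta>) = A \<longrightarrow>
        measure M {\<omega>\<in>space M. (\<lambda>n. \<xi> n \<omega>) \<in> A} \<in> {0, 1})"

text \<open>The law \<open>P\<^sub>\<xi>\<close> of the family \<open>(X(u))\<^sub>u\<close> in the fixed environment \<open>e\<close>: independent
  vectors, \<open>X(u)\<close> having law \<open>\<eta>(e\<^sub>n)\<close> for \<open>n = |u|\<close>. Labels outside the tree are included.\<close>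

definition quenched_law ::
    "('e \<Rightarrow> (nat \<times> (nat \<Rightarrow> real)) measure) \<Rightarrow> (nat \<Rightarrow> 'e) \<Rightarrow> (nat list \<Rightarrow> nat \<times> (nat \<Rightarrow> real)) measure" where
  "quenched_law \<eta> e = (\<Pi>\<^sub>M u\<in>UNIV. \<eta> (e (length u)))"

text \<open>\<open>M\<close> realizes the annealed law: the joint law of \<open>(\<xi>, X)\<close> is \<open>P\<^sub>\<xi>\<close> integrated against the
  law of \<open>\<xi>\<close>. Equivalently, \<open>P\<^sub>\<xi>\<close> is the conditional law of \<open>X\<close> given \<open>\<xi>\<close>.\<close>

definition annealed ::
    "'w measure \<Rightarrow> 'e measure \<Rightarrow> ('e \<Rightarrow> (nat \<times> (nat \<Rightarrow> real)) measure) \<Rightarrow> (nat \<Rightarrow> 'w \<Rightarrow> 'e)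
      \<Rightarrow> (nat list \<Rightarrow> 'w \<Rightarrow> nat \<times> (nat \<Rightarrow> real)) \<Rightarrow> bool" where
  "annealed M \<Theta> \<eta> \<xi> X \<longleftrightarrow>
     (\<forall>A\<in>sets (\<Pi>\<^sub>M n\<in>UNIV. \<Theta>). \<forall>B\<in>sets (\<Pi>\<^sub>M u\<in>UNIV. offspring_space).
        emeasure M {\<omega>\<in>space M. (\<lambda>n. \<xi> n \<omega>) \<in> A \<and> (\<lambda>u. X u \<omega>) \<in> B} =
        (\<integral>\<^sup>+\<omega>. indicator A (\<lambda>n. \<xi> n \<omega>) * emeasure (quenched_law \<eta> (\<lambda>n. \<xi> n \<omega>)) B \<partial>M))"

locale brw_random_environment = prob_space M
  for M :: "'w measure" +
  fixes \<Theta> :: "'e measure"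
    and \<eta> :: "'e \<Rightarrow> (nat \<times> (nat \<Rightarrow> real)) measure"
    and \<xi> :: "nat \<Rightarrow> 'w \<Rightarrow> 'e"
    and X :: "nat list \<Rightarrow> 'w \<Rightarrow> nat \<times> (nat \<Rightarrow> real)"
  assumes measurable_\<eta>: "\<eta> \<in> \<Theta> \<rightarrow>\<^sub>M prob_algebra offspring_space"
    and measurable_\<xi>: "\<xi> n \<in> M \<rightarrow>\<^sub>M \<Theta>"
    and measurable_X: "X u \<in> M \<rightarrow>\<^sub>M offspring_space"
    and stationary: "stationary M \<Theta> \<xi>"
    and ergodic: "ergodic M \<Theta> \<xi>"
    and annealed: "annealed M \<Theta> \<eta> \<xi> X"

text \<open>In the following definitions \<open>x\<close> is one realization of \<open>(X(u))\<^sub>u\<close>.\<close>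

abbreviation num_children :: "(nat list \<Rightarrow> nat \<times> (nat \<Rightarrow> real)) \<Rightarrow> nat list \<Rightarrow> nat" where
  "num_children x u \<equiv> fst (x u)"

abbreviation displacement :: "(nat list \<Rightarrow> nat \<times> (nat \<Rightarrow> real)) \<Rightarrow> nat list \<Rightarrow> nat \<Rightarrow> real" where
  "displacement x u i \<equiv> snd (x u) i"

primrec generation :: "(nat list \<Rightarrow> nat \<times> (nat \<Rightarrow> real)) \<Rightarrow> nat \<Rightarrow> nat list set" where
  "generation x 0 = {[]}"
| "generation x (Suc n) = {u @ [i] | u i. u \<in> generation x n \<and> i < num_children x u}"

definition position :: "(nat list \<Rightarrow> nat \<times> (nat \<Rightarrow> real)) \<Rightarrow> nat list \<Rightarrow> real" where
  "position x u = (\<Sum>k<length u. displacement x (take k u) (u ! k))"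

lemma position_Nil: "position x [] = 0"
  by (simp add: position_def)

lemma position_snoc: "position x (u @ [i]) = position x u + displacement x u i"
  by (simp add: position_def nth_append)

definition partition_function :: "(nat list \<Rightarrow> nat \<times> (nat \<Rightarrow> real)) \<Rightarrow> nat \<Rightarrow> real \<Rightarrow> real" where
  "partition_function x n t = (\<Sum>u\<in>generation x n. exp (t * position x u))"

text \<open>\<open>m\<^sub>0\<close> and \<open>m\<^sub>0(t)\<close> in the environment \<open>e\<close>; a priori they may be infinite.\<close>

definition mean_offspring :: "('e \<Rightarrow> (nat \<times> (nat \<Rightarrow> real)) measure) \<Rightarrow> (nat \<Rightarrow> 'e) \<Rightarrow> ennreal" where
  "mean_offspring \<eta> e = (\<integral>\<^sup>+x. of_nat (num_children x []) \<partial>quenched_law \<eta> e)"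

definition laplace_offspring ::
    "('e \<Rightarrow> (nat \<times> (nat \<Rightarrow> real)) measure) \<Rightarrow> (nat \<Rightarrow> 'e) \<Rightarrow> real \<Rightarrow> ennreal" where
  "laplace_offspring \<eta> e t =
     (\<integral>\<^sup>+x. ennreal (\<Sum>i<num_children x []. exp (t * displacement x [] i)) \<partial>quenched_law \<eta> e)"

text \<open>\<open>E |log f| < \<infinity>\<close> for \<open>f\<close> with values in \<open>[0, \<infinity>]\<close>, where \<open>|log 0| = |log \<infinity>| = \<infinity>\<close>. The first
  conjunct is needed because \<open>ln (enn2real 0) = ln (enn2real \<infinity>) = 0\<close>.\<close>

definition log_integrable :: "'w measure \<Rightarrow> ('w \<Rightarrow> ennreal) \<Rightarrow> bool" where
  "log_integrable M f \<longleftrightarrow>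
     (AE \<omega> in M. 0 < f \<omega> \<and> f \<omega> < \<infinity>) \<and> integrable M (\<lambda>\<omega>. ln (enn2real (f \<omega>)))"

definition \<Lambda> ::
    "'w measure \<Rightarrow> ('e \<Rightarrow> (nat \<times> (nat \<Rightarrow> real)) measure) \<Rightarrow> (nat \<Rightarrow> 'w \<Rightarrow> 'e) \<Rightarrow> real \<Rightarrow> real" where
  "\<Lambda> M \<eta> \<xi> t = (\<integral>\<omega>. ln (enn2real (laplace_offspring \<eta> (\<lambda>n. \<xi> n \<omega>) t)) \<partial>M)"

definition t_minus :: "(real \<Rightarrow> real) \<Rightarrow> ereal" where
  "t_minus f = Inf (ereal ` {t. t * deriv f t - f t \<le> 0})"

definition t_plus :: "(real \<Rightarrow> real) \<Rightarrow> ereal" where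
  "t_plus f = Sup (ereal ` {t. t * deriv f t - f t \<le> 0})"

text \<open>\<open>\<Lambda>\<close> continued linearly outside \<open>(t\<^sub>-, t\<^sub>+)\<close>; an infinite endpoint is never converted to a real,
  since the corresponding case cannot occur. The last case is \<open>t \<le> t\<^sub>-\<close>.\<close>

definition linearized :: "(real \<Rightarrow> real) \<Rightarrow> real \<Rightarrow> real" where
  "linearized f t =
     (if t_minus f < ereal t \<and> ereal t < t_plus f then f t
      else if t_plus f \<le> ereal t then t * deriv f (real_of_ereal (t_plus f))
      else t * deriv f (real_of_ereal (t_minus f)))"

end

theory Submission
  imports Defs
begin

text \<open>
The upper bound is Markov's inequality for \<open>Z\<^sub>n(t)\<close> at fixed \<open>t\<close>, combined with the ergodic theorem for
\<open>ln m\<^sub>0(t)\<close>; since \<open>Z\<^sub>n(q t) \<le> Z\<^sub>n(t)\<^sup>q\<close> for \<open>q \<ge> 1\<close>, it improves to the linear bound beyond \<open>t\<^sub>+\<close>.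

For the lower bound at a \<open>t\<close> with \<open>\<Lambda>(p t) < p \<Lambda>(t)\<close> for some \<open>p \<in> (1, 2]\<close>, keep only the first \<open>K\<close> children of each
particle. The reproduction sums then have second moments at most \<open>K m(2t)\<close>, and the increments of the
normalized truncated partition function have exponentially small \<open>L\<^sup>1\<close> norms, by a conditional
variance bound and \<open>\<ell>\<^sup>2 \<le> \<ell>\<^sup>p\<close>. So its limit is nonzero with positive quenched probability. The
quenched probability \<open>q(\<xi>)\<close> of growing more slowly than \<open>e\<^sup>c\<^sup>n\<close> satisfies \<open>q \<le> q \<circ> \<theta>\<close>, because the
first child always exists, so it is constant by ergodicity; splitting on the number of children
shows that the constant is 0 or 1, hence 0. Since \<open>E |L\<^sub>1| < \<infinity>\<close>, the truncated rates converge to \<open>\<Lambda>(t)\<close> as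
\<open>K \<rightarrow> \<infinity>\<close>.

Convexity of \<open>ln Z\<^sub>n\<close> turns convergence at countably many \<open>t\<close> into convergence everywhere, including the
linear parts.
\<close>

section \<open>Birkhoff's ergodic theorem\<close>

text \<open>The assumptions do not control second moments of the full reproduction sum, but the
  quenched means \<open>m\<^sub>0(t)\<close> are a.s. finite for every \<open>t\<close>. With at
  most \<open>K\<close> summands, Cauchy-Schwarz trades a square for a mean at \<open>2 * t\<close>.
  The environment offers no uniform bounds. Factors attached to a single generation are only
  subexponential, because the terms of a convergent Cesaro average are o(n); the exponential gain in
  the increments must leave room for them. The condition \<open>L (p * t) < p * L t\<close> for some
  \<open>p\<close> in (1, 2] is equivalent, by convexity and \<open>L 0 > 0\<close>, to the strict
  inequality \<open>t * deriv L t < L t\<close>. Integrability of the first displacement enters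
  through Jensen's inequality: the log-mean of the first child alone is at least \<open>t\<close>
  times its mean displacement, a lower bound for the truncated log-means that is uniform in
  \<open>K\<close>. A constant probability \<open>C\<close> of slow growth satisfies
  \<open>C \<le> (1 - h) * C + h * C\<^sup>2\<close>, where \<open>h\<close> is the quenched
  probability of at least two children. If \<open>0 < C < 1\<close> this forces \<open>h = 0\<close>
  a.s., hence \<open>L 0 = 0\<close>, against supercriticality.\<close>

locale ergodic_system = prob_space M for M :: "'a measure" +
  fixes \<theta> :: "'a \<Rightarrow> 'a"
  assumes shift_measurable [measurable]: "\<theta> \<in> M \<rightarrow>\<^sub>M M"
    and measure_preserving: "distr M M \<theta> = M"
    and trivial_invariant: "\<And>A. A \<in> sets M \<Longrightarrow> \<theta> -` A \<inter> space M = A \<Longrightarrow> measure M A \<in> {0, 1}"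
begin

lemma funpow_measurable [measurable]: "(\<theta> ^^ k) \<in> M \<rightarrow>\<^sub>M M"
  by (induction k) (auto intro: measurable_compose shift_measurable simp: comp_def id_def)

lemma distr_funpow: "distr M M (\<theta> ^^ k) = M"
proof (induction k)
  case 0
  show ?case by (simp add: id_def)
next
  case (Suc k)
  have "distr M M (\<theta> ^^ Suc k) = distr (distr M M (\<theta> ^^ k)) M \<theta>"
    by (subst distr_distr) (auto simp: comp_def)
  then show ?case by (simp only: Suc measure_preserving)
qed

lemma AE_funpow:
  assumes "AE x in M. P x"
  shows "AE x in M. P ((\<theta> ^^ k) x)"
  by (rule AE_distrD[OF funpow_measurable]) (simp only: distr_funpow assms)

lemma AE_all_funpow:
  assumes "AE x in M. P x"
  shows "AE x in M. \<forall>k. P ((\<theta> ^^ k) x)"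
  using AE_funpow[OF assms] by (simp add: AE_all_countable)

lemma integrable_shift:
  fixes f :: "'a \<Rightarrow> real"
  assumes "integrable M f"
  shows "integrable M (\<lambda>x. f (\<theta> x))"
  by (rule integrable_distr[OF shift_measurable]) (simp add: measure_preserving assms)

lemma integral_shift:
  fixes f :: "'a \<Rightarrow> real"
  assumes [measurable]: "f \<in> borel_measurable M"
  shows "(\<integral>x. f (\<theta> x) \<partial>M) = (\<integral>x. f x \<partial>M)"
  using integral_distr[OF shift_measurable assms] by (simp add: measure_preserving)

text \<open>This is the maximum of the Birkhoff sums with 1 to \<open>n + 1\<close> terms. The
  recursion peels off the first term, so that comparing with the value at \<open>\<theta> x\<close>
  isolates \<open>f x\<close>.\<close>

primrec max_sums :: "('a \<Rightarrow> real) \<Rightarrow> nat \<Rightarrow> 'a \<Rightarrow> real" where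
  "max_sums f 0 x = f x"
| "max_sums f (Suc n) x = f x + max 0 (max_sums f n (\<theta> x))"

lemma max_sums_mono: "max_sums f n x \<le> max_sums f (Suc n) x"
proof (induction n arbitrary: x)
  case (Suc n)
  show ?case using Suc[of "\<theta> x"] by auto
qed simp

lemma incseq_max_sums: "incseq (\<lambda>n. max_sums f n x)"
  by (intro incseq_SucI max_sums_mono)

lemma sum_le_max_sums: "(\<Sum>k<Suc n. f ((\<theta> ^^ k) x)) \<le> max_sums f n x"
proof (induction n arbitrary: x)
  case (Suc n)
  have "(\<Sum>k<Suc (Suc n). f ((\<theta> ^^ k) x)) = f x + (\<Sum>k<Suc n. f ((\<theta> ^^ k) (\<theta> x)))"
    by (subst sum.lessThan_Suc_shift) (simp add: funpow_Suc_right del: funpow.simps sum.lessThan_Suc)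
  also have "\<dots> \<le> f x + max_sums f n (\<theta> x)" using Suc by simp
  finally show ?case by (simp del: sum.lessThan_Suc)
qed simp

lemma integrable_max_sums:
  assumes "integrable M f"
  shows "integrable M (max_sums f n)"
proof (induction n)
  case 0
  show ?case using assms by (simp add: max_sums.simps(1)[abs_def])
next
  case (Suc n)
  show ?case unfolding max_sums.simps(2)[abs_def]
    by (intro Bochner_Integration.integrable_add assms integrable_max integrable_zero
          integrable_shift[OF Suc])
qed

text \<open>On the invariant event \<open>A\<close> that the partial sums are unbounded, the increments of the running
  maximum along the orbit decrease to \<open>f\<close>, while their integral over \<open>A\<close> is nonnegative.\<close>

lemma sums_bounded_above:
  fixes f :: "'a \<Rightarrow> real"
  assumes f: "integrable M f" and neg: "(\<integral>x. f x \<partial>M) < 0"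
  shows "AE x in M. \<exists>r::nat. \<forall>n. (\<Sum>k<n. f ((\<theta> ^^ k) x)) \<le> r"
proof -
  define A where "A = {x \<in> space M. \<forall>r::nat. \<exists>n. real r < max_sums f n x}"
  have [measurable]: "f \<in> borel_measurable M" using f by simp
  have [measurable]: "max_sums f n \<in> borel_measurable M" for n
    using integrable_max_sums[OF f, of n] by simp
  have A [measurable]: "A \<in> sets M" unfolding A_def by measurable
  have sp: "\<theta> x \<in> space M" if "x \<in> space M" for x
    using measurable_space[OF shift_measurable that] .
  have inv: "\<theta> x \<in> A \<longleftrightarrow> x \<in> A" if x: "x \<in> space M" for x
  proof
    assume a: "\<theta> x \<in> A"
    show "x \<in> A" unfolding A_def
    proof (safe intro!: x)
      fix r :: nat
      obtain s :: nat where "real r - f x \<le> s" using real_arch_simple by blast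
      moreover obtain n where "s < max_sums f n (\<theta> x)" using a unfolding A_def by auto
      ultimately have "real r < max_sums f (Suc n) x" by simp
      then show "\<exists>n. real r < max_sums f n x" by blast
    qed
  next
    assume a: "x \<in> A"
    show "\<theta> x \<in> A" unfolding A_def
    proof (safe intro!: sp x)
      fix r :: nat
      \<comment> \<open>The summand \<open>\<bar>f x\<bar>\<close> rules out the case where the
        inner maximum is 0, since then the running maximum would be just \<open>f x\<close>.\<close>
      obtain s :: nat where s: "real r + \<bar>f x\<bar> \<le> s" using real_arch_simple by blast
      obtain n where n: "s < max_sums f n x" using a unfolding A_def by auto
      have "s < max_sums f (Suc n) x" using n max_sums_mono[of f n x] by linarith
      then have "real r < max_sums f n (\<theta> x)" using s by (auto simp: max_def split: if_splits)
      then show "\<exists>n. real r < max_sums f n (\<theta> x)" by blast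
    qed
  qed
  have "\<theta> -` A \<inter> space M = A" using inv sets.sets_into_space[OF A] by auto
  then have 01: "measure M A \<in> {0,1}" by (rule trivial_invariant[OF A])
  have ind: "indicator A (\<theta> x) = (indicator A x :: real)" if "x \<in> space M" for x
    using inv[OF that] by (auto simp: indicator_def)
  define h where "h n x = indicator A x * (max_sums f (Suc n) x - max_sums f n (\<theta> x))" for n x
  have [measurable]: "h n \<in> borel_measurable M" for n unfolding h_def by measurable
  \<comment> \<open>By invariance of \<open>A\<close> and of the measure, the shifted maximum
    integrates over \<open>A\<close> like the unshifted one, and the running maxima increase with
    \<open>n\<close>.\<close>
  have pos: "0 \<le> (\<integral>x. h n x \<partial>M)" for n
  proof -
    have i1: "integrable M (\<lambda>x. indicator A x * max_sums f k x)" for k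
      by (rule Bochner_Integration.integrable_bound[OF integrable_max_sums[OF f, of k]])
         (auto simp: indicator_def simp del: max_sums.simps)
    have "(\<integral>x. h n x \<partial>M) = (\<integral>x. indicator A x * max_sums f (Suc n) x
            - indicator A (\<theta> x) * max_sums f n (\<theta> x) \<partial>M)"
      by (rule Bochner_Integration.integral_cong) (auto simp: h_def ind algebra_simps simp del: max_sums.simps)
    also have "\<dots> = (\<integral>x. indicator A x * max_sums f (Suc n) x \<partial>M)
        - (\<integral>x. indicator A (\<theta> x) * max_sums f n (\<theta> x) \<partial>M)"
      by (intro Bochner_Integration.integral_diff i1 integrable_shift[where f="\<lambda>x. indicator A x * max_sums f n x"])
    finally have "(\<integral>x. h n x \<partial>M) = \<dots>" .
    moreover have "(\<integral>x. indicator A (\<theta> x) * max_sums f n (\<theta> x) \<partial>M) = (\<integral>x. indicator A x * max_sums f n x \<partial>M)"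
      by (rule integral_shift) measurable
    moreover have "(\<integral>x. indicator A x * max_sums f n x \<partial>M) \<le> (\<integral>x. indicator A x * max_sums f (Suc n) x \<partial>M)"
      by (intro integral_mono i1 mult_left_mono max_sums_mono) auto
    ultimately show ?thesis by (simp only: diff_ge_0_iff_ge)
  qed
  have "(\<lambda>n. \<integral>x. h n x \<partial>M) \<longlonglongrightarrow> (\<integral>x. indicator A x * f x \<partial>M)"
  proof (rule integral_dominated_convergence[where w="\<lambda>x. \<bar>f x\<bar> + \<bar>f (\<theta> x)\<bar>"])
    show "integrable M (\<lambda>x. \<bar>f x\<bar> + \<bar>f (\<theta> x)\<bar>)" using f integrable_shift[OF f] by simp
    show "AE x in M. (\<lambda>n. h n x) \<longlonglongrightarrow> indicator A x * f x"
    proof (rule AE_I2)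
      fix x assume x: "x \<in> space M"
      show "(\<lambda>n. h n x) \<longlonglongrightarrow> indicator A x * f x"
      proof (cases "x \<in> A")
        case True
        then have "\<theta> x \<in> A" using inv x by blast
        then obtain m where m: "0 < max_sums f m (\<theta> x)" unfolding A_def using of_nat_0 by (auto dest: spec[of _ 0])
        have "\<forall>\<^sub>F n in sequentially. h n x = indicator A x * f x"
          using eventually_ge_at_top[of m]
        proof eventually_elim
          case (elim n)
          have "0 < max_sums f n (\<theta> x)" using m incseqD[OF incseq_max_sums elim, of f "\<theta> x"] by linarith
          then show ?case by (simp add: h_def)
        qed
        then show ?thesis by (rule tendsto_eventually)
      qed (simp add: h_def)
    qed
    fix n
    \<comment> \<open>The running maximum dominates its first term, so its negative part is at most
      \<open>\<bar>f (\<theta> x)\<bar>\<close>; this gives an integrable bound independent of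
      \<open>n\<close>.\<close>
    have le: "f (\<theta> x) \<le> max_sums f n (\<theta> x)" for x
      using incseqD[OF incseq_max_sums, of 0 n f "\<theta> x"] by simp
    have *: "\<bar>max 0 (max_sums f n (\<theta> x)) - max_sums f n (\<theta> x)\<bar> \<le> \<bar>f (\<theta> x)\<bar>" for x
      using le[of x] by (auto simp: max_def abs_if)
    have "norm (h n x) \<le> \<bar>f x\<bar> + \<bar>f (\<theta> x)\<bar>" for x
    proof -
      have "norm (h n x) \<le> \<bar>f x + (max 0 (max_sums f n (\<theta> x)) - max_sums f n (\<theta> x))\<bar>"
        by (auto simp: h_def indicator_def)
      also have "\<dots> \<le> \<bar>f x\<bar> + \<bar>f (\<theta> x)\<bar>"
        using * by (intro order_trans[OF abs_triangle_ineq] add_left_mono)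
      finally show ?thesis .
    qed
    then show "AE x in M. norm (h n x) \<le> \<bar>f x\<bar> + \<bar>f (\<theta> x)\<bar>" by simp
  qed simp_all
  then have ge: "0 \<le> (\<integral>x. indicator A x * f x \<partial>M)"
    by (rule LIMSEQ_le_const) (simp add: pos)
  have "measure M A \<noteq> 1"
  proof
    assume "measure M A = 1"
    then have "AE x in M. x \<in> A" using A by (simp add: prob_eq_1)
    then have "(\<integral>x. indicator A x * f x \<partial>M) = (\<integral>x. f x \<partial>M)"
      by (intro integral_cong_AE) auto
    then show False using ge neg by simp
  qed
  then have "measure M A = 0" using 01 by auto
  then have "AE x in M. x \<notin> A" using A by (simp add: prob_eq_0)
  then show ?thesis using AE_space
  proof eventually_elim
    case (elim x)
      then obtain r :: nat where r: "\<And>n. max_sums f n x \<le> r"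
        using elim unfolding A_def by (auto simp: not_less)
      have "(\<Sum>k<n. f ((\<theta> ^^ k) x)) \<le> r" for n
      proof (cases n)
        case (Suc m)
        show ?thesis unfolding Suc by (rule order_trans[OF sum_le_max_sums r])
      qed simp
      then show ?case by blast
  qed
qed

text \<open>Subtracting the mean plus \<open>1 / Suc j\<close> makes the integral negative, so the
  sums stay bounded above and vanish after division by \<open>n\<close>. Letting \<open>j\<close>
  range over the naturals keeps a single null set for all \<open>c\<close>.\<close>

lemma average_le:
  fixes f :: "'a \<Rightarrow> real"
  assumes f: "integrable M f" 
  shows "AE x in M. \<forall>c > (\<integral>x. f x \<partial>M). \<forall>\<^sub>F n in sequentially. (\<Sum>k<n. f ((\<theta> ^^ k) x)) / n < c"
proof -
  let ?I = "\<integral>x. f x \<partial>M"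
  have "AE x in M. \<exists>r::nat. \<forall>n. (\<Sum>k<n. f ((\<theta> ^^ k) x) - (?I + 1 / Suc j)) \<le> r" for j
  proof (rule sums_bounded_above)
    show "integrable M (\<lambda>x. f x - (?I + 1 / Suc j))" using f by simp
    have "(\<integral>x. f x - (?I + 1 / Suc j) \<partial>M) = ?I - (?I + 1 / Suc j)"
      using f by (subst Bochner_Integration.integral_diff) (auto simp: prob_space)
    then show "(\<integral>x. f x - (?I + 1 / Suc j) \<partial>M) < 0" by simp
  qed
  then have "AE x in M. \<forall>j. \<exists>r::nat. \<forall>n. (\<Sum>k<n. f ((\<theta> ^^ k) x) - (?I + 1 / Suc j)) \<le> r"
    by (simp add: AE_all_countable)
  then show ?thesis
  proof eventually_elim
    case (elim x)
    show ?case
    proof (intro allI impI)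
      fix c assume c: "?I < c"
      obtain j where j: "1 / real (Suc j) < c - ?I"
        using c nat_approx_posE[of "c - ?I"] by auto
      obtain r :: nat where r: "\<And>n. (\<Sum>k<n. f ((\<theta> ^^ k) x) - (?I + 1 / Suc j)) \<le> r"
        using elim by blast
      have "(\<lambda>n. ?I + 1 / Suc j + r / real n) \<longlonglongrightarrow> ?I + 1 / Suc j + 0"
        by (intro tendsto_intros lim_const_over_n)
      then have "\<forall>\<^sub>F n in sequentially. ?I + 1 / Suc j + r / real n < c"
        by (rule order_tendstoD) (use j in simp)
      then show "\<forall>\<^sub>F n in sequentially. (\<Sum>k<n. f ((\<theta> ^^ k) x)) / n < c"
        using eventually_gt_at_top[of 0]
      proof eventually_elim
        case (elim n)
        have "(\<Sum>k<n. f ((\<theta> ^^ k) x)) \<le> r + n * (?I + 1 / Suc j)"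
          using r[of n] by (simp add: sum_subtractf)
        then have "(\<Sum>k<n. f ((\<theta> ^^ k) x)) / n \<le> (r + n * (?I + 1 / Suc j)) / n"
          by (rule divide_right_mono) simp
        also have "\<dots> = ?I + 1 / Suc j + r / real n"
          using elim(2) by (subst add_divide_distrib) simp
        finally show ?case using elim(1) by linarith
      qed
    qed
  qed
qed

theorem birkhoff:
  fixes f :: "'a \<Rightarrow> real"
  assumes f: "integrable M f" 
  shows "AE x in M. (\<lambda>n. (\<Sum>k<n. f ((\<theta> ^^ k) x)) / n) \<longlonglongrightarrow> (\<integral>x. f x \<partial>M)"
  using average_le[OF f] average_le[OF integrable_minus[OF f]]
proof eventually_elim
  case (elim x)
  show ?case
  proof (rule order_tendstoI)
    fix a assume "a < (\<integral>x. f x \<partial>M)"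
    then have "\<forall>\<^sub>F n in sequentially. (\<Sum>k<n. - f ((\<theta> ^^ k) x)) / n < - a"
      using elim(2) by simp
    then show "\<forall>\<^sub>F n in sequentially. a < (\<Sum>k<n. f ((\<theta> ^^ k) x)) / n"
      by eventually_elim (simp add: sum_negf)
  qed (use elim(1) in simp)
qed

end

section \<open>Convex functions and the linearization\<close>

text \<open>A chord prolonged to the right stays below the graph. This is how limits at two points
  turn into a lower bound further right, in particular beyond \<open>t_plus\<close>.\<close>

lemma convex_slope_extrapolate:
  fixes f :: "real \<Rightarrow> real"
  assumes "convex_on UNIV f" "r < s" "s < t"
  shows "f s + (t - s) * ((f s - f r) / (s - r)) \<le> f t"
proof -
  have "(f r - f s) / (r - s) \<le> (f s - f t) / (s - t)"
    using convex_on_slope_le[OF assms(1) _ _ assms(2,3)] by (meson UNIV_I order_trans)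
  moreover have "(f r - f s) / (r - s) = (f s - f r) / (s - r)"
    by (metis minus_diff_eq minus_divide_divide)
  moreover have "(f s - f t) / (s - t) = (f t - f s) / (t - s)"
    by (metis minus_diff_eq minus_divide_divide)
  ultimately have "(f s - f r) / (s - r) * (t - s) \<le> f t - f s"
    using assms(3) by (simp add: pos_le_divide_eq)
  then show ?thesis by (simp add: mult.commute)
qed

text \<open>The value of the linearized function at \<open>t > 0\<close> is \<open>t\<close> times the infimum of \<open>L s / s\<close> over
  \<open>0 < s \<le> t\<close>. The quantity \<open>s L' s - L s\<close> is \<open>s\<^sup>2\<close> times the derivative of \<open>L s / s\<close>.\<close>

locale convex_differentiable =
  fixes L :: "real \<Rightarrow> real"
  assumes convex: "convex_on UNIV L"
    and differentiable: "\<And>t. L differentiable (at t)"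
    and L0: "L 0 > 0"
begin

lemma deriv: "(L has_real_derivative deriv L t) (at t)"
  using differentiable[of t] by (simp add: real_differentiable_def DERIV_imp_deriv DERIV_deriv_iff_real_differentiable)

lemma tendsto: "(L \<longlongrightarrow> L t) (at t)"
  using DERIV_isCont[OF deriv] by (simp add: isCont_def)

lemma tangent: "L t + (s - t) * deriv L t \<le> L s"
  using convex_on_imp_above_tangent[OF convex, of t s "deriv L t"] deriv[of t] by (simp add: algebra_simps)

lemma deriv_mono:
  assumes "s \<le> t"
  shows "deriv L s \<le> deriv L t"
proof (cases "s = t")
  case False
  have "0 \<le> (t - s) * (deriv L t - deriv L s)"
    using tangent[of s t] tangent[of t s] by (simp add: algebra_simps)
  then show ?thesis using False assms by (simp add: zero_le_mult_iff)
qed simp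

definition gap :: "real \<Rightarrow> real" where
  "gap t = t * deriv L t - L t"

text \<open>The tangent at \<open>t\<close>, evaluated at \<open>s\<close>, leaves the remainder
  \<open>s * (deriv L t - deriv L s)\<close>, which is nonnegative only for
  \<open>s \<ge> 0\<close>.\<close>

lemma gap_mono:
  assumes "0 \<le> s" "s \<le> t"
  shows "gap s \<le> gap t"
proof -
  have "s * (deriv L t - deriv L s) \<le> gap t - gap s"
    using tangent[of t s] by (simp add: gap_def algebra_simps)
  moreover have "0 \<le> s * (deriv L t - deriv L s)"
    using assms deriv_mono[of s t] by (intro mult_nonneg_nonneg) auto
  ultimately show ?thesis by linarith
qed

lemma ratio_ge_left:
  assumes "gap t \<le> 0" "0 < s" "s \<le> t"
  shows "s * L t \<le> t * L s"
proof -
  have "t * (L t + (s - t) * deriv L t) \<le> t * L s"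
    using tangent[of t s] assms by (intro mult_left_mono) auto
  moreover have "(t - s) * gap t \<le> 0" using assms by (simp add: mult_le_0_iff)
  ultimately show ?thesis by (simp add: gap_def algebra_simps)
qed

lemma ratio_ge_right:
  assumes "gap t \<ge> 0" "0 < t" "t \<le> s"
  shows "s * L t \<le> t * L s"
proof -
  have "t * (L t + (s - t) * deriv L t) \<le> t * L s"
    using tangent[of t s] assms by (intro mult_left_mono) auto
  moreover have "(s - t) * gap t \<ge> 0" using assms by simp
  ultimately show ?thesis by (simp add: gap_def algebra_simps)
qed

text \<open>The tangent at \<open>t\<close>, evaluated at \<open>2 * t\<close>, bounds
  \<open>gap t\<close> by \<open>L (2 * t) - 2 * L t\<close>, which tends to \<open>- L 0\<close>.
  Only continuity of \<open>L\<close> enters, not that of its derivative.\<close>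

lemma gap_negative_near_0: "\<exists>d>0. \<forall>t. 0 < t \<and> t < d \<longrightarrow> gap t < 0"
proof -
  have "gap t \<le> L (2 * t) - 2 * L t" for t
    using tangent[of t "2 * t"] by (simp add: gap_def)
  moreover have "((\<lambda>t. L (2 * t) - 2 * L t) \<longlongrightarrow> L (2 * 0) - 2 * L 0) (at 0)"
    by (intro tendsto_intros isCont_tendsto_compose[OF DERIV_isCont[OF deriv]])
  then have "\<forall>\<^sub>F t in at 0. L (2 * t) - 2 * L t < 0"
    by (rule order_tendstoD) (use L0 in simp)
  then obtain d where "d > 0" "\<And>t. t \<noteq> 0 \<Longrightarrow> dist t 0 < d \<Longrightarrow> L (2 * t) - 2 * L t < 0"
    by (auto simp: eventually_at)
  ultimately have "gap t < 0" if "0 < t" "t < d" for t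
    using le_less_trans[of "gap t" "L (2 * t) - 2 * L t" 0] that by auto
  then show ?thesis using \<open>d > 0\<close> by blast
qed

text \<open>The function \<open>t * L s - s * L t\<close> of \<open>s\<close> vanishes at
  \<open>s = t\<close> and has derivative \<open>gap t\<close> there, so it is negative just to the
  right of \<open>t\<close>.\<close>

lemma gap_negative_imp:
  assumes "gap t < 0" "t > 0"
  shows "\<exists>p>1. p \<le> 2 \<and> L (p * t) < p * L t"
proof -
  have der: "((\<lambda>s. t * L s - s * L t) has_real_derivative t * deriv L t - 1 * L t) (at t)"
    by (intro DERIV_diff DERIV_cmult DERIV_cmult_right DERIV_ident deriv)
  have "t * deriv L t - 1 * L t < 0" using assms by (simp add: gap_def)
  then obtain d where d: "d > 0" "\<And>h. 0 < h \<Longrightarrow> h < d \<Longrightarrow> t * L (t + h) - (t + h) * L t < t * L t - t * L t"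
    using DERIV_neg_dec_right[OF der] by blast
  \<comment> \<open>The multiplier will be \<open>p = 1 + h / t\<close>; capping \<open>h\<close> at
    \<open>t\<close> keeps \<open>p \<le> 2\<close>.\<close>
  define h where "h = min (d / 2) t"
  have h: "0 < h" "h < d" "h \<le> t" using d assms by (auto simp: h_def)
  have "t * L (t + h) < t * ((1 + h / t) * L t)"
  proof -
    have "t * (1 + h / t) = t + h" using assms by (simp add: distrib_left)
    then have eq: "t * ((1 + h / t) * L t) = (t + h) * L t" by (simp only: mult.assoc[symmetric])
    show ?thesis unfolding eq using d(2)[OF h(1,2)] by simp
  qed
  then have "L (t + h) < (1 + h / t) * L t" using assms by simp
  moreover have "(1 + h / t) * t = t + h" using assms by (simp add: distrib_right)
  ultimately show ?thesis
    using h assms by (intro exI[of _ "1 + h / t"]) auto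
qed

lemma le_t_plus:
  assumes "gap t \<le> 0"
  shows "ereal t \<le> t_plus L"
  using assms unfolding t_plus_def gap_def by (intro Sup_upper imageI CollectI)

lemma t_plus_positive: "0 < t_plus L"
proof -
  obtain d where d: "d > 0" "\<And>t. 0 < t \<Longrightarrow> t < d \<Longrightarrow> gap t < 0" using gap_negative_near_0 by blast
  have "ereal (d / 2) \<le> t_plus L"
    using d(2)[of "d / 2"] d(1) by (intro le_t_plus) simp
  moreover have "0 < ereal (d / 2)" using d(1) by simp
  ultimately show ?thesis by (rule less_le_trans[rotated])
qed

lemma gap_below_t_plus:
  assumes "0 \<le> t" "ereal t < t_plus L"
  shows "gap t \<le> 0"
proof -
  obtain s where "gap s \<le> 0" "t < s"
    using assms(2) unfolding t_plus_def less_SUP_iff gap_def by auto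
  then show ?thesis using gap_mono[of t s] assms(1) by simp
qed

lemma gap_above_t_plus:
  assumes "t_plus L < ereal t"
  shows "gap t > 0"
proof (rule ccontr)
  assume "\<not> gap t > 0"
  then have "ereal t \<le> t_plus L"
    by (intro le_t_plus) simp
  then show False using assms by simp
qed

text \<open>The ratio \<open>L x / x\<close> is monotone on each side of \<open>r\<close>. The
  comparison is made at nearby \<open>x\<close> and passed to the limit, because the sign of
  \<open>gap\<close> is known only off \<open>r\<close> at this point.\<close>

lemma min_ratio_at_t_plus:
  assumes r: "t_plus L = ereal r" and s: "s > 0"
  shows "s * L r \<le> r * L s"
proof -
  have r0: "r > 0" using t_plus_positive r by simp
  consider "s = r" | "s < r" | "r < s" by linarith
  then show ?thesis
  proof cases
    case 2
    have "((\<lambda>x. x * L s - s * L x) \<longlongrightarrow> r * L s - s * L r) (at_left r)"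
      by (intro tendsto_intros tendsto_mono[OF at_le tendsto]) auto
    moreover have "\<forall>\<^sub>F x in at_left r. 0 \<le> x * L s - s * L x"
      using eventually_at_left_real[OF 2]
    proof eventually_elim
      case (elim x)
      then show ?case using ratio_ge_left[of x s] gap_below_t_plus[of x] s r by simp
    qed
    ultimately have "0 \<le> r * L s - s * L r"
      by (intro tendsto_lowerbound) auto
    then show ?thesis by simp
  next
    case 3
    have "((\<lambda>x. x * L s - s * L x) \<longlongrightarrow> r * L s - s * L r) (at_right r)"
      by (intro tendsto_intros tendsto_mono[OF at_le tendsto]) auto
    moreover have "\<forall>\<^sub>F x in at_right r. 0 \<le> x * L s - s * L x"
      using eventually_at_right_real[OF 3]
    proof eventually_elim
      case (elim x)
      then show ?case using ratio_ge_right[of x s] gap_above_t_plus[of x] s r r0 by simp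
    qed
    ultimately have "0 \<le> r * L s - s * L r"
      by (intro tendsto_lowerbound) auto
    then show ?thesis by simp
  qed simp
qed

text \<open>\<open>r\<close> is an interior minimum of \<open>L s / s\<close>, in cross-multiplied
  form. Hence the slope of the linear part is the minimal ratio \<open>L r / r\<close>.\<close>

lemma deriv_t_plus:
  assumes r: "t_plus L = ereal r"
  shows "r * deriv L r = L r"
proof -
  have r0: "r > 0" using t_plus_positive r by simp
  have "((\<lambda>s. r * L s - s * L r) has_real_derivative r * deriv L r - 1 * L r) (at r)"
    by (intro DERIV_diff DERIV_cmult DERIV_cmult_right DERIV_ident deriv)
  then have "r * deriv L r - 1 * L r = 0"
    by (rule DERIV_local_min[OF _ r0]) (use min_ratio_at_t_plus[OF r] r0 in auto)
  then show ?thesis by simp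
qed

text \<open>The part of \<open>linearized\<close> that concerns positive \<open>t\<close>; negative
  \<open>t\<close> are reduced to it by reflecting \<open>L\<close>.\<close>

definition right_value :: "real \<Rightarrow> real" where
  "right_value t = (if ereal t < t_plus L then L t else t * deriv L (real_of_ereal (t_plus L)))"

lemma right_value_le:
  assumes "0 < s" "s \<le> t"
  shows "s * right_value t \<le> t * L s"
proof (cases "ereal t < t_plus L")
  case True
  then show ?thesis using ratio_ge_left[of t s] gap_below_t_plus[of t] assms by (simp add: right_value_def)
next
  case False
  then obtain r where r: "t_plus L = ereal r" using t_plus_positive by (cases "t_plus L") auto
  have r0: "r > 0" using t_plus_positive r by simp
  have "s * (r * deriv L r) \<le> r * L s"
    using min_ratio_at_t_plus[OF r assms(1)] deriv_t_plus[OF r] by simp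
  then have "r * (s * deriv L r) \<le> r * L s" by (simp add: algebra_simps)
  then have "s * deriv L r \<le> L s" using r0 by simp
  then have "t * (s * deriv L r) \<le> t * L s" using assms by (intro mult_left_mono) auto
  then show ?thesis using False r by (simp add: right_value_def algebra_simps)
qed

text \<open>The infimum of \<open>t / s * L s\<close> is attained at \<open>t\<close> or at
  \<open>t_plus\<close>, and continuity allows a rational \<open>s\<close> slightly to the left.
  Rationality matters because almost sure bounds are available only for countably many
  parameters.\<close>

lemma right_value_approx:
  assumes "0 < t" "right_value t < c"
  shows "\<exists>s\<in>\<rat>. 0 < s \<and> s \<le> t \<and> t / s * L s < c"
proof -
  define u where "u = (if ereal t < t_plus L then t else real_of_ereal (t_plus L))"
  have u: "0 < u \<and> u \<le> t \<and> t / u * L u = right_value t"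
  proof (cases "ereal t < t_plus L")
    case True
    then show ?thesis using assms by (simp add: u_def right_value_def)
  next
    case False
    then obtain r where r: "t_plus L = ereal r" using t_plus_positive by (cases "t_plus L") auto
    have r0: "r > 0" using t_plus_positive r by simp
    then show ?thesis using False r deriv_t_plus[OF r] 
      by (auto simp add: u_def right_value_def field_simps)
  qed
  have "((\<lambda>s. t / s * L s) \<longlongrightarrow> t / u * L u) (at_left u)"
    using u by (intro tendsto_intros tendsto_mono[OF at_le tendsto]) auto
  then have "\<forall>\<^sub>F s in at_left u. t / s * L s < c"
    by (rule order_tendstoD) (use assms u in simp)
  then have "\<forall>\<^sub>F s in at_left u. t / s * L s < c \<and> 0 < s"
    using eventually_at_left_real[of 0 u] u by (auto elim: eventually_elim2)
  then obtain b where b: "b < u" "\<And>s. b < s \<Longrightarrow> s < u \<Longrightarrow> t / s * L s < c \<and> 0 < s"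
    by (auto simp: eventually_at_left_field)
  obtain s where "s \<in> \<rat>" "b < s" "s < u" using Rats_dense_in_real[OF b(1)] by auto
  then show ?thesis using b u by (intro bexI[of _ s]) auto
qed

text \<open>\<open>t_plus\<close> is not a suitable point of tangency: \<open>gap\<close> may vanish
  on an interval to its left, while the lower bound needs \<open>gap < 0\<close> strictly. So
  \<open>u\<close> is the left end of the set where \<open>gap\<close> is nonnegative, or
  \<open>t\<close> if that set does not meet (0, t).\<close>

lemma right_value_tangent:
  assumes t: "0 < t"
  shows "\<exists>u. 0 < u \<and> u \<le> t \<and> (\<forall>s. 0 < s \<and> s < u \<longrightarrow> gap s < 0) \<and>
           right_value t \<le> L u + (t - u) * deriv L u"
proof (cases "\<forall>s. 0 < s \<and> s < t \<longrightarrow> gap s < 0")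
  case True
  then show ?thesis using t right_value_le[of t t] by (intro exI[of _ t]) auto
next
  case False
  then obtain s1 where s1: "0 < s1" "s1 < t" "gap s1 \<ge> 0" by force
  define u where "u = Inf {s. 0 < s \<and> gap s \<ge> 0}"
  obtain d where d: "d > 0" "\<And>s. 0 < s \<Longrightarrow> s < d \<Longrightarrow> gap s < 0" using gap_negative_near_0 by blast
  have bdd: "bdd_below {s. 0 < s \<and> gap s \<ge> 0}" by (rule bdd_belowI[of _ 0]) auto
  have "d \<le> u" unfolding u_def
    by (rule cInf_greatest) (use s1 d in \<open>auto simp: not_less[symmetric]\<close>)
  then have u0: "0 < u" using d by simp
  have ut: "u \<le> s1" unfolding u_def using s1 bdd by (intro cInf_lower) auto
  have below: "gap s < 0" if "0 < s" "s < u" for s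
    using cInf_lower[OF _ bdd, of s] that unfolding u_def by force
  have above: "gap s \<ge> 0" if s: "u < s" for s
  proof -
    obtain s' where "0 < s'" "gap s' \<ge> 0" "s' < s"
      using cInf_lessD[of "{s. 0 < s \<and> gap s \<ge> 0}" s] s s1 unfolding u_def by blast
    then show ?thesis using gap_mono[of s' s] by simp
  qed
  have right: "0 \<le> u * L s - s * L u" if s: "u < s" for s
  proof -
    have "((\<lambda>x. x * L s - s * L x) \<longlongrightarrow> u * L s - s * L u) (at_right u)"
      by (intro tendsto_intros tendsto_mono[OF at_le tendsto]) auto
    moreover have "\<forall>\<^sub>F x in at_right u. 0 \<le> x * L s - s * L x"
      using eventually_at_right_real[OF s]
    proof eventually_elim
      case (elim x)
      then show ?case using ratio_ge_right[of x s] above[of x] u0 by simp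
    qed
    ultimately show ?thesis by (intro tendsto_lowerbound) auto
  qed
  have der: "((\<lambda>s. u * L s - s * L u) has_real_derivative u * deriv L u - 1 * L u) (at u)"
    by (intro DERIV_diff DERIV_cmult DERIV_cmult_right DERIV_ident deriv)
  have "0 \<le> u * deriv L u - 1 * L u"
  proof (rule ccontr)
    assume "\<not> ?thesis"
    then obtain h where "h > 0" "\<And>x. 0 < x \<Longrightarrow> x < h \<Longrightarrow> u * L (u + x) - (u + x) * L u < u * L u - u * L u"
      using DERIV_neg_dec_right[OF der] by force
    then show False using right[of "u + h / 2"] by (force dest: spec[of _ "h/2"])
  qed
  then have "(t - u) * L u \<le> (t - u) * (u * deriv L u)"
    using ut s1 by (intro mult_left_mono) auto
  then have "u * right_value t \<le> u * (L u + (t - u) * deriv L u)"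
    using right_value_le[of u t] u0 ut s1 by (simp add: algebra_simps)
  then have "right_value t \<le> L u + (t - u) * deriv L u" using u0 by simp
  then show ?thesis using u0 ut s1 below by (intro exI[of _ u]) auto
qed

text \<open>The tangent at \<open>u\<close> is replaced by a chord through rational points below
  \<open>u\<close>, where convergence can be established directly.\<close>

lemma right_value_slope:
  assumes t: "0 < t" and c: "c < right_value t"
  shows "\<exists>r\<in>\<rat>. \<exists>s\<in>\<rat>. 0 < r \<and> r < s \<and> s < t \<and> gap r < 0 \<and> gap s < 0 \<and>
           c < L s + (t - s) * ((L s - L r) / (s - r))"
proof -
  obtain u where u: "0 < u" "u \<le> t" "\<And>s. 0 < s \<Longrightarrow> s < u \<Longrightarrow> gap s < 0"
    and ru: "right_value t \<le> L u + (t - u) * deriv L u"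
    using right_value_tangent[OF t] by blast
  have "((\<lambda>r. (L r - L u) / (r - u)) \<longlongrightarrow> deriv L u) (at_left u)"
    using deriv[of u] unfolding has_field_derivative_iff by (rule tendsto_mono[OF at_le, rotated]) simp
  then have "((\<lambda>r. L u + (t - u) * ((L r - L u) / (r - u))) \<longlongrightarrow> L u + (t - u) * deriv L u) (at_left u)"
    by (intro tendsto_intros)
  then have "\<forall>\<^sub>F r in at_left u. c < L u + (t - u) * ((L r - L u) / (r - u))"
    by (rule order_tendstoD) (use c ru in simp)
  then obtain b where b: "b < u" "\<And>r. b < r \<Longrightarrow> r < u \<Longrightarrow> c < L u + (t - u) * ((L r - L u) / (r - u))"
    by (auto simp: eventually_at_left_field)
  obtain r where r: "r \<in> \<rat>" "max b 0 < r" "r < u" using Rats_dense_in_real[of "max b 0" u] b u by auto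
  \<comment> \<open>With \<open>r\<close> fixed, the second node moves from \<open>u\<close> to a
    rational \<open>s < u\<close> by continuity.\<close>
  have "((\<lambda>s. L s + (t - s) * ((L s - L r) / (s - r))) \<longlongrightarrow> L u + (t - u) * ((L u - L r) / (u - r))) (at_left u)"
    using r by (intro tendsto_intros tendsto_mono[OF at_le tendsto]) auto
  moreover have "(L u - L r) / (u - r) = (L r - L u) / (r - u)"
    by (metis minus_diff_eq minus_divide_divide)
  ultimately have "\<forall>\<^sub>F s in at_left u. c < L s + (t - s) * ((L s - L r) / (s - r))"
    using b(2)[of r] r by (intro order_tendstoD) auto
  then obtain b' where b': "b' < u" "\<And>s. b' < s \<Longrightarrow> s < u \<Longrightarrow> c < L s + (t - s) * ((L s - L r) / (s - r))"
    by (auto simp: eventually_at_left_field)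
  obtain s where s: "s \<in> \<rat>" "max b' r < s" "s < u" using Rats_dense_in_real[of "max b' r" u] b' r by auto
  show ?thesis
    using r s u b' by (intro bexI[of _ r] bexI[of _ s]) auto
qed

text \<open>Here \<open>f n\<close> stands for the normalized logarithm of the partition function.
  Upper bounds are carried from \<open>s\<close> to \<open>t \<ge> s\<close> by
  \<open>scale\<close>, lower bounds by convexity of \<open>f n\<close>; both start from rational
  parameters.\<close>

theorem tendsto_right_value:
  fixes f :: "nat \<Rightarrow> real \<Rightarrow> real"
  assumes convex_f: "\<And>n. convex_on UNIV (f n)"
    and upper: "\<And>t c. t \<in> \<rat> \<Longrightarrow> L t < c \<Longrightarrow> \<forall>\<^sub>F n in sequentially. f n t < c"
    and lower: "\<And>t p c. t \<in> \<rat> \<Longrightarrow> 1 < p \<Longrightarrow> p \<le> 2 \<Longrightarrow> L (p * t) < p * L t \<Longrightarrow> c < L t \<Longrightarrow>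
        \<forall>\<^sub>F n in sequentially. c < f n t"
    and scale: "\<And>n t q. 1 \<le> q \<Longrightarrow> f n (q * t) \<le> q * f n t"
    and t: "0 < t"
  shows "(\<lambda>n. f n t) \<longlonglongrightarrow> right_value t"
proof (rule order_tendstoI)
  fix c assume "right_value t < c"
  then obtain s where s: "s \<in> \<rat>" "0 < s" "s \<le> t" "t / s * L s < c"
    using right_value_approx[OF t] by blast
  have "L s < c * (s / t)" using s t by (simp add: field_simps)
  from upper[OF s(1) this] show "\<forall>\<^sub>F n in sequentially. f n t < c"
  proof eventually_elim
    case (elim n)
    have "f n t \<le> t / s * f n s" using scale[of "t / s" n s] s by simp
    also have "\<dots> < t / s * (c * (s / t))" using elim s t by (intro mult_strict_left_mono) auto
    also have "\<dots> = c" using s t by simp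
    finally show ?case .
  qed
next
  fix c assume "c < right_value t"
  then obtain r s where rs: "r \<in> \<rat>" "s \<in> \<rat>" "0 < r" "r < s" "s < t" "gap r < 0" "gap s < 0"
      "c < L s + (t - s) * ((L s - L r) / (s - r))"
    using right_value_slope[OF t] by blast
  have lim: "(\<lambda>n. f n x) \<longlonglongrightarrow> L x" if x: "x \<in> \<rat>" "0 < x" "gap x < 0" for x
  proof -
    obtain p where p: "1 < p" "p \<le> 2" "L (p * x) < p * L x" using gap_negative_imp[OF x(3,2)] by blast
    show ?thesis
      by (rule order_tendstoI) (use upper lower[OF _ p] x in auto)
  qed
  have "(\<lambda>n. f n s + (t - s) * ((f n s - f n r) / (s - r))) \<longlonglongrightarrow> L s + (t - s) * ((L s - L r) / (s - r))"
    using rs by (intro tendsto_intros lim) auto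
  then have "\<forall>\<^sub>F n in sequentially. c < f n s + (t - s) * ((f n s - f n r) / (s - r))"
    by (rule order_tendstoD) (use rs in simp)
  then show "\<forall>\<^sub>F n in sequentially. c < f n t"
    by eventually_elim (use convex_slope_extrapolate[OF convex_f rs(4,5)] in \<open>auto intro: less_le_trans\<close>)
qed

end

section \<open>Reflection and negative parameters\<close>

lemma t_plus_reflect:
  assumes "\<And>t. L differentiable (at t)"
  shows "deriv (\<lambda>t. L (- t)) t = - deriv L (- t)" "t_plus (\<lambda>t. L (- t)) = - t_minus L"
proof -
  have "(L has_real_derivative deriv L x) (at x)" for x
    using assms[of x] by (simp add: DERIV_deriv_iff_real_differentiable)
  then have "((\<lambda>t. L (- t)) has_real_derivative deriv L (- x) * (- 1)) (at x)" for x
    by (intro DERIV_chain'[where g=L and f=uminus] DERIV_minus DERIV_ident)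
  from DERIV_imp_deriv[OF this] show d: "deriv (\<lambda>t. L (- t)) t = - deriv L (- t)" for t by simp
  have "{t. t * deriv (\<lambda>t. L (- t)) t - L (- t) \<le> 0} = uminus ` {t. t * deriv L t - L t \<le> 0}"
    unfolding d by (auto simp: image_iff intro!: bexI[of _ "- _"] exI[of _ "- _"])
  then show "t_plus (\<lambda>t. L (- t)) = - t_minus L"
    unfolding t_plus_def t_minus_def ereal_Inf_uminus_image_eq
    by (simp add: image_image ereal_Sup_uminus_image_eq[symmetric])
qed

lemma convex_on_reflect:
  fixes f :: "real \<Rightarrow> real"
  assumes "convex_on UNIV f"
  shows "convex_on UNIV (\<lambda>t. f (- t))"
proof (rule convex_onI)
  fix t x y :: real assume "0 < t" "t < 1"
  then show "f (- ((1 - t) *\<^sub>R x + t *\<^sub>R y)) \<le> (1 - t) * f (- x) + t * f (- y)"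
    using convex_onD[OF assms, of t "- x" "- y"] by (simp add: algebra_simps)
qed simp

context convex_differentiable
begin

lemma reflect: "convex_differentiable (\<lambda>t. L (- t))"
proof
  show "(\<lambda>t. L (- t)) differentiable (at t)" for t
    using differentiable_compose[of L uminus t UNIV] differentiable[of "- t"] by simp
qed (use convex_on_reflect[OF convex] L0 in auto)

lemma linearized_eq:
  shows "0 < t \<Longrightarrow> linearized L t = right_value t"
    and "linearized L 0 = L 0"
    and "t < 0 \<Longrightarrow> linearized L t = convex_differentiable.right_value (\<lambda>t. L (- t)) (- t)"
proof -
  interpret R: convex_differentiable "\<lambda>t. L (- t)" by (rule reflect)
  note refl = t_plus_reflect[OF differentiable]
  have p: "0 < t_plus L" by (rule t_plus_positive)
  have m: "t_minus L < 0"
    using R.t_plus_positive unfolding refl by (simp add: ereal_less_uminus_reorder)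
  show "linearized L t = right_value t" if "0 < t"
  proof -
    have "t_minus L < ereal t" using m that by (meson ereal_less(2) less_trans)
    then show ?thesis unfolding linearized_def right_value_def by (auto simp: not_less)
  qed
  show "linearized L 0 = L 0" using p m by (simp add: linearized_def zero_ereal_def[symmetric])
  show "linearized L t = R.right_value (- t)" if "t < 0"
  proof -
    have "ereal t < t_plus L" using p that by (metis ereal_less(3) less_trans zero_ereal_def ereal_less_eq(3) not_less)
    moreover have "t_minus L < ereal t \<longleftrightarrow> ereal (- t) < - t_minus L"
      by (metis ereal_uminus_less_reorder uminus_ereal.simps(1) ereal_less_uminus_reorder ereal_uminus_uminus)
    ultimately show ?thesis
      unfolding linearized_def R.right_value_def refl
      by (auto simp: not_less real_of_ereal_minus)
  qed
qed

theorem tendsto_linearized: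
  fixes f :: "nat \<Rightarrow> real \<Rightarrow> real"
  assumes convex_f: "\<And>n. convex_on UNIV (f n)"
    and upper: "\<And>t c. t \<in> \<rat> \<Longrightarrow> L t < c \<Longrightarrow> \<forall>\<^sub>F n in sequentially. f n t < c"
    and lower: "\<And>t p c. t \<in> \<rat> \<Longrightarrow> 1 < p \<Longrightarrow> p \<le> 2 \<Longrightarrow> L (p * t) < p * L t \<Longrightarrow> c < L t \<Longrightarrow>
        \<forall>\<^sub>F n in sequentially. c < f n t"
    and scale: "\<And>n t q. 1 \<le> q \<Longrightarrow> f n (q * t) \<le> q * f n t"
  shows "(\<lambda>n. f n t) \<longlonglongrightarrow> linearized L t"
proof -
  interpret R: convex_differentiable "\<lambda>t. L (- t)" by (rule reflect)
  consider "0 < t" | "t = 0" | "t < 0" by linarith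
  then show ?thesis
  proof cases
    case 1
    show ?thesis unfolding linearized_eq(1)[OF 1]
      by (rule tendsto_right_value[OF convex_f upper lower scale 1])
  next
    case 2
    \<comment> \<open>At 0 the condition for the lower bound holds with \<open>p = 2\<close>, since
      it reads \<open>L 0 < 2 * L 0\<close>.\<close>
    have "(\<lambda>n. f n 0) \<longlonglongrightarrow> L 0"
      by (rule order_tendstoI) (use upper lower[of 0 2] L0 in auto)
    then show ?thesis using 2 by (simp add: linearized_eq(2))
  next
    case 3
    have "(\<lambda>n. f n (- (- t))) \<longlonglongrightarrow> R.right_value (- t)"
    proof (rule R.tendsto_right_value[where f="\<lambda>n t. f n (- t)"])
      show "convex_on UNIV (\<lambda>t. f n (- t))" for n by (rule convex_on_reflect[OF convex_f])
      show "\<And>t c. t \<in> \<rat> \<Longrightarrow> L (- t) < c \<Longrightarrow> \<forall>\<^sub>F n in sequentially. f n (- t) < c"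
        by (rule upper) auto
      show "\<And>t p c. t \<in> \<rat> \<Longrightarrow> 1 < p \<Longrightarrow> p \<le> 2 \<Longrightarrow> L (- (p * t)) < p * L (- t) \<Longrightarrow> c < L (- t) \<Longrightarrow>
        \<forall>\<^sub>F n in sequentially. c < f n (- t)"
        by (rule lower) auto
      show "f n (- (q * t)) \<le> q * f n (- t)" if "1 \<le> q" for n t q
        using scale[OF that, of n "- t"] by simp
    qed (use 3 in simp)
    then show ?thesis by (simp add: linearized_eq(3)[OF 3])
  qed
qed

end

section \<open>Power sums, log-convexity and differentiation under the integral\<close>

lemma sum_powr_le_powr_sum:
  fixes a :: "'a \<Rightarrow> real"
  assumes fin: "finite A" and nn: "\<And>i. i \<in> A \<Longrightarrow> 0 \<le> a i" and q: "1 \<le> q"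
  shows "(\<Sum>i\<in>A. a i powr q) \<le> (\<Sum>i\<in>A. a i) powr q"
proof -
  let ?s = "\<Sum>i\<in>A. a i"
  \<comment> \<open>One factor \<open>a i\<close> is kept and the remaining power is bounded through
    the total; summing the kept factors restores the missing power of the total.\<close>
  have "a i powr q \<le> a i * ?s powr (q - 1)" if i: "i \<in> A" for i
  proof (cases "a i = 0")
    case False
    then have "0 < a i" using nn[OF i] by simp
    then have "a i powr q = a i * a i powr (q - 1)" by (simp add: powr_mult_base)
    also have "\<dots> \<le> a i * ?s powr (q - 1)"
      using nn[OF i] q member_le_sum[OF i, of a] nn fin by (intro mult_left_mono powr_mono2) auto
    finally show ?thesis .
  qed simp
  then have "(\<Sum>i\<in>A. a i powr q) \<le> (\<Sum>i\<in>A. a i * ?s powr (q - 1))" by (intro sum_mono)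
  also have "\<dots> = ?s * ?s powr (q - 1)" by (simp add: sum_distrib_right)
  also have "\<dots> = ?s powr q" using sum_nonneg[OF nn, of A] by (simp add: powr_mult_base)
  finally show ?thesis .
qed

text \<open>An interpolation between \<open>\<ell>\<^sup>2\<close> and \<open>\<ell>\<^sup>p\<close> that is linear in the \<open>p\<close>-th powers, so that it can
  be integrated without Jensen's inequality.\<close>

lemma sqrt_sum_squares_le:
  fixes a :: "'a \<Rightarrow> real"
  assumes fin: "finite A" and nn: "\<And>i. i \<in> A \<Longrightarrow> 0 \<le> a i" and p: "1 \<le> p" "p \<le> 2" and d: "0 < d"
  shows "sqrt (\<Sum>i\<in>A. (a i)\<^sup>2) \<le> d + d powr (1 - p) * (\<Sum>i\<in>A. a i powr p)"
proof -
  let ?y = "\<Sum>i\<in>A. a i powr p"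
  have y: "0 \<le> ?y" by (intro sum_nonneg) auto
  have "(a i)\<^sup>2 = (a i powr p) powr (2 / p)" if "i \<in> A" for i
    using nn[OF that] p by (simp add: powr_powr)
  then have "(\<Sum>i\<in>A. (a i)\<^sup>2) \<le> ?y powr (2 / p)"
    using sum_powr_le_powr_sum[OF fin, of "\<lambda>i. a i powr p" "2 / p"] p by simp
  also have "\<dots> = (?y powr (1 / p))\<^sup>2" by (simp add: powr_powr flip: powr_numeral)
  finally have "sqrt (\<Sum>i\<in>A. (a i)\<^sup>2) \<le> ?y powr (1 / p)" by (simp add: real_le_lsqrt sum_nonneg)
  also have "\<dots> \<le> d + d powr (1 - p) * ?y"
  proof (cases "?y \<le> d powr p")
    case True
    then have "?y powr (1 / p) \<le> (d powr p) powr (1 / p)" using y p by (intro powr_mono2) auto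
    also have "\<dots> = d" using p d by (simp add: powr_powr)
    finally show ?thesis using y by (simp add: add_increasing2)
  next
    case False
    then have yd: "d powr p < ?y" by simp
    have y0: "0 < ?y" using yd by (rule le_less_trans[rotated]) simp
    have "?y powr (1 / p) = ?y powr (1 / p - 1) * ?y" using y0 by (simp add: powr_diff)
    \<comment> \<open>The exponent \<open>1 / p - 1\<close> is nonpositive, so the lower bound on
      the power sum becomes an upper bound here.\<close>
    also have "?y powr (1 / p - 1) \<le> (d powr p) powr (1 / p - 1)"
      using yd p d by (intro powr_mono2') auto
    also have "(d powr p) powr (1 / p - 1) = d powr (1 - p)" using p by (simp add: powr_powr algebra_simps)
    finally show ?thesis using y d by (simp add: mult_right_mono add_increasing)
  qed
  finally show ?thesis .
qed

lemma convex_on_sum_fun: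
  assumes "finite A" "\<And>i. i \<in> A \<Longrightarrow> convex_on S (f i)" "convex S"
  shows "convex_on S (\<lambda>x. \<Sum>i\<in>A. f i x)"
  using assms by (induction A) (auto simp: convex_on_const intro!: convex_on_add)

lemma convex_on_exp_linear: "convex_on UNIV (\<lambda>t::real. exp (t * x + c))"
proof (rule convex_onI)
  fix t u v :: real assume "0 < t" "t < 1"
  moreover have "((1 - t) *\<^sub>R u + t *\<^sub>R v) * x + c = (1 - t) *\<^sub>R (u * x + c) + t *\<^sub>R (v * x + c)"
    by (simp add: algebra_simps)
  ultimately show "exp (((1 - t) *\<^sub>R u + t *\<^sub>R v) * x + c) \<le> (1 - t) * exp (u * x + c) + t * exp (v * x + c)"
    using convex_onD[OF exp_convex, of t "u * x + c" "v * x + c"] by simp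
qed simp

text \<open>The exponential tilt reduces the inequality to the case where \<open>F\<close> has the same value at both
  end points.\<close>

lemma convex_on_ln:
  fixes F :: "real \<Rightarrow> real"
  assumes conv: "\<And>c. convex_on UNIV (\<lambda>t. exp (t * c) * F t)" and pos: "\<And>t. 0 < F t"
  shows "convex_on UNIV (\<lambda>t. ln (F t))"
proof (rule convex_onI)
  fix t x y :: real assume t: "0 < t" "t < 1"
  show "ln (F ((1 - t) *\<^sub>R x + t *\<^sub>R y)) \<le> (1 - t) * ln (F x) + t * ln (F y)"
  proof (cases "x = y")
    case True
    then show ?thesis by (simp add: algebra_simps)
  next
    case False
    define c where "c = (ln (F y) - ln (F x)) / (x - y)"
    define z where "z = (1 - t) *\<^sub>R x + t *\<^sub>R y"
    define v where "v = exp (x * c) * F x"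
    have eq: "x * c + ln (F x) = y * c + ln (F y)" using False by (simp add: c_def field_simps)
    have v: "v = exp (y * c) * F y"
      using arg_cong[OF eq, of exp] pos[of x] pos[of y] by (simp add: v_def exp_add)
    have v0: "0 < v" using pos by (simp add: v_def)
    have "exp (z * c) * F z \<le> (1 - t) * v + t * v"
      using convex_onD[OF conv[of c], of t x y] t unfolding z_def v_def[symmetric] v[symmetric] by simp
    then have "exp (z * c) * F z \<le> v" by (simp add: algebra_simps)
    then have "ln (exp (z * c) * F z) \<le> ln v" using pos v0 by simp
    then have "z * c + ln (F z) \<le> x * c + ln (F x)" using pos[of z] pos[of x] by (simp add: v_def ln_mult)
    moreover have "x * c + ln (F x) = (1 - t) * (x * c + ln (F x)) + t * (y * c + ln (F y))"
      using eq by (simp add: algebra_simps)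
    ultimately show ?thesis unfolding z_def[symmetric] by (simp add: z_def algebra_simps)
  qed
qed simp

text \<open>Difference quotients with step in [-1, 1] lie between the slopes over [t - 1, t] and
  [t, t + 1]. The bound is free of \<open>h\<close> and serves as a dominating function.\<close>

lemma convex_difference_quotient_bound:
  fixes f :: "real \<Rightarrow> real"
  assumes f: "convex_on UNIV f" and h: "h \<noteq> 0" "\<bar>h\<bar> \<le> 1"
  shows "\<bar>(f (t + h) - f t) / h\<bar> \<le> \<bar>f (t + 1) - f t\<bar> + \<bar>f t - f (t - 1)\<bar>"
proof -
  have up: "f (t + k) - f t \<le> k * (f (t + 1) - f t)" if "0 \<le> k" "k \<le> 1" for k
    using convex_onD[OF f, of k t "t + 1"] that by (simp add: algebra_simps)
  have down: "f (t - k) - f t \<le> k * (f (t - 1) - f t)" if "0 \<le> k" "k \<le> 1" for k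
    using convex_onD[OF f, of k t "t - 1"] that by (simp add: algebra_simps)
  have mid: "2 * f t \<le> f (t + k) + f (t - k)" for k
  proof -
    have "(1 - 1 / 2) *\<^sub>R (t + k) + (1 / 2) *\<^sub>R (t - k) = t" by (simp add: field_simps)
    then show ?thesis using convex_onD[OF f, of "1/2" "t + k" "t - k"] by simp
  qed
  show ?thesis
  proof (cases "0 < h")
    case True
    have "(f (t + h) - f t) / h \<le> f (t + 1) - f t"
      using up[of h] h True by (simp add: pos_divide_le_eq mult.commute)
    moreover have "h * (f t - f (t - 1)) \<le> f (t + h) - f t"
      using down[of h] mid[of h] h True by (simp add: algebra_simps)
    then have "f t - f (t - 1) \<le> (f (t + h) - f t) / h"
      using True by (simp add: pos_le_divide_eq mult.commute)
    ultimately show ?thesis by linarith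
  next
    case False
    define k where "k = - h"
    have k: "0 < k" "k \<le> 1" using False h by (auto simp: k_def)
    have q: "(f (t + h) - f t) / h = (f t - f (t - k)) / k"
      unfolding k_def by (metis add_uminus_conv_diff minus_diff_eq minus_divide_divide minus_minus)
    have "f t - f (t - k) \<le> k * (f (t + 1) - f t)"
      using up[of k] mid[of k] k by simp
    then have "(f t - f (t - k)) / k \<le> f (t + 1) - f t"
      using k by (simp add: pos_divide_le_eq mult.commute)
    moreover have "k * (f t - f (t - 1)) \<le> f t - f (t - k)"
      using down[of k] k by (simp add: algebra_simps)
    then have "f t - f (t - 1) \<le> (f t - f (t - k)) / k"
      using k by (simp add: pos_le_divide_eq mult.commute)
    ultimately show ?thesis unfolding q by linarith
  qed
qed

lemma convex_on_integral:
  fixes F :: "real \<Rightarrow> 'a \<Rightarrow> real"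
  assumes int: "\<And>t. integrable M (F t)" and conv: "AE x in M. convex_on UNIV (\<lambda>t. F t x)"
  shows "convex_on UNIV (\<lambda>t. \<integral>x. F t x \<partial>M)"
proof (rule convex_onI)
  fix t u v :: real assume t: "0 < t" "t < 1"
  have "(\<integral>x. F ((1 - t) *\<^sub>R u + t *\<^sub>R v) x \<partial>M) \<le> (\<integral>x. (1 - t) * F u x + t * F v x \<partial>M)"
  proof (rule integral_mono_AE)
    show "AE x in M. F ((1 - t) *\<^sub>R u + t *\<^sub>R v) x \<le> (1 - t) * F u x + t * F v x"
      using conv
    proof eventually_elim
      case (elim x)
      show ?case using convex_onD[OF elim, of t u v] t by simp
    qed
  qed (use int in auto)
  then show "(\<integral>x. F ((1 - t) *\<^sub>R u + t *\<^sub>R v) x \<partial>M) \<le> (1 - t) * (\<integral>x. F u x \<partial>M) + t * (\<integral>x. F v x \<partial>M)"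
    using int by simp
qed simp

text \<open>Convexity supplies the domination needed to differentiate under the integral: the
  difference quotients are controlled by the integrable values of \<open>F\<close> at
  \<open>t - 1\<close>, \<open>t\<close> and \<open>t + 1\<close>.\<close>

lemma differentiable_integral_convex:
  fixes F :: "real \<Rightarrow> 'a \<Rightarrow> real"
  assumes int: "\<And>t. integrable M (F t)" and conv: "AE x in M. convex_on UNIV (\<lambda>t. F t x)"
    and diff: "AE x in M. (\<lambda>t. F t x) differentiable (at t)"
  shows "(\<lambda>t. \<integral>x. F t x \<partial>M) differentiable (at t)"
proof -
  have [measurable]: "F t \<in> borel_measurable M" for t using int by simp
  define q where "q h x = (F (t + h) x - F t x) / h" for h x
  have [measurable]: "q h \<in> borel_measurable M" for h unfolding q_def by measurable
  \<comment> \<open>Defining the derivative as a limit along one sequence makes its measurability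
    immediate; almost everywhere it agrees with the limit over all \<open>h\<close>.\<close>
  define D where "D x = lim (\<lambda>n. q (1 / Suc n) x)" for x
  have [measurable]: "D \<in> borel_measurable M" unfolding D_def by measurable
  have lim: "AE x in M. ((\<lambda>h. q h x) \<longlongrightarrow> D x) (at 0)"
    using diff
  proof eventually_elim
    case (elim x)
    then obtain d where "((\<lambda>t. F t x) has_real_derivative d) (at t)"
      by (auto simp: real_differentiable_def)
    then have d: "((\<lambda>h. q h x) \<longlongrightarrow> d) (at 0)" unfolding q_def DERIV_def .
    have "filterlim (\<lambda>n. 1 / real (Suc n)) (at 0) sequentially"
      using LIMSEQ_inverse_real_of_nat by (auto simp: filterlim_at inverse_eq_divide)
    from filterlim_compose[OF d this] have "D x = d" unfolding D_def by (rule limI)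
    then show ?case using d by simp
  qed
  have "((\<lambda>h. \<integral>x. q h x \<partial>M) \<longlongrightarrow> (\<integral>x. D x \<partial>M)) (at 0)"
    unfolding tendsto_at_iff_sequentially comp_def
  proof (intro allI impI)
    fix X :: "nat \<Rightarrow> real" assume X: "\<forall>i. X i \<in> UNIV - {0}" "X \<longlonglongrightarrow> 0"
    from X(2) have "\<forall>\<^sub>F n in sequentially. \<bar>X n\<bar> < 1"
      by (intro order_tendstoD(2)[OF tendsto_rabs_zero]) auto
    then obtain N where N: "\<And>n. N \<le> n \<Longrightarrow> \<bar>X n\<bar> < 1" by (auto simp: eventually_sequentially)
    have flim: "filterlim X (at 0) sequentially" using X by (simp add: filterlim_at)
    show "(\<lambda>n. \<integral>x. q (X n) x \<partial>M) \<longlonglongrightarrow> (\<integral>x. D x \<partial>M)"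
    proof (rule LIMSEQ_offset[where k=N], rule integral_dominated_convergence)
      show "integrable M (\<lambda>x. \<bar>F (t + 1) x - F t x\<bar> + \<bar>F t x - F (t - 1) x\<bar>)" using int by simp
      show "AE x in M. (\<lambda>n. q (X (n + N)) x) \<longlonglongrightarrow> D x"
        using lim by eventually_elim (intro LIMSEQ_ignore_initial_segment filterlim_compose[OF _ flim])
      show "AE x in M. norm (q (X (n + N)) x) \<le> \<bar>F (t + 1) x - F t x\<bar> + \<bar>F t x - F (t - 1) x\<bar>" for n
        using conv
      proof eventually_elim
        case (elim x)
        show ?case using convex_difference_quotient_bound[OF elim, of "X (n + N)" t] N[of "n + N"] X(1)
          by (simp add: q_def)
      qed
    qed simp_all
  qed
  moreover have "(\<integral>x. q h x \<partial>M) = ((\<integral>x. F (t + h) x \<partial>M) - (\<integral>x. F t x \<partial>M)) / h" for h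
    unfolding q_def using int by simp
  ultimately have "((\<lambda>t. \<integral>x. F t x \<partial>M) has_real_derivative (\<integral>x. D x \<partial>M)) (at t)"
    by (simp add: DERIV_def)
  then show ?thesis by (auto simp: real_differentiable_def)
qed

section \<open>Independence under product measures\<close>

text \<open>Models resampling the coordinates outside \<open>A\<close>. If \<open>x\<close> and
  \<open>y\<close> are independent with the same product law, the spliced point has this law again,
  so independence of two blocks becomes Fubini's theorem.\<close>

definition splice :: "'i set \<Rightarrow> ('i \<Rightarrow> 'a) \<Rightarrow> ('i \<Rightarrow> 'a) \<Rightarrow> 'i \<Rightarrow> 'a" where
  "splice A x y = (\<lambda>u. if u \<in> A then x u else y u)"

text \<open>A pointwise substitute for measurability with respect to the coordinates in
  \<open>A\<close>; measurability proper is assumed separately where it is needed.\<close>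

definition depends_on :: "'i set \<Rightarrow> (('i \<Rightarrow> 'a) \<Rightarrow> 'c) \<Rightarrow> bool" where
  "depends_on A f \<longleftrightarrow> (\<forall>x y. (\<forall>u\<in>A. x u = y u) \<longrightarrow> f x = f y)"

lemma depends_on_compose:
  fixes f :: "('i \<Rightarrow> 'a) \<Rightarrow> 'c"
  assumes "depends_on A f"
  shows "depends_on A (\<lambda>x. h (f x))"
  unfolding depends_on_def
proof (intro allI impI)
  fix x y :: "'i \<Rightarrow> 'a" assume "\<forall>u\<in>A. x u = y u"
  then show "h (f x) = h (f y)" using assms by (intro arg_cong[of _ _ h]) (auto simp: depends_on_def)
qed

context product_prob_space
begin

context
  assumes I: "I = UNIV"
begin

lemma splice_measurable [measurable]: "(\<lambda>(x, y). splice A x y) \<in> PiM I M \<Otimes>\<^sub>M PiM I M \<rightarrow>\<^sub>M PiM I M"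
proof -
  have "(\<lambda>z u. splice A (fst z) (snd z) u) \<in> PiM I M \<Otimes>\<^sub>M PiM I M \<rightarrow>\<^sub>M PiM I M"
  proof (rule measurable_PiM_single')
    show "(\<lambda>z. splice A (fst z) (snd z) u) \<in> PiM I M \<Otimes>\<^sub>M PiM I M \<rightarrow>\<^sub>M M u" if "u \<in> I" for u
      using that by (cases "u \<in> A") (simp_all add: splice_def)
  qed (auto simp: splice_def space_pair_measure space_PiM PiE_iff I)
  then show ?thesis by (simp add: case_prod_beta')
qed

text \<open>It suffices to test cylinders over a finite \<open>J\<close>. The preimage is a
  rectangle, with the constraints in \<open>J \<inter> A\<close> on \<open>x\<close> and those in
  \<open>J - A\<close> on \<open>y\<close>.\<close>

lemma distr_splice: "distr (PiM I M \<Otimes>\<^sub>M PiM I M) (PiM I M) (\<lambda>(x, y). splice A x y) = PiM I M"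
proof (rule PiM_eq)
  fix J F assume J: "finite J" "J \<subseteq> I" and F: "\<And>j. j \<in> J \<Longrightarrow> F j \<in> sets (M j)"
  let ?P = "PiM I M"
  let ?C = "\<lambda>J. {x \<in> space ?P. \<forall>j\<in>J. x j \<in> F j}"
  have C [measurable]: "?C J' \<in> sets ?P" if "J' \<subseteq> J" for J'
    using that J F by (intro sets.sets_Collect_finite_All sets_Collect_single') (auto intro: finite_subset)
  have emb: "prod_emb I M J (Pi\<^sub>E J F) = ?C J"
    using J F by (auto simp: prod_emb_def space_PiM PiE_iff I)
  have "(\<lambda>(x, y). splice A x y) -` ?C J \<inter> space (?P \<Otimes>\<^sub>M ?P) = ?C (J \<inter> A) \<times> ?C (J - A)"
    by (auto simp: splice_def space_pair_measure space_PiM PiE_iff I split: if_splits)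
  then have "emeasure (distr (?P \<Otimes>\<^sub>M ?P) ?P (\<lambda>(x, y). splice A x y)) (prod_emb I M J (Pi\<^sub>E J F))
      = emeasure (?P \<Otimes>\<^sub>M ?P) (?C (J \<inter> A) \<times> ?C (J - A))"
    unfolding emb by (subst emeasure_distr) (auto simp: C)
  also have "\<dots> = emeasure ?P (?C (J \<inter> A)) * emeasure ?P (?C (J - A))"
    by (rule P.emeasure_pair_measure_Times) (auto intro!: C)
  also have "\<dots> = (\<Prod>j\<in>J \<inter> A. emeasure (M j) (F j)) * (\<Prod>j\<in>J - A. emeasure (M j) (F j))"
    using J F by (subst (1 2) emeasure_PiM_Collect) auto
  also have "\<dots> = (\<Prod>j\<in>J. emeasure (M j) (F j))"
    using J by (subst prod.union_disjoint[symmetric]) (auto simp: Int_Diff_Un)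
  finally show "emeasure (distr (?P \<Otimes>\<^sub>M ?P) ?P (\<lambda>(x, y). splice A x y)) (prod_emb I M J (Pi\<^sub>E J F))
      = (\<Prod>j\<in>J. emeasure (M j) (F j))" .
qed simp

lemma nn_integral_splice:
  assumes [measurable]: "F \<in> borel_measurable (PiM I M)"
  shows "(\<integral>\<^sup>+x. F x \<partial>PiM I M) = (\<integral>\<^sup>+x. \<integral>\<^sup>+y. F (splice A x y) \<partial>PiM I M \<partial>PiM I M)"
proof -
  have "(\<integral>\<^sup>+x. F x \<partial>PiM I M) = (\<integral>\<^sup>+x. F x \<partial>distr (PiM I M \<Otimes>\<^sub>M PiM I M) (PiM I M) (\<lambda>(x, y). splice A x y))"
    by (simp only: distr_splice)
  also have "\<dots> = (\<integral>\<^sup>+z. F (case z of (x, y) \<Rightarrow> splice A x y) \<partial>(PiM I M \<Otimes>\<^sub>M PiM I M))"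
    by (rule nn_integral_distr) measurable
  also have "\<dots> = (\<integral>\<^sup>+x. \<integral>\<^sup>+y. F (case (x, y) of (x, y) \<Rightarrow> splice A x y) \<partial>PiM I M \<partial>PiM I M)"
    by (rule P.nn_integral_fst[symmetric]) (rule measurable_compose[OF splice_measurable assms])
  also have "\<dots> = (\<integral>\<^sup>+x. \<integral>\<^sup>+y. F (splice A x y) \<partial>PiM I M \<partial>PiM I M)"
    by simp
  finally show ?thesis .
qed

lemma nn_integral_mult_indep:
  fixes f g :: "('i \<Rightarrow> 'a) \<Rightarrow> ennreal"
  assumes [measurable]: "f \<in> borel_measurable (PiM I M)" "g \<in> borel_measurable (PiM I M)"
    and f: "depends_on A f" and g: "depends_on (- A) g"
  shows "(\<integral>\<^sup>+x. f x * g x \<partial>PiM I M) = (\<integral>\<^sup>+x. f x \<partial>PiM I M) * (\<integral>\<^sup>+x. g x \<partial>PiM I M)"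
proof -
  have [simp]: "f (splice A x y) = f x" "g (splice A x y) = g y" for x y
    using f[unfolded depends_on_def, rule_format, of "splice A x y" x]
      g[unfolded depends_on_def, rule_format, of "splice A x y" y] by (auto simp: splice_def)
  have "(\<integral>\<^sup>+x. f x * g x \<partial>PiM I M) = (\<integral>\<^sup>+x. \<integral>\<^sup>+y. f x * g y \<partial>PiM I M \<partial>PiM I M)"
    by (subst nn_integral_splice[where A=A]) auto
  also have "\<dots> = (\<integral>\<^sup>+x. f x \<partial>PiM I M) * (\<integral>\<^sup>+x. g x \<partial>PiM I M)"
    by (simp add: nn_integral_cmult nn_integral_multc)
  finally show ?thesis .
qed

lemma
  fixes f g :: "('i \<Rightarrow> 'a) \<Rightarrow> real"
  assumes fi: "integrable (PiM I M) f" and gi: "integrable (PiM I M) g"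
    and f: "depends_on A f" and g: "depends_on (- A) g"
  shows integrable_mult_indep: "integrable (PiM I M) (\<lambda>x. f x * g x)"
    and integral_mult_indep: "(\<integral>x. f x * g x \<partial>PiM I M) = (\<integral>x. f x \<partial>PiM I M) * (\<integral>x. g x \<partial>PiM I M)"
proof -
  interpret pair_sigma_finite "PiM I M" "PiM I M" by standard
  have [measurable]: "f \<in> borel_measurable (PiM I M)" "g \<in> borel_measurable (PiM I M)" using fi gi by auto
  have [simp]: "f (splice A x y) = f x" "g (splice A x y) = g y" for x y
    using f[unfolded depends_on_def, rule_format, of "splice A x y" x]
      g[unfolded depends_on_def, rule_format, of "splice A x y" y] by (auto simp: splice_def)
  show int: "integrable (PiM I M) (\<lambda>x. f x * g x)"
  proof (rule integrableI_bounded)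
    have "(\<integral>\<^sup>+x. ennreal (norm (f x * g x)) \<partial>PiM I M) = (\<integral>\<^sup>+x. ennreal (norm (f x)) * ennreal (norm (g x)) \<partial>PiM I M)"
      by (simp add: abs_mult ennreal_mult)
    also have "\<dots> = (\<integral>\<^sup>+x. ennreal (norm (f x)) \<partial>PiM I M) * (\<integral>\<^sup>+x. ennreal (norm (g x)) \<partial>PiM I M)"
      using f g by (intro nn_integral_mult_indep[where A=A]) (auto intro: depends_on_compose)
    also have "\<dots> < \<infinity>"
      using fi gi by (auto simp: integrable_iff_bounded ennreal_mult_less_top)
    finally show "(\<integral>\<^sup>+x. ennreal (norm (f x * g x)) \<partial>PiM I M) < \<infinity>" .
  qed measurable
  define h where "h z = (case z of (x, y) \<Rightarrow> f x * g y)" for z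
  have hm: "h (x, y) = f x * g y" for x y by (simp add: h_def)
  have h: "h = (\<lambda>z. f (case z of (x, y) \<Rightarrow> splice A x y) * g (case z of (x, y) \<Rightarrow> splice A x y))"
    by (auto simp: h_def fun_eq_iff)
  have "integrable (PiM I M \<Otimes>\<^sub>M PiM I M) h" unfolding h
    by (rule integrable_distr[OF splice_measurable[of A]]) (simp only: distr_splice int)
  from integral_fst'[OF this]
  have "integral\<^sup>L (PiM I M \<Otimes>\<^sub>M PiM I M) h = (\<integral>x. \<integral>y. f x * g y \<partial>PiM I M \<partial>PiM I M)"
    by (simp add: hm)
  also have "\<dots> = (\<integral>x. f x \<partial>PiM I M) * (\<integral>x. g x \<partial>PiM I M)" by simp
  also have "integral\<^sup>L (PiM I M \<Otimes>\<^sub>M PiM I M) h = (\<integral>x. f x * g x \<partial>PiM I M)"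
    unfolding h by (subst integral_distr[OF splice_measurable[of A], symmetric]) (simp_all only: distr_splice, measurable)
  finally show "(\<integral>x. f x * g x \<partial>PiM I M) = (\<integral>x. f x \<partial>PiM I M) * (\<integral>x. g x \<partial>PiM I M)" .
qed

end

end

text \<open>Takes the place of Markov's inequality with Borel-Cantelli: the sum of a tail has finite
  expectation, so it is finite almost everywhere. Finitely many initial terms do not affect
  summability.\<close>

lemma AE_summable_if_nn_integral_le:
  fixes Y :: "nat \<Rightarrow> 'a \<Rightarrow> real"
  assumes [measurable]: "\<And>n. Y n \<in> borel_measurable M" and nn: "\<And>n x. 0 \<le> Y n x"
    and b: "summable b" "\<And>n. 0 \<le> b n"
    and le: "\<forall>\<^sub>F n in sequentially. (\<integral>\<^sup>+x. ennreal (Y n x) \<partial>M) \<le> ennreal (b n)"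
  shows "AE x in M. summable (\<lambda>n. Y n x)"
proof -
  obtain N where N: "\<And>n. N \<le> n \<Longrightarrow> (\<integral>\<^sup>+x. ennreal (Y n x) \<partial>M) \<le> ennreal (b n)"
    using le by (auto simp: eventually_sequentially)
  have "(\<integral>\<^sup>+x. (\<Sum>n. ennreal (Y (n + N) x)) \<partial>M) = (\<Sum>n. \<integral>\<^sup>+x. ennreal (Y (n + N) x) \<partial>M)"
    by (rule nn_integral_suminf) simp
  also have "\<dots> \<le> (\<Sum>n. ennreal (b (n + N)))"
    by (intro suminf_le summableI N) auto
  also have "\<dots> < \<infinity>"
    using b by (subst suminf_ennreal2) (auto simp: summable_iff_shift)
  finally have "AE x in M. (\<Sum>n. ennreal (Y (n + N) x)) \<noteq> \<infinity>"
    by (intro nn_integral_PInf_AE) auto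
  then show ?thesis
  proof eventually_elim
    case (elim x)
    then have "summable (\<lambda>n. Y (n + N) x)" by (intro summable_suminf_not_top nn) simp
    then show ?case by (rule summable_iff_shift[THEN iffD1])
  qed
qed

section \<open>Weighted paths in a fixed environment\<close>

text \<open>Absent children get weight 0, so that sums over the random tree become sums over fixed
  label sets, to which independence of the coordinates applies directly.\<close>

definition child_weight :: "real \<Rightarrow> nat \<Rightarrow> nat \<times> (nat \<Rightarrow> real) \<Rightarrow> real" where
  "child_weight t i a = (if i < fst a then exp (t * snd a i) else 0)"

definition offspring_sum :: "nat \<Rightarrow> real \<Rightarrow> nat \<times> (nat \<Rightarrow> real) \<Rightarrow> real" where
  "offspring_sum K t a = (\<Sum>i<K. child_weight t i a)"

definition path_weight :: "real \<Rightarrow> nat list \<Rightarrow> (nat list \<Rightarrow> nat \<times> (nat \<Rightarrow> real)) \<Rightarrow> real" where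
  "path_weight t u x = (\<Prod>k<length u. child_weight t (u ! k) (x (take k u)))"

definition labels :: "nat \<Rightarrow> nat \<Rightarrow> nat list set" where
  "labels K n = {u. length u = n \<and> set u \<subseteq> {..<K}}"

definition truncated :: "nat \<Rightarrow> real \<Rightarrow> nat \<Rightarrow> (nat list \<Rightarrow> nat \<times> (nat \<Rightarrow> real)) \<Rightarrow> real" where
  "truncated K t n x = (\<Sum>u\<in>labels K n. path_weight t u x)"

lemma child_weight_nonneg [simp]: "0 \<le> child_weight t i a"
  by (simp add: child_weight_def)

lemma child_weight_powr: "child_weight t i a powr p = child_weight (p * t) i a"
  by (simp add: child_weight_def exp_powr_real algebra_simps)

lemma offspring_sum_nonneg [simp]: "0 \<le> offspring_sum K t a"
  by (simp add: offspring_sum_def sum_nonneg)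

lemma path_weight_nonneg [simp]: "0 \<le> path_weight t u x"
  by (simp add: path_weight_def prod_nonneg)

lemma path_weight_Nil [simp]: "path_weight t [] x = 1"
  by (simp add: path_weight_def)

lemma path_weight_snoc: "path_weight t (u @ [i]) x = path_weight t u x * child_weight t i (x u)"
  by (simp add: path_weight_def nth_append)

lemma path_weight_powr: "path_weight t u x powr p = path_weight (p * t) u x"
  by (induction u rule: rev_induct) (auto simp: path_weight_snoc powr_mult child_weight_powr)

text \<open>Only proper prefixes of \<open>u\<close> enter. Passing to all shorter labels gives one
  coordinate set for the whole generation, disjoint from the labels of that generation.\<close>

lemma depends_on_path_weight: "depends_on {v. length v < length u} (path_weight t u)"
  by (auto simp: depends_on_def path_weight_def intro!: prod.cong arg_cong[where f="child_weight _ _"])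

lemma length_labels: "u \<in> labels K n \<Longrightarrow> length u = n"
  by (simp add: labels_def)

lemma finite_labels [simp]: "finite (labels K n)"
  using finite_lists_length_eq[of "{..<K}" n] by (simp add: labels_def conj_commute)

lemma labels_0 [simp]: "labels K 0 = {[]}"
  by (auto simp: labels_def)

lemma labels_Suc: "labels K (Suc n) = (\<lambda>(u, i). u @ [i]) ` (labels K n \<times> {..<K})"
proof (intro equalityI subsetI)
  fix w assume w: "w \<in> labels K (Suc n)"
  then obtain u i where "w = u @ [i]" by (cases w rule: rev_cases) (auto simp: labels_def)
  with w show "w \<in> (\<lambda>(u, i). u @ [i]) ` (labels K n \<times> {..<K})"
    by (auto simp: labels_def)
qed (auto simp: labels_def)

lemma truncated_0 [simp]: "truncated K t 0 x = 1"
  by (simp add: truncated_def)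

lemma truncated_Suc:
  "truncated K t (Suc n) x = (\<Sum>u\<in>labels K n. path_weight t u x * offspring_sum K t (x u))"
proof -
  have "truncated K t (Suc n) x = (\<Sum>(u, i)\<in>labels K n \<times> {..<K}. path_weight t (u @ [i]) x)"
    unfolding truncated_def labels_Suc
    by (subst sum.reindex) (auto simp: inj_on_def case_prod_beta')
  then show ?thesis
    by (simp add: path_weight_snoc offspring_sum_def sum_distrib_left sum.cartesian_product)
qed

lemma truncated_nonneg [simp]: "0 \<le> truncated K t n x"
  by (simp add: truncated_def sum_nonneg)

lemma length_generation: "u \<in> generation x n \<Longrightarrow> length u = n"
  by (induction n arbitrary: u) auto

lemma finite_generation [simp]: "finite (generation x n)"
proof (induction n)
  case (Suc n)
  have "generation x (Suc n) = (\<Union>u\<in>generation x n. (\<lambda>i. u @ [i]) ` {..<num_children x u})" by auto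
  then show ?case using Suc by simp
qed simp

lemma path_weight_eq:
  "path_weight t u x = (if u \<in> generation x (length u) then exp (t * position x u) else 0)"
proof (induction u rule: rev_induct)
  case (snoc i u)
  then show ?case
    by (auto simp: path_weight_snoc child_weight_def position_snoc exp_add algebra_simps)
qed (simp add: position_Nil)

lemma truncated_eq: "truncated K t n x = (\<Sum>u\<in>generation x n \<inter> labels K n. exp (t * position x u))"
proof -
  have "truncated K t n x = (\<Sum>u\<in>labels K n. if u \<in> generation x n then exp (t * position x u) else 0)"
    unfolding truncated_def by (intro sum.cong) (auto simp: path_weight_eq length_labels)
  then show ?thesis by (simp add: sum.inter_restrict[symmetric] Int_commute)
qed

lemma truncated_le_partition_function: "truncated K t n x \<le> partition_function x n t"
  unfolding truncated_eq partition_function_def by (intro sum_mono2) auto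

lemma partition_function_nonneg [simp]: "0 \<le> partition_function x n t"
  by (simp add: partition_function_def sum_nonneg)

text \<open>A generation is finite, so its labels are bounded for each realization. Measurability
  and the mean bound for the partition function are derived from this.\<close>

lemma eventually_truncated_eq: "\<forall>\<^sub>F K in sequentially. truncated K t n x = partition_function x n t"
proof -
  obtain B where B: "\<forall>i\<in>(\<Union>u\<in>generation x n. set u). i < B"
    using finite_nat_set_iff_bounded[of "\<Union>u\<in>generation x n. set u"] by auto
  show ?thesis
    using eventually_ge_at_top[of B]
  proof eventually_elim
    case (elim K)
    then have "generation x n \<subseteq> labels K n" using B by (force simp: labels_def length_generation)
    then show ?case by (simp add: truncated_eq partition_function_def Int_absorb2)
  qed
qed

lemma incseq_truncated: "incseq (\<lambda>K. truncated K t n x)"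
  unfolding incseq_def truncated_eq by (auto intro!: sum_mono2 simp: labels_def)

text \<open>\<open>generation\<close> appends new labels at the end, whereas decomposing the tree at
  the root prepends one; this reconciles the two directions.\<close>

lemma generation_Cons:
  assumes "i < num_children x []" "v \<in> generation (\<lambda>u. x (i # u)) n"
  shows "i # v \<in> generation x (Suc n)"
  using assms(2)
proof (induction n arbitrary: v)
  case 0
  then show ?case using assms(1) by auto
next
  case (Suc n)
  then obtain u j where "v = u @ [j]" "u \<in> generation (\<lambda>u. x (i # u)) n" "j < num_children x (i # u)" by auto
  then show ?case using Suc.IH[of u] by (auto intro!: exI[of _ "i # u"])
qed

lemma position_Cons: "position x (i # v) = displacement x [] i + position (\<lambda>u. x (i # u)) v"
  unfolding position_def by (simp add: sum.lessThan_Suc_shift del: sum.lessThan_Suc)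

lemma partition_function_child:
  assumes "i < num_children x []"
  shows "exp (t * displacement x [] i) * partition_function (\<lambda>u. x (i # u)) n t \<le> partition_function x (Suc n) t"
proof -
  have "exp (t * displacement x [] i) * partition_function (\<lambda>u. x (i # u)) n t
      = (\<Sum>v\<in>generation (\<lambda>u. x (i # u)) n. exp (t * position x (i # v)))"
    by (simp add: partition_function_def sum_distrib_left position_Cons exp_add algebra_simps)
  also have "\<dots> = (\<Sum>w\<in>(#) i ` generation (\<lambda>u. x (i # u)) n. exp (t * position x w))"
    by (subst sum.reindex) auto
  also have "\<dots> \<le> partition_function x (Suc n) t"
    unfolding partition_function_def by (intro sum_mono2 finite_generation) (auto simp del: generation.simps intro: generation_Cons[where x=x and i=i, OF assms])
  finally show ?thesis .
qed

lemma child_weight_measurable [measurable]: "child_weight t i \<in> borel_measurable offspring_space"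
  unfolding child_weight_def[abs_def] offspring_space_def by measurable

lemma offspring_sum_measurable [measurable]: "offspring_sum K t \<in> borel_measurable offspring_space"
  unfolding offspring_sum_def[abs_def] by measurable

abbreviation tree_space :: "(nat list \<Rightarrow> nat \<times> (nat \<Rightarrow> real)) measure" where
  "tree_space \<equiv> \<Pi>\<^sub>M u\<in>UNIV. offspring_space"

lemma path_weight_measurable [measurable]: "path_weight t u \<in> borel_measurable tree_space"
  unfolding path_weight_def[abs_def] by measurable

lemma truncated_measurable [measurable]: "truncated K t n \<in> borel_measurable tree_space"
  unfolding truncated_def[abs_def] by measurable

lemma partition_function_measurable [measurable]:
  "(\<lambda>x. partition_function x n t) \<in> borel_measurable tree_space"
proof (rule borel_measurable_LIMSEQ_real)
  show "(\<lambda>K. truncated K t n x) \<longlonglongrightarrow> partition_function x n t" for x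
    by (rule tendsto_eventually[OF eventually_truncated_eq])
qed measurable

locale environment =
  fixes \<nu> :: "nat \<Rightarrow> (nat \<times> (nat \<Rightarrow> real)) measure"
  assumes prob_space_\<nu>: "prob_space (\<nu> n)"
    and sets_\<nu> [measurable_cong]: "sets (\<nu> n) = sets offspring_space"
begin

sublocale product_prob_space "\<lambda>u :: nat list. \<nu> (length u)" UNIV
  using prob_space_\<nu> by (intro product_prob_spaceI)

abbreviation "Q \<equiv> PiM UNIV (\<lambda>u :: nat list. \<nu> (length u))"

lemma sets_Q [measurable_cong]: "sets Q = sets tree_space"
  by (intro sets_PiM_cong) (simp_all add: sets_\<nu>)

lemma prob_space_Q: "prob_space Q"
  by unfold_locales

lemma nn_integral_component:
  assumes "f \<in> borel_measurable offspring_space"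
  shows "(\<integral>\<^sup>+x. f (x u) \<partial>Q) = (\<integral>\<^sup>+a. f a \<partial>\<nu> (length u))"
proof -
  have [measurable]: "f \<in> borel_measurable (\<nu> (length u))" using assms unfolding measurable_cong_sets[OF sets_\<nu> refl] .
  have "(\<integral>\<^sup>+a. f a \<partial>\<nu> (length u)) = (\<integral>\<^sup>+a. f a \<partial>distr Q (\<nu> (length u)) (\<lambda>x. x u))"
    by (subst PiM_component) auto
  also have "\<dots> = (\<integral>\<^sup>+x. f (x u) \<partial>Q)" by (subst nn_integral_distr) auto
  finally show ?thesis by simp
qed

definition truncated_mean :: "nat \<Rightarrow> real \<Rightarrow> nat \<Rightarrow> ennreal" where
  "truncated_mean K t n = (\<integral>\<^sup>+a. ennreal (offspring_sum K t a) \<partial>\<nu> n)"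

text \<open>Weights of paths of length \<open>n\<close> and the vectors at their end points use
  disjoint coordinates, so every generation contributes one factor. The exact formula is used at
  \<open>t\<close> for the normalization and at \<open>p * t\<close> for the increments.\<close>

lemma nn_integral_truncated: "(\<integral>\<^sup>+x. ennreal (truncated K t n x) \<partial>Q) = (\<Prod>k<n. truncated_mean K t k)"
proof (induction n)
  case 0
  show ?case by (simp add: P.emeasure_space_1)
next
  case (Suc n)
  have "(\<integral>\<^sup>+x. ennreal (truncated K t (Suc n) x) \<partial>Q)
      = (\<Sum>u\<in>labels K n. \<integral>\<^sup>+x. ennreal (path_weight t u x) * ennreal (offspring_sum K t (x u)) \<partial>Q)"
    by (simp add: truncated_Suc ennreal_mult flip: sum_ennreal nn_integral_sum)
  also have "\<dots> = (\<Sum>u\<in>labels K n. (\<integral>\<^sup>+x. ennreal (path_weight t u x) \<partial>Q) * truncated_mean K t n)"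
  proof (intro sum.cong refl)
    fix u assume u: "u \<in> labels K n"
    have "(\<integral>\<^sup>+x. ennreal (path_weight t u x) * ennreal (offspring_sum K t (x u)) \<partial>Q)
        = (\<integral>\<^sup>+x. ennreal (path_weight t u x) \<partial>Q) * (\<integral>\<^sup>+x. ennreal (offspring_sum K t (x u)) \<partial>Q)"
    proof (rule nn_integral_mult_indep[OF refl, where A="{v. length v < length u}"])
      show "depends_on {v. length v < length u} (\<lambda>x. ennreal (path_weight t u x))"
        by (rule depends_on_compose[OF depends_on_path_weight])
      show "depends_on (- {v. length v < length u}) (\<lambda>x. ennreal (offspring_sum K t (x u)))"
        by (auto simp: depends_on_def)
    qed measurable
    also have "(\<integral>\<^sup>+x. ennreal (offspring_sum K t (x u)) \<partial>Q) = truncated_mean K t n"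
      using u by (subst nn_integral_component[where f="\<lambda>a. ennreal (offspring_sum K t a)"])
        (auto simp: truncated_mean_def length_labels)
    finally show "(\<integral>\<^sup>+x. ennreal (path_weight t u x) * ennreal (offspring_sum K t (x u)) \<partial>Q)
        = (\<integral>\<^sup>+x. ennreal (path_weight t u x) \<partial>Q) * truncated_mean K t n" .
  qed
  also have "\<dots> = (\<integral>\<^sup>+x. ennreal (truncated K t n x) \<partial>Q) * truncated_mean K t n"
    by (simp add: truncated_def sum_distrib_right nn_integral_sum flip: sum_ennreal)
  finally show ?case using Suc by (simp add: mult.commute)
qed

lemma nn_integral_partition_function_le:
  "(\<integral>\<^sup>+x. ennreal (partition_function x n t) \<partial>Q)
    \<le> (\<Prod>k<n. \<integral>\<^sup>+a. ennreal (\<Sum>i<fst a. exp (t * snd a i)) \<partial>\<nu> k)"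
proof -
  have lim: "(\<lambda>K. ennreal (truncated K t n x)) \<longlonglongrightarrow> ennreal (partition_function x n t)" for x
    by (rule tendsto_eventually) (use eventually_truncated_eq[of t n x] in \<open>auto elim: eventually_mono\<close>)
  have "ennreal (partition_function x n t) = (SUP K. ennreal (truncated K t n x))" for x
    by (rule LIMSEQ_unique[OF lim LIMSEQ_SUP]) (auto intro!: incseq_SucI ennreal_leI incseqD[OF incseq_truncated])
  then have "(\<integral>\<^sup>+x. ennreal (partition_function x n t) \<partial>Q) = (SUP K. \<integral>\<^sup>+x. ennreal (truncated K t n x) \<partial>Q)"
    by (subst nn_integral_monotone_convergence_SUP[symmetric])
       (auto intro!: incseq_SucI le_funI ennreal_leI incseqD[OF incseq_truncated])
  also have "\<dots> \<le> (\<Prod>k<n. \<integral>\<^sup>+a. ennreal (\<Sum>i<fst a. exp (t * snd a i)) \<partial>\<nu> k)"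
  proof (rule SUP_least)
    fix K
    have "offspring_sum K t a \<le> (\<Sum>i<fst a. exp (t * snd a i))" for a
    proof -
      have "offspring_sum K t a = (\<Sum>i\<in>{..<K} \<inter> {..<fst a}. exp (t * snd a i))"
        unfolding offspring_sum_def child_weight_def by (subst sum.inter_restrict) auto
      also have "\<dots> \<le> (\<Sum>i<fst a. exp (t * snd a i))" by (intro sum_mono2) auto
      finally show ?thesis .
    qed
    then have le: "truncated_mean K t k \<le> (\<integral>\<^sup>+a. ennreal (\<Sum>i<fst a. exp (t * snd a i)) \<partial>\<nu> k)" for k
      unfolding truncated_mean_def by (intro nn_integral_mono ennreal_leI)
    show "(\<integral>\<^sup>+x. ennreal (truncated K t n x) \<partial>Q)
        \<le> (\<Prod>k<n. \<integral>\<^sup>+a. ennreal (\<Sum>i<fst a. exp (t * snd a i)) \<partial>\<nu> k)"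
      unfolding nn_integral_truncated by (induction n) (auto intro!: mult_mono le)
  qed
  finally show ?thesis .
qed

end

section \<open>Quenched growth estimates\<close>

text \<open>The multiplier \<open>j\<close> makes the property insensitive to constant factors, so
  that it passes from the subtree of a child to the whole tree. All quantifiers range over naturals,
  for measurability.\<close>

definition growing :: "real \<Rightarrow> real \<Rightarrow> (nat list \<Rightarrow> nat \<times> (nat \<Rightarrow> real)) \<Rightarrow> bool" where
  "growing t c x \<longleftrightarrow> (\<exists>j::nat. \<exists>N. \<forall>n\<ge>N. exp (c * n) \<le> real j * partition_function x n t)"

lemma growing_measurable [measurable]: "Measurable.pred tree_space (growing t c)"
  unfolding growing_def[abs_def] by measurable

context environment
begin

lemma AE_upper:
  assumes mean: "\<And>k. (\<integral>\<^sup>+a. ennreal (\<Sum>i<fst a. exp (t * snd a i)) \<partial>\<nu> k) = ennreal (l k)" "\<And>k. 0 < l k"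
    and lim: "(\<lambda>n. (\<Sum>k<n. ln (l k)) / n) \<longlonglongrightarrow> \<alpha>" and c: "\<alpha> < c"
  shows "AE x in Q. \<forall>\<^sub>F n in sequentially. partition_function x n t < exp (c * n)"
proof -
  define Y where "Y n x = exp (- c * real n) * partition_function x n t" for n x
  \<comment> \<open>Half of the margin \<open>c - \<alpha>\<close> absorbs the fluctuation of the
    ergodic average; the other half leaves the geometric rate \<open>r\<close>.\<close>
  define r where "r = exp ((\<alpha> - c) / 2)"
  have r: "0 < r" "r < 1" using c by (auto simp: r_def)
  have ev: "\<forall>\<^sub>F n in sequentially. (\<Sum>k<n. ln (l k)) / n < (\<alpha> + c) / 2"
    using c by (intro order_tendstoD(2)[OF lim]) simp
  have "AE x in Q. summable (\<lambda>n. Y n x)"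
  proof (rule AE_summable_if_nn_integral_le[where b="\<lambda>n. r ^ n"])
    show "\<forall>\<^sub>F n in sequentially. (\<integral>\<^sup>+x. ennreal (Y n x) \<partial>Q) \<le> ennreal (r ^ n)"
      using ev eventually_gt_at_top[of 0]
    proof eventually_elim
      case (elim n)
      have s: "(\<Sum>k<n. ln (l k)) \<le> (\<alpha> + c) / 2 * n" using elim by (simp add: field_simps)
      have "(\<integral>\<^sup>+x. ennreal (Y n x) \<partial>Q) = ennreal (exp (- c * real n)) * (\<integral>\<^sup>+x. ennreal (partition_function x n t) \<partial>Q)"
        unfolding Y_def by (simp add: ennreal_mult nn_integral_cmult)
      also have "\<dots> \<le> ennreal (exp (- c * real n)) * (\<Prod>k<n. ennreal (l k))"
        by (intro mult_left_mono order_trans[OF nn_integral_partition_function_le]) (simp_all add: mean)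
      also have "\<dots> = ennreal (exp (- c * real n) * (\<Prod>k<n. l k))"
        using mean(2) by (simp add: prod_ennreal ennreal_mult less_imp_le prod_nonneg)
      also have "(\<Prod>k<n. l k) = exp (\<Sum>k<n. ln (l k))"
        using mean(2) by (simp add: exp_sum)
      also have "exp (- c * real n) * \<dots> = exp ((\<Sum>k<n. ln (l k)) - c * n)"
        by (simp add: exp_diff exp_minus field_simps)
      also have "\<dots> \<le> exp (n * ((\<alpha> - c) / 2))" using s by (simp add: field_simps)
      also have "\<dots> = r ^ n" by (simp only: r_def exp_of_nat_mult)
      finally show ?case by (simp add: ennreal_leI)
    qed
  qed (use r in \<open>auto simp: Y_def[abs_def] summable_geometric\<close>)
  then show ?thesis
  proof eventually_elim
    case (elim x)
    have "\<forall>\<^sub>F n in sequentially. Y n x < 1"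
      using summable_LIMSEQ_zero[OF elim] by (rule order_tendstoD) simp
    then show ?case
      by eventually_elim (simp add: Y_def exp_minus field_simps)
  qed
qed

lemma
  fixes f :: "nat \<times> (nat \<Rightarrow> real) \<Rightarrow> real"
  assumes f: "integrable (\<nu> (length u)) f"
  shows integrable_component: "integrable Q (\<lambda>x. f (x u))"
    and integral_component: "(\<integral>x. f (x u) \<partial>Q) = (\<integral>a. f a \<partial>\<nu> (length u))"
proof -
  have d: "distr Q (\<nu> (length u)) (\<lambda>x. x u) = \<nu> (length u)" by (rule PiM_component) simp
  show "integrable Q (\<lambda>x. f (x u))"
    by (rule integrable_distr[of _ _ "\<nu> (length u)"]) (simp_all add: d f)
  show "(\<integral>x. f (x u) \<partial>Q) = (\<integral>a. f a \<partial>\<nu> (length u))"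
    using integral_distr[of "\<lambda>x. x u" Q "\<nu> (length u)" f] f by (simp add: d)
qed

text \<open>Centred functions of distinct coordinates are orthogonal, so the cross term vanishes in
  the induction. The coefficients are deterministic because the path weights will be frozen when
  this is applied.\<close>

lemma second_moment_sum:
  fixes h :: "nat \<times> (nat \<Rightarrow> real) \<Rightarrow> real" and c :: "nat list \<Rightarrow> real"
  assumes "finite U" "\<And>u. u \<in> U \<Longrightarrow> length u = n"
    and h: "integrable (\<nu> n) h" "integrable (\<nu> n) (\<lambda>a. (h a)\<^sup>2)" "(\<integral>a. h a \<partial>\<nu> n) = 0"
  defines "S \<equiv> \<lambda>U x. \<Sum>u\<in>U. c u * h (x u)"
  shows "integrable Q (S U)" "integrable Q (\<lambda>x. (S U x)\<^sup>2)"
    "(\<integral>x. (S U x)\<^sup>2 \<partial>Q) = (\<integral>a. (h a)\<^sup>2 \<partial>\<nu> n) * (\<Sum>u\<in>U. (c u)\<^sup>2)"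
proof -
  have "integrable Q (S U) \<and> integrable Q (\<lambda>x. (S U x)\<^sup>2) \<and>
      (\<integral>x. (S U x)\<^sup>2 \<partial>Q) = (\<integral>a. (h a)\<^sup>2 \<partial>\<nu> n) * (\<Sum>u\<in>U. (c u)\<^sup>2)"
    using assms(1,2)
  proof (induction U)
    case empty
    show ?case by (simp add: S_def)
  next
    case (insert u U)
    then have len: "length u = n" by simp
    have I: "integrable Q (S U)" "integrable Q (\<lambda>x. (S U x)\<^sup>2)"
        "(\<integral>x. (S U x)\<^sup>2 \<partial>Q) = (\<integral>a. (h a)\<^sup>2 \<partial>\<nu> n) * (\<Sum>u\<in>U. (c u)\<^sup>2)"
      using insert by auto
    have hu: "integrable Q (\<lambda>x. h (x u))" "(\<integral>x. h (x u) \<partial>Q) = 0"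
      using integrable_component[of u h] integral_component[of u h] h len by auto
    have hu2: "integrable Q (\<lambda>x. (h (x u))\<^sup>2)" "(\<integral>x. (h (x u))\<^sup>2 \<partial>Q) = (\<integral>a. (h a)\<^sup>2 \<partial>\<nu> n)"
      using integrable_component[of u "\<lambda>a. (h a)\<^sup>2"] integral_component[of u "\<lambda>a. (h a)\<^sup>2"] h len by auto
    have dep: "depends_on {u} (\<lambda>x. h (x u))" by (simp add: depends_on_def)
    have "depends_on (- {u}) (S U)"
      using insert(2) unfolding depends_on_def S_def by (auto intro!: sum.cong arg_cong[where f=h])
    note ind = integrable_mult_indep[OF refl hu(1) I(1) dep this] integral_mult_indep[OF refl hu(1) I(1) dep this]
    have ins: "S (insert u U) = (\<lambda>x. c u * h (x u) + S U x)"
      using insert by (simp add: S_def fun_eq_iff)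
    have sq: "(\<lambda>x. (S (insert u U) x)\<^sup>2) =
        (\<lambda>x. (c u)\<^sup>2 * (h (x u))\<^sup>2 + (2 * c u * (h (x u) * S U x) + (S U x)\<^sup>2))"
      by (simp add: ins fun_eq_iff power2_eq_square algebra_simps)
    have "(\<integral>x. (S (insert u U) x)\<^sup>2 \<partial>Q) = (c u)\<^sup>2 * (\<integral>a. (h a)\<^sup>2 \<partial>\<nu> n) + (2 * c u * 0 + (\<integral>x. (S U x)\<^sup>2 \<partial>Q))"
      unfolding sq using hu hu2 I(1,2) ind by simp
    also have "\<dots> = (\<integral>a. (h a)\<^sup>2 \<partial>\<nu> n) * (\<Sum>u\<in>insert u U. (c u)\<^sup>2)"
      using insert(1,2) by (simp add: I(3) algebra_simps)
    finally have 1: "(\<integral>x. (S (insert u U) x)\<^sup>2 \<partial>Q) = (\<integral>a. (h a)\<^sup>2 \<partial>\<nu> n) * (\<Sum>u\<in>insert u U. (c u)\<^sup>2)" .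
    have "integrable Q (S (insert u U))" unfolding ins using hu(1) I(1) by auto
    moreover have "integrable Q (\<lambda>x. (S (insert u U) x)\<^sup>2)" unfolding sq using hu2(1) I(2) ind(1) by auto
    ultimately show ?case using 1 by simp
  qed
  then show "integrable Q (S U)" "integrable Q (\<lambda>x. (S U x)\<^sup>2)"
    "(\<integral>x. (S U x)\<^sup>2 \<partial>Q) = (\<integral>a. (h a)\<^sup>2 \<partial>\<nu> n) * (\<Sum>u\<in>U. (c u)\<^sup>2)" by auto
qed

text \<open>The variance of the absolute value is nonnegative, so the squared first absolute moment
  is at most the second moment.\<close>

lemma nn_integral_abs_sum_le:
  fixes h :: "nat \<times> (nat \<Rightarrow> real) \<Rightarrow> real"
  assumes "finite U" "\<And>u. u \<in> U \<Longrightarrow> length u = n"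
    and "integrable (\<nu> n) h" "integrable (\<nu> n) (\<lambda>a. (h a)\<^sup>2)" "(\<integral>a. h a \<partial>\<nu> n) = 0"
  shows "(\<integral>\<^sup>+x. ennreal \<bar>\<Sum>u\<in>U. c u * h (x u)\<bar> \<partial>Q)
    \<le> ennreal (sqrt ((\<integral>a. (h a)\<^sup>2 \<partial>\<nu> n) * (\<Sum>u\<in>U. (c u)\<^sup>2)))"
proof -
  note S = second_moment_sum[OF assms, where c=c]
  let ?S = "\<lambda>x. \<bar>\<Sum>u\<in>U. c u * h (x u)\<bar>"
  have "P.variance ?S = (\<integral>x. (?S x)\<^sup>2 \<partial>Q) - (\<integral>x. ?S x \<partial>Q)\<^sup>2"
    using S by (intro P.variance_eq) auto
  then have "(\<integral>x. ?S x \<partial>Q)\<^sup>2 \<le> (\<integral>a. (h a)\<^sup>2 \<partial>\<nu> n) * (\<Sum>u\<in>U. (c u)\<^sup>2)"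
    using P.variance_positive[of ?S] S(3) by simp
  then have "(\<integral>x. ?S x \<partial>Q) \<le> sqrt ((\<integral>a. (h a)\<^sup>2 \<partial>\<nu> n) * (\<Sum>u\<in>U. (c u)\<^sup>2))"
    by (rule real_le_rsqrt)
  moreover have "(\<integral>\<^sup>+x. ennreal (?S x) \<partial>Q) = ennreal (\<integral>x. ?S x \<partial>Q)"
    using S by (intro nn_integral_eq_integral) auto
  ultimately show ?thesis by (simp add: ennreal_leI)
qed

text \<open>Given the earlier generations, the increment is a weighted sum of independent centred
  variables, so its conditional first absolute moment is at most a multiple of the l2 norm of the
  weights. The free parameter \<open>d\<close> comes from the interpolation and is chosen
  later.\<close>

lemma martingale_increment:
  assumes a: "\<And>k. truncated_mean K t k = ennreal (a k)" "\<And>k. 0 < a k"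
    and b: "\<And>k. truncated_mean K (p * t) k = ennreal (b k)" "\<And>k. 0 < b k"
    and v: "(\<integral>\<^sup>+x. ennreal ((offspring_sum K t x)\<^sup>2) \<partial>\<nu> n) \<le> ennreal v" "0 \<le> v"
    and p: "1 \<le> p" "p \<le> 2" and d: "0 < d"
  defines "W \<equiv> \<lambda>n x. truncated K t n x / (\<Prod>k<n. a k)"
  shows "(\<integral>\<^sup>+x. ennreal \<bar>W (Suc n) x - W n x\<bar> \<partial>Q)
    \<le> ennreal (sqrt v / a n * (d + d powr (1 - p) * (\<Prod>k<n. b k / a k powr p)))"
proof -
  define m where "m = (\<Prod>k<n. a k)"
  have m: "0 < m" using a by (auto simp: m_def intro!: prod_pos)
  define h where "h x = offspring_sum K t x / a n - 1" for x
  interpret \<nu>: prob_space "\<nu> n" by (rule prob_space_\<nu>)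
  have [measurable]: "offspring_sum K t \<in> borel_measurable (\<nu> n)"
    by measurable
  have o1: "integrable (\<nu> n) (offspring_sum K t)" "(\<integral>x. offspring_sum K t x \<partial>\<nu> n) = a n"
    using a(1)[of n] a(2)[of n] nn_integral_eq_integrable[of "offspring_sum K t" "\<nu> n" "a n"]
    by (auto simp: truncated_mean_def)
  have o2: "integrable (\<nu> n) (\<lambda>x. (offspring_sum K t x)\<^sup>2)"
    using v by (intro integrableI_bounded) (auto intro: le_less_trans)
  have o2v: "(\<integral>x. (offspring_sum K t x)\<^sup>2 \<partial>\<nu> n) \<le> v"
    using v o2 by (simp add: nn_integral_eq_integral)
  have h1: "integrable (\<nu> n) h" "(\<integral>x. h x \<partial>\<nu> n) = 0"
    using o1 a(2)[of n] by (simp_all add: h_def[abs_def] \<nu>.prob_space)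
  have h_sq: "(\<lambda>x. (h x)\<^sup>2) = (\<lambda>x. (offspring_sum K t x)\<^sup>2 / (a n)\<^sup>2 - 2 / a n * offspring_sum K t x + 1)"
    by (simp add: h_def fun_eq_iff power2_diff power_divide)
  have h2: "integrable (\<nu> n) (\<lambda>x. (h x)\<^sup>2)" unfolding h_sq using o1 o2 by simp
  have "(\<integral>x. (h x)\<^sup>2 \<partial>\<nu> n) = (\<integral>x. (offspring_sum K t x)\<^sup>2 \<partial>\<nu> n) / (a n)\<^sup>2 - 1"
    unfolding h_sq using o1 o2 a(2)[of n] by (simp add: \<nu>.prob_space)
  also have "\<dots> \<le> v / (a n)\<^sup>2" using o2v divide_right_mono[OF o2v, of "(a n)\<^sup>2"] by simp
  finally have hv: "(\<integral>x. (h x)\<^sup>2 \<partial>\<nu> n) \<le> v / (a n)\<^sup>2" .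
  define D where "D x = (\<Sum>u\<in>labels K n. path_weight t u x / m * h (x u))" for x
  have inc: "W (Suc n) x - W n x = D x" for x
  proof -
    have "D x = (\<Sum>u\<in>labels K n. path_weight t u x * offspring_sum K t (x u) / (a n * m) - path_weight t u x / m)"
      unfolding D_def h_def using a(2)[of n] m by (intro sum.cong) (auto simp: field_simps)
    then show ?thesis
      using a(2)[of n] m by (simp add: W_def truncated_Suc truncated_def[of K t n] m_def sum_subtractf
          sum_divide_distrib[symmetric] mult.commute)
  qed
  have [measurable]: "h \<in> borel_measurable offspring_space" unfolding h_def[abs_def] by measurable
  have [measurable]: "D \<in> borel_measurable tree_space" unfolding D_def[abs_def] by measurable
  \<comment> \<open>Splicing at generation \<open>n\<close> freezes the path weights at
    \<open>x\<close> and leaves fresh vectors \<open>y u\<close>; the inner integral is then a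
    conditional expectation.\<close>
  let ?A = "{u :: nat list. length u < n}"
  have "(\<integral>\<^sup>+x. ennreal \<bar>D x\<bar> \<partial>Q) = (\<integral>\<^sup>+x. \<integral>\<^sup>+y. ennreal \<bar>D (splice ?A x y)\<bar> \<partial>Q \<partial>Q)"
    by (rule nn_integral_splice) simp_all
  also have "\<dots> = (\<integral>\<^sup>+x. \<integral>\<^sup>+y. ennreal \<bar>\<Sum>u\<in>labels K n. path_weight t u x / m * h (y u)\<bar> \<partial>Q \<partial>Q)"
  proof (intro nn_integral_cong arg_cong[where f=ennreal] arg_cong[where f=abs])
    fix x y
    have "path_weight t u (splice ?A x y) = path_weight t u x" "splice ?A x y u = y u" if "u \<in> labels K n" for u
      using depends_on_path_weight[of u t] length_labels[OF that]
      unfolding depends_on_def by (auto simp: splice_def)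
    then show "D (splice ?A x y) = (\<Sum>u\<in>labels K n. path_weight t u x / m * h (y u))"
      unfolding D_def by (intro sum.cong) auto
  qed
  also have "\<dots> \<le> (\<integral>\<^sup>+x. ennreal (sqrt v / a n * d + sqrt v / a n * d powr (1 - p) / m powr p * truncated K (p * t) n x) \<partial>Q)"
  proof (rule nn_integral_mono)
    fix x
    \<comment> \<open>The right side is linear in the \<open>p\<close>-th powers of the weights, and
      these are path weights at \<open>p * t\<close>; its outer integral is therefore a product of
      truncated means.\<close>
    have "sqrt (\<Sum>u\<in>labels K n. (path_weight t u x / m)\<^sup>2)
        \<le> d + d powr (1 - p) * (\<Sum>u\<in>labels K n. (path_weight t u x / m) powr p)"
      using m p d by (intro sqrt_sum_squares_le) auto
    also have "(\<Sum>u\<in>labels K n. (path_weight t u x / m) powr p) = truncated K (p * t) n x / m powr p"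
      using m by (simp add: powr_divide path_weight_powr truncated_def sum_divide_distrib)
    finally have s: "sqrt (\<Sum>u\<in>labels K n. (path_weight t u x / m)\<^sup>2)
        \<le> d + d powr (1 - p) * (truncated K (p * t) n x / m powr p)" .
    have "(\<integral>\<^sup>+y. ennreal \<bar>\<Sum>u\<in>labels K n. path_weight t u x / m * h (y u)\<bar> \<partial>Q)
        \<le> ennreal (sqrt ((\<integral>a. (h a)\<^sup>2 \<partial>\<nu> n) * (\<Sum>u\<in>labels K n. (path_weight t u x / m)\<^sup>2)))"
      by (rule nn_integral_abs_sum_le) (use h1 h2 in \<open>auto simp: length_labels\<close>)
    also have "\<dots> \<le> ennreal (sqrt (v / (a n)\<^sup>2 * (\<Sum>u\<in>labels K n. (path_weight t u x / m)\<^sup>2)))"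
      using hv by (intro ennreal_leI real_sqrt_le_mono mult_right_mono sum_nonneg) auto
    also have "\<dots> = ennreal (sqrt v / a n * sqrt (\<Sum>u\<in>labels K n. (path_weight t u x / m)\<^sup>2))"
      using a(2)[of n] by (simp add: real_sqrt_mult real_sqrt_divide)
    also have "\<dots> \<le> ennreal (sqrt v / a n * (d + d powr (1 - p) * (truncated K (p * t) n x / m powr p)))"
      using s v(2) a(2)[of n] by (intro ennreal_leI mult_left_mono) auto
    finally show "(\<integral>\<^sup>+y. ennreal \<bar>\<Sum>u\<in>labels K n. path_weight t u x / m * h (y u)\<bar> \<partial>Q)
        \<le> ennreal (sqrt v / a n * d + sqrt v / a n * d powr (1 - p) / m powr p * truncated K (p * t) n x)"
      by (simp add: algebra_simps)
  qed
  also have "\<dots> = ennreal (sqrt v / a n * d) + ennreal (sqrt v / a n * d powr (1 - p) / m powr p) * (\<Prod>k<n. ennreal (b k))"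
  proof -
    have *: "(\<integral>\<^sup>+x. ennreal (c + c' * truncated K (p * t) n x) \<partial>Q) = ennreal c + ennreal c' * (\<Prod>k<n. ennreal (b k))"
      if "0 \<le> c" "0 \<le> c'" for c c'
      using that by (simp add: nn_integral_add nn_integral_cmult ennreal_mult nn_integral_truncated b(1) P.emeasure_space_1)
    show ?thesis by (rule *) (use v(2) a(2)[of n] d m in auto)
  qed
  also have "\<dots> = ennreal (sqrt v / a n * d + sqrt v / a n * d powr (1 - p) / m powr p * (\<Prod>k<n. b k))"
    using v(2) a(2)[of n] d b(2) by (simp add: prod_ennreal less_imp_le prod_nonneg flip: ennreal_mult ennreal_plus)
  also have "m powr p = (\<Prod>k<n. a k powr p)"
    using a(2) unfolding m_def by (induction n) (auto simp: powr_mult less_imp_le prod_nonneg)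
  also have "sqrt v / a n * d + sqrt v / a n * d powr (1 - p) / (\<Prod>k<n. a k powr p) * (\<Prod>k<n. b k)
      = sqrt v / a n * (d + d powr (1 - p) * (\<Prod>k<n. b k / a k powr p))"
    by (simp add: prod_dividef algebra_simps)
  finally show ?thesis by (simp add: inc)
qed


text \<open>If growth failed almost surely, the normalized sums \<open>W\<close> would tend to 0.
  But each \<open>W n\<close> has mean 1, and for late \<open>n\<close> the expected total variation
  after \<open>n\<close> is below 1, which is incompatible with the limit 0.\<close>

lemma not_AE_not_growing:
  assumes a: "\<And>k. truncated_mean K t k = ennreal (a k)" "\<And>k. 0 < a k"
    and b: "\<And>k. truncated_mean K (p * t) k = ennreal (b k)" "\<And>k. 0 < b k"
    and v: "\<And>n. (\<integral>\<^sup>+x. ennreal ((offspring_sum K t x)\<^sup>2) \<partial>\<nu> n) \<le> ennreal (v n)" "\<And>n. 0 \<le> v n"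
    and p: "1 \<le> p" "p \<le> 2"
    and lim_a: "(\<lambda>n. (\<Sum>k<n. ln (a k)) / n) \<longlonglongrightarrow> \<alpha>"
    and lim_b: "(\<lambda>n. (\<Sum>k<n. ln (b k)) / n) \<longlonglongrightarrow> \<beta>"
    and lim_v: "\<And>e. 0 < e \<Longrightarrow> \<forall>\<^sub>F n in sequentially. sqrt (v n) / a n \<le> exp (e * real n)"
    and less: "\<beta> < p * \<alpha>" and c: "c < \<alpha>"
  shows "\<not> (AE x in Q. \<not> growing t c x)"
proof
  assume not_growing: "AE x in Q. \<not> growing t c x"
  define W where "W n x = truncated K t n x / (\<Prod>k<n. a k)" for n x
  have [measurable]: "W n \<in> borel_measurable tree_space" for n unfolding W_def[abs_def] by measurable
  have prod_a: "(\<Prod>k<n. a k) = exp (\<Sum>k<n. ln (a k))" for n using a(2) by (simp add: exp_sum)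
  have W0: "0 \<le> W n x" for n x by (simp add: W_def prod_a)
  \<comment> \<open>The limiting exponent of the product of \<open>b k / a k powr p\<close> is
    \<open>- 8 * e\<close>. Half of it is lost to the limit; from the rest, \<open>\<delta>\<close>
    keeps \<open>2 * e\<close>, of which the moment factor costs at most \<open>e\<close>.\<close>
  define e where "e = (p * \<alpha> - \<beta>) / 8"
  have e: "0 < e" using less by (simp add: e_def)
  define r where "r = exp (- e)"
  have r: "0 < r" "r < 1" using e by (auto simp: r_def)
  have lim_ab: "(\<lambda>n. (\<Sum>k<n. ln (b k)) / n - p * ((\<Sum>k<n. ln (a k)) / n)) \<longlonglongrightarrow> \<beta> - p * \<alpha>"
    by (intro tendsto_intros lim_a lim_b)
  have ev: "\<forall>\<^sub>F n in sequentially. (\<Sum>k<n. ln (b k)) / n - p * ((\<Sum>k<n. ln (a k)) / n) < - 4 * e"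
    by (rule order_tendstoD(2)[OF lim_ab]) (use less in \<open>simp add: e_def mult.commute\<close>)
  have inc: "\<forall>\<^sub>F n in sequentially. (\<integral>\<^sup>+x. ennreal \<bar>W (Suc n) x - W n x\<bar> \<partial>Q) \<le> ennreal (2 * r ^ n)"
    using ev lim_v[OF e] eventually_gt_at_top[of 0]
  proof eventually_elim
    case (elim n)
    \<comment> \<open>This balances the two interpolation terms: since \<open>p - 1 \<le> 1\<close>,
      the second one is at most \<open>exp (2 * e * n - 4 * e * n)\<close>, which is
      \<open>\<delta>\<close> again.\<close>
    define \<delta> where "\<delta> = exp (- 2 * e * n)"
    have rn: "r ^ n = exp (- e * n)" by (simp add: r_def exp_of_nat_mult[symmetric] mult.commute)
    have "b k / a k powr p = exp (ln (b k) - p * ln (a k))" for k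
      using a(2)[of k] b(2)[of k] by (simp add: exp_diff powr_def)
    then have "(\<Prod>k<n. b k / a k powr p) = exp (\<Sum>k<n. ln (b k) - p * ln (a k))"
      by (simp add: exp_sum)
    also have "\<dots> \<le> exp (- 4 * e * n)"
      using elim by (simp add: sum_subtractf field_simps flip: sum_distrib_left)
    finally have "\<delta> powr (1 - p) * (\<Prod>k<n. b k / a k powr p) \<le> \<delta> powr (1 - p) * exp (- 4 * e * n)"
      by (intro mult_left_mono) auto
    also have "\<dots> = exp (2 * e * n * (p - 1) - 4 * e * n)"
      unfolding \<delta>_def exp_powr_real exp_add[symmetric] by (simp add: algebra_simps)
    also have "\<dots> \<le> \<delta>" using p e elim by (simp add: \<delta>_def algebra_simps)
    finally have *: "\<delta> + \<delta> powr (1 - p) * (\<Prod>k<n. b k / a k powr p) \<le> 2 * \<delta>" by simp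
    have "(\<integral>\<^sup>+x. ennreal \<bar>W (Suc n) x - W n x\<bar> \<partial>Q)
        \<le> ennreal (sqrt (v n) / a n * (\<delta> + \<delta> powr (1 - p) * (\<Prod>k<n. b k / a k powr p)))"
      unfolding W_def by (rule martingale_increment[OF a b v p]) (simp add: \<delta>_def)
    also have "\<dots> \<le> ennreal (exp (e * n) * (2 * \<delta>))"
    proof (intro ennreal_leI mult_mono)
      show "0 \<le> \<delta> + \<delta> powr (1 - p) * (\<Prod>k<n. b k / a k powr p)"
        using b(2) by (intro add_nonneg_nonneg mult_nonneg_nonneg prod_nonneg)
          (simp_all add: \<delta>_def less_imp_le)
    qed (use * elim in simp_all)
    also have "exp (e * n) * (2 * \<delta>) = 2 * r ^ n"
      unfolding rn \<delta>_def by (simp add: exp_minus field_simps flip: exp_add)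
    finally show ?case .
  qed
  have "AE x in Q. summable (\<lambda>n. \<bar>W (Suc n) x - W n x\<bar>)"
    by (rule AE_summable_if_nn_integral_le[OF _ _ _ _ inc]) (use r in \<open>auto intro!: summable_mult summable_geometric\<close>)
  with not_growing have AE: "AE x in Q. summable (\<lambda>n. \<bar>W (Suc n) x - W n x\<bar>) \<and> (\<lambda>n. W n x) \<longlonglongrightarrow> 0"
  proof eventually_elim
    case (elim x)
    have "summable (\<lambda>n. W (Suc n) x - W n x)" by (rule summable_rabs_cancel) (rule elim(2))
    from tendsto_add[OF summable_LIMSEQ[OF this] tendsto_const[of "W 0 x"]]
    obtain l where l: "(\<lambda>n. W n x) \<longlonglongrightarrow> l"
      unfolding sum_lessThan_telescope[of "\<lambda>n. W n x"] by auto
    have "l = 0"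
    proof (rule ccontr)
      assume "l \<noteq> 0"
      moreover have "0 \<le> l" by (rule LIMSEQ_le_const[OF l]) (use W0 in auto)
      ultimately have l0: "0 < l" by simp
      \<comment> \<open>Eventually \<open>W n x\<close> exceeds \<open>l / 2\<close>, so
        \<open>j\<close> absorbs the factor \<open>2 / l\<close>. The product of the
        \<open>a k\<close> itself eventually exceeds \<open>exp (c * n)\<close>, because
        \<open>c < \<alpha>\<close>.\<close>
      obtain j :: nat where j: "2 / l < j" using reals_Archimedean2 by blast
      have "\<forall>\<^sub>F n in sequentially. exp (c * n) \<le> real j * partition_function x n t"
        using order_tendstoD(1)[OF l, of "l / 2", simplified, OF l0] order_tendstoD(1)[OF lim_a c] eventually_gt_at_top[of 0]
      proof eventually_elim
        case (elim n)
        have "c * n \<le> (\<Sum>k<n. ln (a k))" using elim by (simp add: field_simps)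
        then have "exp (c * n) \<le> (\<Prod>k<n. a k)" by (simp add: prod_a)
        also have "\<dots> \<le> real j * truncated K t n x"
        proof -
          have "(\<Prod>k<n. a k) * (l / 2) \<le> truncated K t n x"
            using elim by (simp add: W_def prod_a field_simps)
          then have "real j * ((\<Prod>k<n. a k) * (l / 2)) \<le> real j * truncated K t n x" by (intro mult_left_mono) auto
          moreover have "(\<Prod>k<n. a k) * 1 \<le> (\<Prod>k<n. a k) * (real j * (l / 2))"
            using j l0 by (intro mult_left_mono) (auto simp: prod_a field_simps)
          ultimately show ?thesis by (simp add: algebra_simps)
        qed
        also have "\<dots> \<le> real j * partition_function x n t"
          by (intro mult_left_mono truncated_le_partition_function) simp
        finally show ?case .
      qed
      then show False using elim(1) unfolding growing_def eventually_sequentially by blast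
    qed
    with l elim show ?case by simp
  qed
  obtain N where N: "\<And>n. N \<le> n \<Longrightarrow> (\<integral>\<^sup>+x. ennreal \<bar>W (Suc n) x - W n x\<bar> \<partial>Q) \<le> ennreal (2 * r ^ n)"
    using inc by (auto simp: eventually_sequentially)
  have "(\<lambda>n. 2 * r ^ n / (1 - r)) \<longlonglongrightarrow> 2 * 0 / (1 - r)"
    using r by (intro tendsto_intros LIMSEQ_power_zero) auto
  then have "\<forall>\<^sub>F n in sequentially. 2 * r ^ n / (1 - r) < 1" by (rule order_tendstoD) simp
  then have "\<forall>\<^sub>F n in sequentially. 2 * r ^ n / (1 - r) < 1 \<and> N \<le> n"
    using eventually_ge_at_top[of N] by eventually_elim simp
  then obtain n where n: "2 * r ^ n / (1 - r) < 1" "N \<le> n" by (auto simp: eventually_sequentially)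
  have "(\<integral>\<^sup>+x. ennreal (W n x) \<partial>Q) = ennreal (1 / (\<Prod>k<n. a k)) * (\<integral>\<^sup>+x. ennreal (truncated K t n x) \<partial>Q)"
    unfolding W_def by (simp add: prod_a nn_integral_cmult[symmetric] flip: ennreal_mult) 
  also have "\<dots> = ennreal (1 / (\<Prod>k<n. a k)) * ennreal (\<Prod>k<n. a k)"
    using a by (simp add: nn_integral_truncated prod_ennreal less_imp_le)
  also have "\<dots> = 1" by (simp add: prod_a flip: ennreal_mult)
  \<comment> \<open>The unit mean now meets the tail of increments: as the limit is 0,
    \<open>W n x\<close> equals minus the sum of all later increments.\<close>
  finally have "1 = (\<integral>\<^sup>+x. ennreal (W n x) \<partial>Q)" ..
  also have "\<dots> \<le> (\<integral>\<^sup>+x. (\<Sum>k. ennreal \<bar>W (Suc (k + n)) x - W (k + n) x\<bar>) \<partial>Q)"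
  proof (rule nn_integral_mono_AE)
    show "AE x in Q. ennreal (W n x) \<le> (\<Sum>k. ennreal \<bar>W (Suc (k + n)) x - W (k + n) x\<bar>)"
      using AE
    proof eventually_elim
      case (elim x)
      then have s: "summable (\<lambda>k. \<bar>W (Suc (k + n)) x - W (k + n) x\<bar>)"
        using summable_iff_shift[of "\<lambda>n. \<bar>W (Suc n) x - W n x\<bar>" n] by simp
      have "(\<lambda>k. W (k + n) x) \<longlonglongrightarrow> 0" using elim by (intro LIMSEQ_ignore_initial_segment) simp
      from telescope_sums[OF this] have "(\<lambda>k. W (Suc (k + n)) x - W (k + n) x) sums - W n x" by simp
      then have "W n x = \<bar>\<Sum>k. W (Suc (k + n)) x - W (k + n) x\<bar>" using W0[of n x] by (simp add: sums_iff)
      also have "\<dots> \<le> (\<Sum>k. \<bar>W (Suc (k + n)) x - W (k + n) x\<bar>)" by (rule summable_rabs[OF s])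
      finally show ?case using s by (subst suminf_ennreal2) (auto intro: ennreal_leI)
    qed
  qed
  also have "\<dots> = (\<Sum>k. \<integral>\<^sup>+x. ennreal \<bar>W (Suc (k + n)) x - W (k + n) x\<bar> \<partial>Q)"
    by (rule nn_integral_suminf) simp
  also have "\<dots> \<le> (\<Sum>k. ennreal (2 * r ^ n * r ^ k))"
  proof (intro suminf_le summableI)
    fix k
    have "2 * r ^ n * r ^ k = 2 * r ^ (k + n)" by (simp add: power_add)
    then show "(\<integral>\<^sup>+x. ennreal \<bar>W (Suc (k + n)) x - W (k + n) x\<bar> \<partial>Q) \<le> ennreal (2 * r ^ n * r ^ k)"
      using N[of "k + n"] n(2) by (simp only:)
  qed
  also have "\<dots> = ennreal (2 * r ^ n / (1 - r))"
    using r by (subst suminf_ennreal2) (auto simp: suminf_mult suminf_geometric summable_geometric intro!: summable_mult)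
  also have "\<dots> < 1" using n(1) by (simp add: ennreal_less_one_iff)
  finally show False by simp
qed

end

text \<open>The last term is a difference of consecutive partial sums, whose averages share a limit.
  With logarithms for \<open>g\<close>, this shows that the factors of single generations are
  subexponential.\<close>

lemma term_over_n_tendsto_0:
  fixes g :: "nat \<Rightarrow> real"
  assumes "(\<lambda>n. (\<Sum>k<n. g k) / n) \<longlonglongrightarrow> l"
  shows "(\<lambda>n. g n / n) \<longlonglongrightarrow> 0"
proof -
  have "(\<lambda>n. (\<Sum>k<Suc n. g k) / Suc n * (1 + 1 / n) - (\<Sum>k<n. g k) / n) \<longlonglongrightarrow> l * (1 + 0) - l"
    by (intro tendsto_intros LIMSEQ_Suc[OF assms] assms lim_1_over_n)
  then have "(\<lambda>n. (\<Sum>k<Suc n. g k) / Suc n * (1 + 1 / n) - (\<Sum>k<n. g k) / n) \<longlonglongrightarrow> 0" by simp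
  moreover have "\<forall>\<^sub>F n in sequentially. (\<Sum>k<Suc n. g k) / Suc n * (1 + 1 / n) - (\<Sum>k<n. g k) / n = g n / n"
    using eventually_gt_at_top[of 0]
  proof eventually_elim
    case (elim n)
    have "1 + 1 / real n = Suc n / n" using elim by (simp add: field_simps)
    then have "(\<Sum>k<Suc n. g k) / Suc n * (1 + 1 / n) = (\<Sum>k<Suc n. g k) / n"
      by (simp only:) (simp del: of_nat_Suc sum.lessThan_Suc)
    then show ?case by (simp add: add_divide_distrib)
  qed
  ultimately show ?thesis by (rule Lim_transform_eventually)
qed

text \<open>The child's displacement and the delay by one generation cost only constant factors,
  which the multiplier in \<open>growing\<close> absorbs.\<close>

lemma growing_child:
  assumes "i < num_children x []" "growing t c (\<lambda>u. x (i # u))"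
  shows "growing t c x"
proof -
  let ?d = "exp (t * displacement x [] i)"
  obtain j :: nat and N where N: "\<And>n. N \<le> n \<Longrightarrow> exp (c * n) \<le> real j * partition_function (\<lambda>u. x (i # u)) n t"
    using assms(2) unfolding growing_def by blast
  obtain l :: nat where l: "exp c * real j / ?d \<le> l" using real_arch_simple by blast
  have "exp (c * n) \<le> real l * partition_function x n t" if n: "Suc N \<le> n" for n
  proof -
    obtain m where m: "n = Suc m" "N \<le> m" using n by (cases n) auto
    have "exp (c * n) = exp c * exp (c * m)" by (simp add: m algebra_simps flip: exp_add)
    also have "\<dots> \<le> exp c * (real j * partition_function (\<lambda>u. x (i # u)) m t)"
      using N[OF m(2)] by (intro mult_left_mono) auto
    also have "\<dots> = exp c * real j / ?d * (?d * partition_function (\<lambda>u. x (i # u)) m t)" by simp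
    also have "\<dots> \<le> real l * partition_function x n t"
      unfolding m(1) by (intro mult_mono l partition_function_child assms(1)) auto
    finally show ?thesis .
  qed
  then show ?thesis unfolding growing_def by blast
qed

lemma subtree_measurable [measurable]: "(\<lambda>x u. x (i # u)) \<in> tree_space \<rightarrow>\<^sub>M tree_space"
  by (rule measurable_PiM_single') (auto simp: space_PiM PiE_iff)

section \<open>Branching at the root and the probability of slow growth\<close>

context environment
begin

lemma component_measurable: "(\<lambda>x. x u) \<in> Q \<rightarrow>\<^sub>M offspring_space"
proof -
  have "(\<lambda>x. x u) \<in> Q \<rightarrow>\<^sub>M \<nu> (length u)" by (rule measurable_component_singleton) (rule UNIV_I)
  then show ?thesis unfolding measurable_cong_sets[OF refl sets_\<nu>] .
qed

lemma AE_nodes: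
  assumes "\<And>n. AE a in \<nu> n. P a"
  shows "AE x in Q. \<forall>u. P (x u)"
  unfolding AE_all_countable using AE_component[OF _ assms] by auto

lemma environment_Suc: "environment (\<lambda>n. \<nu> (Suc n))"
  by (rule environment.intro[OF prob_space_\<nu> sets_\<nu>])

lemma distr_subtree:
  "distr Q tree_space (\<lambda>x u. x (i # u)) = PiM UNIV (\<lambda>u :: nat list. \<nu> (Suc (length u)))"
proof -
  have "distr Q (PiM UNIV (\<lambda>u :: nat list. \<nu> (length (i # u)))) (\<lambda>x. \<lambda>u\<in>UNIV. x (i # u))
      = PiM UNIV (\<lambda>u :: nat list. \<nu> (length (i # u)))"
    by (rule distr_PiM_reindex) (auto simp: prob_space_\<nu>)
  moreover have "distr Q (PiM UNIV (\<lambda>u :: nat list. \<nu> (length (i # u)))) (\<lambda>x. \<lambda>u\<in>UNIV. x (i # u))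
      = distr Q tree_space (\<lambda>x u. x (i # u))"
    by (intro distr_cong) (auto intro!: sets_PiM_cong simp: sets_\<nu> restrict_def)
  ultimately show ?thesis by simp
qed

text \<open>Slow growth of the tree is inherited by the subtree of every child. One child always
  exists; with two or more, the first two subtrees are independent of each other and of the root,
  and both have the law of the shifted environment, whence the square.\<close>

lemma not_growing_le:
  fixes t c :: real
  assumes one: "AE a in \<nu> 0. 1 \<le> fst a"
  defines "q \<equiv> emeasure (PiM UNIV (\<lambda>u :: nat list. \<nu> (Suc (length u)))) {x \<in> space tree_space. \<not> growing t c x}"
  shows "emeasure Q {x \<in> space tree_space. \<not> growing t c x}
    \<le> emeasure (\<nu> 0) {a \<in> space (\<nu> 0). fst a < 2} * q + emeasure (\<nu> 0) {a \<in> space (\<nu> 0). \<not> fst a < 2} * (q * q)"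
proof -
  let ?G = "\<lambda>x. indicator {x \<in> space tree_space. \<not> growing t c x} x :: ennreal"
  let ?s = "\<lambda>i x u. x (i # u)"
  let ?l = "\<lambda>a :: nat \<times> (nat \<Rightarrow> real). if fst a < 2 then 1 else 0 :: ennreal"
  let ?h = "\<lambda>a :: nat \<times> (nat \<Rightarrow> real). if \<not> fst a < 2 then 1 else 0 :: ennreal"
  let ?L = "\<lambda>x :: nat list \<Rightarrow> nat \<times> (nat \<Rightarrow> real). ?l (x [])"
  let ?H = "\<lambda>x :: nat list \<Rightarrow> nat \<times> (nat \<Rightarrow> real). ?h (x [])"
  have lh [measurable]: "?l \<in> borel_measurable offspring_space" "?h \<in> borel_measurable offspring_space"
    unfolding offspring_space_def by measurable
  have [measurable]: "{a \<in> space (\<nu> 0). fst a < 2} \<in> sets (\<nu> 0)" "{a \<in> space (\<nu> 0). \<not> fst a < 2} \<in> sets (\<nu> 0)"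
    unfolding sets_eq_imp_space_eq[OF sets_\<nu>] sets_\<nu> unfolding offspring_space_def by (measurable, measurable)
  have LH [measurable]: "?L \<in> borel_measurable Q" "?H \<in> borel_measurable Q"
    by (rule measurable_compose[OF component_measurable lh(1)], rule measurable_compose[OF component_measurable lh(2)])
  have G [measurable]: "?G \<in> borel_measurable tree_space" by measurable
  have Gs [measurable]: "(\<lambda>x. ?G (?s i x)) \<in> borel_measurable Q" for i
    by (rule measurable_compose[OF _ G]) measurable
  have intG: "(\<integral>\<^sup>+x. ?G (?s i x) \<partial>Q) = q" for i
  proof -
    have "(\<integral>\<^sup>+x. ?G (?s i x) \<partial>Q) = (\<integral>\<^sup>+x. ?G x \<partial>distr Q tree_space (?s i))"
      by (subst nn_integral_distr) auto
    also have "\<dots> = (\<integral>\<^sup>+x. ?G x \<partial>PiM UNIV (\<lambda>u :: nat list. \<nu> (Suc (length u))))"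
      by (simp only: distr_subtree)
    also have "\<dots> = q" unfolding q_def
      using environment.sets_Q[OF environment_Suc]
      by (intro nn_integral_indicator) auto
    finally show ?thesis .
  qed
  have intL: "(\<integral>\<^sup>+x. ?L x \<partial>Q) = emeasure (\<nu> 0) {a \<in> space (\<nu> 0). fst a < 2}"
  proof -
    have "(\<integral>\<^sup>+x. ?L x \<partial>Q) = (\<integral>\<^sup>+a. ?l a \<partial>\<nu> 0)"
      using nn_integral_component[OF lh(1), of "[]"] by simp
    also have "\<dots> = (\<integral>\<^sup>+a. indicator {a \<in> space (\<nu> 0). fst a < 2} a \<partial>\<nu> 0)"
      by (intro nn_integral_cong) (simp add: indicator_def)
    finally show ?thesis by simp
  qed
  have intH: "(\<integral>\<^sup>+x. ?H x \<partial>Q) = emeasure (\<nu> 0) {a \<in> space (\<nu> 0). \<not> fst a < 2}"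
  proof -
    have "(\<integral>\<^sup>+x. ?H x \<partial>Q) = (\<integral>\<^sup>+a. ?h a \<partial>\<nu> 0)"
      using nn_integral_component[OF lh(2), of "[]"] by simp
    also have "\<dots> = (\<integral>\<^sup>+a. indicator {a \<in> space (\<nu> 0). \<not> fst a < 2} a \<partial>\<nu> 0)"
      by (intro nn_integral_cong) (simp add: indicator_def)
    finally show ?thesis by simp
  qed
  have dG: "depends_on (range ((#) i)) (\<lambda>x. ?G (?s i x))" for i
    unfolding depends_on_def
  proof (intro allI impI)
    fix x y :: "nat list \<Rightarrow> nat \<times> (nat \<Rightarrow> real)" assume "\<forall>u\<in>range ((#) i). x u = y u"
    then have "?s i x = ?s i y" by auto
    then show "?G (?s i x) = ?G (?s i y)" by (simp only:)
  qed
  have mono: "depends_on A f \<Longrightarrow> A \<subseteq> B \<Longrightarrow> depends_on B f"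
    for A B :: "nat list set" and f :: "(nat list \<Rightarrow> nat \<times> (nat \<Rightarrow> real)) \<Rightarrow> ennreal"
    unfolding depends_on_def by blast
  have dG': "depends_on (- {[]}) (\<lambda>x. ?G (?s i x))" for i
    by (rule mono[OF dG]) auto
  have dGG: "depends_on (- {[]}) (\<lambda>x. ?G (?s 0 x) * ?G (?s 1 x))"
    unfolding depends_on_def
  proof (intro allI impI arg_cong2[where f=times])
    fix x y :: "nat list \<Rightarrow> nat \<times> (nat \<Rightarrow> real)" assume *: "\<forall>u\<in>- {[]}. x u = y u"
    show "?G (?s 0 x) = ?G (?s 0 y)" by (rule dG'[unfolded depends_on_def, rule_format]) (use * in blast)
    show "?G (?s 1 x) = ?G (?s 1 y)" by (rule dG'[unfolded depends_on_def, rule_format]) (use * in blast)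
  qed
  have "emeasure Q {x \<in> space tree_space. \<not> growing t c x} = (\<integral>\<^sup>+x. ?G x \<partial>Q)"
    using sets_Q by (intro nn_integral_indicator[symmetric]) auto
  also have "\<dots> \<le> (\<integral>\<^sup>+x. ?L x * ?G (?s 0 x) + ?H x * (?G (?s 0 x) * ?G (?s 1 x)) \<partial>Q)"
  proof (rule nn_integral_mono_AE)
    have "AE x in Q. 1 \<le> fst (x [])"
      using one AE_component[of "[]" "\<lambda>a. 1 \<le> fst a", OF UNIV_I] unfolding list.size by blast
    then show "AE x in Q. ?G x \<le> ?L x * ?G (?s 0 x) + ?H x * (?G (?s 0 x) * ?G (?s 1 x))"
    proof eventually_elim
      case (elim x)
      have sp: "?s i x \<in> space tree_space" if "x \<in> space tree_space" for i
        using that by (auto simp: space_PiM PiE_iff)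
      show ?case
      proof (cases "fst (x []) < 2")
        case True
        then show ?thesis using growing_child[of 0 x t c] elim sp by (auto simp: indicator_def)
      next
        case False
        then have "0 < fst (x [])" "1 < fst (x [])" by auto
        then show ?thesis
          using False growing_child[of 0 x t c] growing_child[of 1 x t c] sp by (auto simp: indicator_def)
      qed
    qed
  qed
  also have "\<dots> = (\<integral>\<^sup>+x. ?L x * ?G (?s 0 x) \<partial>Q) + (\<integral>\<^sup>+x. ?H x * (?G (?s 0 x) * ?G (?s 1 x)) \<partial>Q)"
    by (rule nn_integral_add) measurable
  also have "(\<integral>\<^sup>+x. ?L x * ?G (?s 0 x) \<partial>Q) = (\<integral>\<^sup>+x. ?L x \<partial>Q) * (\<integral>\<^sup>+x. ?G (?s 0 x) \<partial>Q)"
    by (rule nn_integral_mult_indep[OF refl _ _ _ dG']) (auto simp: depends_on_def)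
  also have "(\<integral>\<^sup>+x. ?H x * (?G (?s 0 x) * ?G (?s 1 x)) \<partial>Q) = (\<integral>\<^sup>+x. ?H x \<partial>Q) * (\<integral>\<^sup>+x. ?G (?s 0 x) * ?G (?s 1 x) \<partial>Q)"
    by (rule nn_integral_mult_indep[OF refl _ _ _ dGG]) (auto simp: depends_on_def)
  also have "(\<integral>\<^sup>+x. ?G (?s 0 x) * ?G (?s 1 x) \<partial>Q) = (\<integral>\<^sup>+x. ?G (?s 0 x) \<partial>Q) * (\<integral>\<^sup>+x. ?G (?s 1 x) \<partial>Q)"
    by (rule nn_integral_mult_indep[OF refl _ _ dG mono[OF dG]]) auto
  finally show ?thesis by (simp only: intG intL intH)
qed

end

section \<open>Exponential moments of a single reproduction vector\<close>

definition child_sum :: "real \<Rightarrow> nat \<times> (nat \<Rightarrow> real) \<Rightarrow> real" where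
  "child_sum t a = (\<Sum>i<fst a. exp (t * snd a i))"

lemma child_sum_nonneg [simp]: "0 \<le> child_sum t a"
  by (simp add: child_sum_def sum_nonneg)

lemma offspring_sum_eq: "offspring_sum K t a = (\<Sum>i\<in>{..<K} \<inter> {..<fst a}. exp (t * snd a i))"
  unfolding offspring_sum_def child_weight_def by (subst sum.inter_restrict) auto

lemma offspring_sum_le: "offspring_sum K t a \<le> child_sum t a"
  unfolding offspring_sum_eq child_sum_def by (intro sum_mono2) auto

lemma offspring_sum_tendsto: "(\<lambda>K. offspring_sum K t a) \<longlonglongrightarrow> child_sum t a"
proof (rule tendsto_eventually)
  show "\<forall>\<^sub>F K in sequentially. offspring_sum K t a = child_sum t a"
    using eventually_ge_at_top[of "fst a"]
    by eventually_elim (auto simp: offspring_sum_eq child_sum_def intro!: sum.cong)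
qed

lemma child_sum_measurable [measurable]: "child_sum t \<in> borel_measurable offspring_space"
  by (rule borel_measurable_LIMSEQ_real[OF offspring_sum_tendsto]) measurable

text \<open>The purpose of truncation: Cauchy-Schwarz over \<open>K\<close> terms, and squaring an
  exponential weight doubles its parameter. So a second moment at \<open>t\<close> is controlled by
  a mean at \<open>2 * t\<close>.\<close>

lemma offspring_sum_square_le: "(offspring_sum K t a)\<^sup>2 \<le> real K * child_sum (2 * t) a"
proof -
  have "(offspring_sum K t a)\<^sup>2 \<le> (\<Sum>i<K. (child_weight t i a)\<^sup>2) * (\<Sum>i<K. 1\<^sup>2)"
    using Cauchy_Schwarz_ineq_sum[of "\<lambda>i. child_weight t i a" "\<lambda>_. 1" "{..<K}"]
    by (simp add: offspring_sum_def)
  also have "(\<Sum>i<K. (child_weight t i a)\<^sup>2) = offspring_sum K (2 * t) a"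
    unfolding offspring_sum_def
    by (intro sum.cong) (auto simp: child_weight_def power2_eq_square algebra_simps simp flip: exp_add)
  finally show ?thesis using offspring_sum_le[of K "2 * t" a] by (simp add: mult.commute mult_left_mono order_trans)
qed

text \<open>Reduces finiteness of the means at all real parameters to integer parameters, so that a
  single null set suffices.\<close>

lemma child_sum_bound:
  assumes "\<bar>t\<bar> \<le> s"
  shows "child_sum t a \<le> child_sum s a + child_sum (- s) a"
proof -
  have "exp (t * l) \<le> exp (s * l) + exp (- s * l)" for l :: real
  proof -
    have "t * l \<le> \<bar>t\<bar> * \<bar>l\<bar>" by (metis abs_ge_self abs_mult)
    also have "\<dots> \<le> s * \<bar>l\<bar>" using assms by (intro mult_right_mono) auto
    finally have "t * l \<le> s * l \<or> t * l \<le> - s * l" by (auto simp: abs_if split: if_splits)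
    then show ?thesis by (auto intro: add_increasing add_increasing2)
  qed
  then show ?thesis unfolding child_sum_def by (simp add: sum.distrib[symmetric] sum_mono)
qed

text \<open>Stated with an exponential tilt because this stronger convexity survives integration and
  implies convexity of the logarithm.\<close>

lemma convex_child_sum: "convex_on UNIV (\<lambda>t. exp (t * c) * child_sum t a)"
proof -
  have "exp (t * c) * child_sum t a = (\<Sum>i<fst a. exp (t * (c + snd a i) + 0))" for t
    by (simp add: child_sum_def sum_distrib_left algebra_simps exp_add)
  moreover have "convex_on UNIV (\<lambda>t. \<Sum>i<fst a. exp (t * (c + snd a i) + 0))"
    by (intro convex_on_sum_fun convex_on_exp_linear) auto
  ultimately show ?thesis by (simp only:)
qed

lemma differentiable_child_sum: "(\<lambda>t. child_sum t a) differentiable (at t)"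
proof -
  have "((\<lambda>t. child_sum t a) has_real_derivative (\<Sum>i<fst a. exp (t * snd a i) * (1 * snd a i))) (at t)"
    unfolding child_sum_def by (intro DERIV_sum DERIV_fun_exp DERIV_cmult_right DERIV_ident)
  then show ?thesis by (auto simp: real_differentiable_def)
qed

lemma
  assumes sets: "sets N = sets offspring_space"
    and fin: "\<And>t. (\<integral>\<^sup>+a. ennreal (child_sum t a) \<partial>N) < \<infinity>" and pos: "\<And>t. 0 < (\<integral>\<^sup>+a. ennreal (child_sum t a) \<partial>N)"
  defines "m \<equiv> \<lambda>t. enn2real (\<integral>\<^sup>+a. ennreal (child_sum t a) \<partial>N)"
  shows convex_on_ln_child_mean: "convex_on UNIV (\<lambda>t. ln (m t))"
    and differentiable_ln_child_mean: "(\<lambda>t. ln (m t)) differentiable (at t)"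
proof -
  have meas: "child_sum t \<in> borel_measurable N" for t
    using child_sum_measurable unfolding measurable_cong_sets[OF sets refl] .
  have int: "integrable N (child_sum t)" for t
    using fin[of t] by (intro integrableI_bounded meas) simp
  have m: "m = (\<lambda>t. \<integral>a. child_sum t a \<partial>N)"
    unfolding m_def using int by (simp add: nn_integral_eq_integral integral_nonneg_AE)
  have m0: "0 < m t" for t unfolding m_def using fin[of t] pos[of t] by (simp add: enn2real_positive_iff)
  show "convex_on UNIV (\<lambda>t. ln (m t))"
  proof (rule convex_on_ln[OF _ m0])
    fix c
    have "convex_on UNIV (\<lambda>t. \<integral>a. exp (t * c) * child_sum t a \<partial>N)"
      by (rule convex_on_integral) (use int convex_child_sum in auto)
    then show "convex_on UNIV (\<lambda>t. exp (t * c) * m t)" by (simp add: m)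
  qed
  have "m differentiable (at t)" unfolding m
    by (rule differentiable_integral_convex) (use int convex_child_sum[of 0] differentiable_child_sum in auto)
  then obtain D where "(m has_real_derivative D) (at t)" by (auto simp: real_differentiable_def)
  from DERIV_chain2[OF DERIV_ln[OF m0] this]
  show "(\<lambda>t. ln (m t)) differentiable (at t)" by (auto simp: real_differentiable_def)
qed

text \<open>Jensen's inequality, by integrating the tangent line of \<open>exp\<close> at the
  mean.\<close>

lemma exp_integral_le:
  fixes f :: "'a \<Rightarrow> real"
  assumes "prob_space N" "integrable N f" "integrable N (\<lambda>x. exp (f x))"
  shows "exp (\<integral>x. f x \<partial>N) \<le> (\<integral>x. exp (f x) \<partial>N)"
proof -
  interpret prob_space N by fact
  let ?m = "\<integral>x. f x \<partial>N"
  have "exp ?m = (\<integral>x. exp ?m * (1 + (f x - ?m)) \<partial>N)"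
    using assms(2) by (simp add: prob_space)
  also have "\<dots> \<le> (\<integral>x. exp (f x) \<partial>N)"
  proof (rule integral_mono)
    show "exp ?m * (1 + (f x - ?m)) \<le> exp (f x)" for x
      using mult_left_mono[OF exp_ge_add_one_self[of "f x - ?m"], of "exp ?m"] by (simp add: exp_diff)
  qed (use assms in auto)
  finally show ?thesis .
qed

text \<open>Keeping only the first child and applying Jensen's inequality bounds the truncated mean
  below by the exponential of \<open>t\<close> times the mean first displacement. The resulting
  bound on its logarithm does not involve \<open>K\<close>, so it can dominate the limit in
  \<open>K\<close>.\<close>

lemma
  fixes t :: real
  assumes N: "prob_space N" and sets: "sets N = sets offspring_space"
    and one: "AE a in N. 1 \<le> fst a" and L: "(\<integral>\<^sup>+a. ennreal \<bar>snd a 0\<bar> \<partial>N) < \<infinity>"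
    and fin: "(\<integral>\<^sup>+a. ennreal (child_sum t a) \<partial>N) < \<infinity>" and K: "0 < K"
  defines "T \<equiv> \<integral>\<^sup>+a. ennreal (offspring_sum K t a) \<partial>N"
  shows truncated_mean_positive: "0 < T"
    and truncated_mean_finite: "T < \<infinity>"
    and ln_truncated_mean_le: "ln (enn2real T) \<le> ln (enn2real (\<integral>\<^sup>+a. ennreal (child_sum t a) \<partial>N))"
    and ln_truncated_mean_bound: "\<bar>ln (enn2real T)\<bar> \<le> \<bar>ln (enn2real (\<integral>\<^sup>+a. ennreal (child_sum t a) \<partial>N))\<bar>
        + \<bar>t\<bar> * enn2real (\<integral>\<^sup>+a. ennreal \<bar>snd a 0\<bar> \<partial>N)"
proof -
  interpret prob_space N by fact
  note meas = measurable_cong_sets[OF sets refl]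
  let ?C = "\<integral>\<^sup>+a. ennreal (child_sum t a) \<partial>N"
  have snd0: "(\<lambda>a. snd a 0 :: real) \<in> borel_measurable N"
    unfolding meas offspring_space_def by measurable
  have cw: "child_weight t 0 \<in> borel_measurable N" unfolding meas by measurable
  have TC: "T \<le> ?C" unfolding T_def by (intro nn_integral_mono ennreal_leI offspring_sum_le)
  have intL: "integrable N (\<lambda>a. snd a 0)"
    using L snd0 by (intro integrableI_bounded) auto
  have le: "(\<integral>\<^sup>+a. ennreal (child_weight t 0 a) \<partial>N) \<le> T"
    unfolding T_def offspring_sum_def
    by (intro nn_integral_mono ennreal_leI member_le_sum) (use K in auto)
  have eq: "AE a in N. exp (t * snd a 0) = child_weight t 0 a"
    using one by eventually_elim (simp add: child_weight_def)
  have intc: "integrable N (child_weight t 0)"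
    by (rule integrableI_nonneg[OF cw AE_I2[OF child_weight_nonneg] le_less_trans[OF le le_less_trans[OF TC fin]]])
  have m: "(\<lambda>a. exp (t * snd a 0)) \<in> borel_measurable N"
    by (intro borel_measurable_exp[THEN measurable_compose[rotated]] borel_measurable_times borel_measurable_const snd0)
  have inte: "integrable N (\<lambda>a. exp (t * snd a 0))"
    using integrable_cong_AE[OF m cw eq] intc by simp
  have int_eq: "(\<integral>a. exp (t * snd a 0) \<partial>N) = (\<integral>a. child_weight t 0 a \<partial>N)"
    by (rule integral_cong_AE[OF m cw eq])
  have "exp (\<integral>a. t * snd a 0 \<partial>N) \<le> (\<integral>a. exp (t * snd a 0) \<partial>N)"
    by (rule exp_integral_le[OF N _ inte]) (use intL in simp)
  then have "ennreal (exp (t * (\<integral>a. snd a 0 \<partial>N))) \<le> ennreal (\<integral>a. child_weight t 0 a \<partial>N)"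
    by (simp add: int_eq ennreal_leI)
  also have "\<dots> = (\<integral>\<^sup>+a. ennreal (child_weight t 0 a) \<partial>N)"
    by (rule nn_integral_eq_integral[symmetric]) (use intc in auto)
  finally have low: "ennreal (exp (t * (\<integral>a. snd a 0 \<partial>N))) \<le> T" using le by simp
  show pos: "0 < T" by (rule less_le_trans[OF _ low]) simp
  show T: "T < \<infinity>" using TC fin by (rule le_less_trans)
  have e: "exp (t * (\<integral>a. snd a 0 \<partial>N)) \<le> enn2real T"
    using enn2real_mono[OF low] T by simp
  have T0: "0 < enn2real T" using pos T by (simp add: enn2real_positive_iff)
  have eC: "enn2real T \<le> enn2real ?C" using TC fin by (simp add: enn2real_mono)
  show up: "ln (enn2real T) \<le> ln (enn2real ?C)" using T0 eC by simp
  have "t * (\<integral>a. snd a 0 \<partial>N) \<le> ln (enn2real T)" using e T0 by (simp add: ln_ge_iff)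
  moreover have "\<bar>t * (\<integral>a. snd a 0 \<partial>N)\<bar> \<le> \<bar>t\<bar> * enn2real (\<integral>\<^sup>+a. ennreal \<bar>snd a 0\<bar> \<partial>N)"
  proof -
    have "\<bar>\<integral>a. snd a 0 \<partial>N\<bar> \<le> (\<integral>a. \<bar>snd a 0\<bar> \<partial>N)" by (rule integral_abs_bound)
    also have "\<dots> = enn2real (\<integral>\<^sup>+a. ennreal \<bar>snd a 0\<bar> \<partial>N)"
      using snd0 by (intro integral_eq_nn_integral) auto
    finally show ?thesis by (simp add: abs_mult mult_left_mono)
  qed
  ultimately show "\<bar>ln (enn2real T)\<bar> \<le> \<bar>ln (enn2real ?C)\<bar> + \<bar>t\<bar> * enn2real (\<integral>\<^sup>+a. ennreal \<bar>snd a 0\<bar> \<partial>N)"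
    using up by linarith
qed

lemma truncated_mean_tendsto:
  assumes sets: "sets N = sets offspring_space"
    and fin: "(\<integral>\<^sup>+a. ennreal (child_sum t a) \<partial>N) < \<infinity>"
  shows "(\<lambda>K. enn2real (\<integral>\<^sup>+a. ennreal (offspring_sum K t a) \<partial>N))
    \<longlonglongrightarrow> enn2real (\<integral>\<^sup>+a. ennreal (child_sum t a) \<partial>N)"
proof -
  note meas = measurable_cong_sets[OF sets refl]
  have m: "child_sum t \<in> borel_measurable N" "offspring_sum K t \<in> borel_measurable N" for K
    unfolding meas by measurable
  have int: "integrable N (child_sum t)"
    by (rule integrableI_nonneg[OF m(1) AE_I2[OF child_sum_nonneg] fin])
  have "(\<lambda>K. \<integral>a. offspring_sum K t a \<partial>N) \<longlonglongrightarrow> (\<integral>a. child_sum t a \<partial>N)"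
    by (rule integral_dominated_convergence[OF m(1) m(2) int])
      (simp_all add: offspring_sum_tendsto offspring_sum_le)
  then show ?thesis by (simp only: integral_eq_nn_integral[OF m(1)] integral_eq_nn_integral[OF m(2)]
      AE_I2 child_sum_nonneg offspring_sum_nonneg)
qed

lemma child_mean_finite:
  assumes "\<And>n. (\<integral>\<^sup>+a. ennreal (child_sum (real_of_int n) a) \<partial>N) < \<infinity>"
    and sets: "sets N = sets offspring_space"
  shows "(\<integral>\<^sup>+a. ennreal (child_sum t a) \<partial>N) < \<infinity>"
proof -
  have m: "child_sum t \<in> borel_measurable N" for t
    unfolding measurable_cong_sets[OF sets refl] by measurable
  define n where "n = \<lceil>\<bar>t\<bar>\<rceil>"
  have "(\<integral>\<^sup>+a. ennreal (child_sum t a) \<partial>N) \<le> (\<integral>\<^sup>+a. ennreal (child_sum (real_of_int n) a) + ennreal (child_sum (real_of_int (- n)) a) \<partial>N)"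
    using child_sum_bound[of t "real_of_int n"]
    by (intro nn_integral_mono) (simp add: n_def ennreal_leI flip: ennreal_plus)
  also have "\<dots> = (\<integral>\<^sup>+a. ennreal (child_sum (real_of_int n) a) \<partial>N) + (\<integral>\<^sup>+a. ennreal (child_sum (real_of_int (- n)) a) \<partial>N)"
    by (intro nn_integral_add measurable_compose[OF m measurable_ennreal])
  also have "\<dots> < \<infinity>" using assms(1)[of n] assms(1)[of "- n"] by (simp add: less_top)
  finally show ?thesis .
qed

lemma child_mean_positive:
  assumes "prob_space N" "sets N = sets offspring_space" "AE a in N. 1 \<le> fst a"
  shows "0 < (\<integral>\<^sup>+a. ennreal (child_sum t a) \<partial>N)"
proof (rule ccontr)
  interpret prob_space N by fact
  have m: "child_sum t \<in> borel_measurable N"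
    unfolding measurable_cong_sets[OF assms(2) refl] by measurable
  assume "\<not> ?thesis"
  then have "(\<integral>\<^sup>+a. ennreal (child_sum t a) \<partial>N) = 0" by (simp only: zero_less_iff_neq_zero not_not)
  then have "AE a in N. ennreal (child_sum t a) = 0"
    by (rule nn_integral_0_iff_AE[OF measurable_compose[OF m measurable_ennreal], THEN iffD1])
  with assms(3) have "AE a in N. False"
  proof eventually_elim
    case (elim a)
    have "0 < child_sum t a" unfolding child_sum_def using elim(1) by (intro sum_pos) (auto simp: lessThan_empty_iff)
    then show ?case using elim(2) by (simp add: ennreal_eq_0_iff)
  qed
  then show False by (simp add: AE_False)
qed

section \<open>The environment and the annealed law\<close>

context brw_random_environment
begin

definition env_space :: "(nat \<Rightarrow> 'e) measure" where
  "env_space = (\<Pi>\<^sub>M n\<in>UNIV. \<Theta>)"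

definition env :: "'w \<Rightarrow> nat \<Rightarrow> 'e" where
  "env \<omega> = (\<lambda>n. \<xi> n \<omega>)"

definition tree :: "'w \<Rightarrow> nat list \<Rightarrow> nat \<times> (nat \<Rightarrow> real)" where
  "tree \<omega> = (\<lambda>u. X u \<omega>)"

text \<open>The sequence space carries the shift as an actual map, which \<open>M\<close> need not
  do; ergodic theory is therefore applied to this law.\<close>

definition env_law :: "(nat \<Rightarrow> 'e) measure" where
  "env_law = distr M env_space env"

definition shift :: "(nat \<Rightarrow> 'e) \<Rightarrow> nat \<Rightarrow> 'e" where
  "shift e = (\<lambda>n. e (Suc n))"

lemma space_env_space: "e \<in> space env_space \<longleftrightarrow> (\<forall>n. e n \<in> space \<Theta>)"
  by (auto simp: env_space_def space_PiM PiE_iff)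

lemma env_measurable: "env \<in> M \<rightarrow>\<^sub>M env_space"
  unfolding env_space_def env_def
  by (rule measurable_PiM_single'[OF measurable_\<xi>]) (simp add: Pi_iff PiE_iff measurable_space[OF measurable_\<xi>])

lemma tree_measurable: "tree \<in> M \<rightarrow>\<^sub>M tree_space"
  unfolding tree_def
  by (rule measurable_PiM_single'[OF measurable_X]) (simp add: Pi_iff PiE_iff measurable_space[OF measurable_X])

lemma coordinate_measurable: "(\<lambda>e. e n) \<in> env_space \<rightarrow>\<^sub>M \<Theta>"
  unfolding env_space_def by (rule measurable_component_singleton) (rule UNIV_I)

lemma shift_measurable: "shift \<in> env_space \<rightarrow>\<^sub>M env_space"
proof -
  have "(\<lambda>e n. e (Suc n)) \<in> env_space \<rightarrow>\<^sub>M (\<Pi>\<^sub>M n\<in>UNIV. \<Theta>)"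
    by (rule measurable_PiM_single'[OF coordinate_measurable]) (simp add: Pi_iff PiE_iff space_env_space)
  then show ?thesis unfolding shift_def[abs_def] env_space_def[symmetric] .
qed

lemma funpow_shift: "(shift ^^ k) e = (\<lambda>n. e (n + k))"
  by (induction k arbitrary: e) (auto simp: shift_def)

lemma prob_space_env_law: "prob_space env_law"
  unfolding env_law_def by (rule prob_space_distr[OF env_measurable])

lemma sets_env_law: "sets env_law = sets env_space"
  by (simp add: env_law_def)

lemma space_env_law: "space env_law = space env_space"
  by (simp add: env_law_def)

lemma ergodic_env_law: "ergodic_system env_law shift"
proof (rule ergodic_system.intro[OF prob_space_env_law], rule ergodic_system_axioms.intro)
  show "shift \<in> env_law \<rightarrow>\<^sub>M env_law"
    unfolding measurable_cong_sets[OF sets_env_law sets_env_law] by (rule shift_measurable)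
  have "distr env_law env_law shift = distr (distr M env_space env) env_space shift"
    by (rule distr_cong) (simp_all add: env_law_def)
  also have "\<dots> = distr M env_space (shift \<circ> env)"
    by (rule distr_distr[OF shift_measurable env_measurable])
  also have "\<dots> = distr M (\<Pi>\<^sub>M n\<in>UNIV. \<Theta>) (\<lambda>\<omega> n. \<xi> (1 + n) \<omega>)"
    by (rule distr_cong) (auto simp: env_space_def shift_def env_def)
  also have "\<dots> = env_law"
    using stationary unfolding stationary_def env_law_def env_space_def env_def by blast
  finally show "distr env_law env_law shift = env_law" .
next
  fix A assume A: "A \<in> sets env_law" and inv: "shift -` A \<inter> space env_law = A"
  have "measure env_law A = measure M (env -` A \<inter> space M)"
    unfolding env_law_def using A by (intro measure_distr env_measurable) (simp add: sets_env_law)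
  also have "env -` A \<inter> space M = {\<omega> \<in> space M. (\<lambda>n. \<xi> n \<omega>) \<in> A}" by (auto simp: env_def)
  also have "measure M \<dots> \<in> {0, 1}"
    using ergodic A inv unfolding ergodic_def
    by (simp add: sets_env_law space_env_law env_space_def shift_def[abs_def])
  finally show "measure env_law A \<in> {0, 1}" .
qed

sublocale E: ergodic_system env_law shift
  by (rule ergodic_env_law)

lemma
  assumes "e \<in> space \<Theta>"
  shows prob_space_\<eta>: "prob_space (\<eta> e)" and sets_\<eta>: "sets (\<eta> e) = sets offspring_space"
  using measurable_space[OF measurable_\<eta> assms] by (auto simp: space_prob_algebra)

lemma environment:
  assumes "e \<in> space env_space"
  shows "environment (\<lambda>n. \<eta> (e n))"
  using assms by (intro environment.intro prob_space_\<eta> sets_\<eta>) (auto simp: space_env_space)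

lemma AE_env: "AE e in env_law. e \<in> space env_space"
  using AE_space[of env_law] by (simp add: space_env_law)

lemma AE_env_law_iff:
  assumes "Measurable.pred env_space P"
  shows "(AE e in env_law. P e) \<longleftrightarrow> (AE \<omega> in M. P (env \<omega>))"
  unfolding env_law_def using assms by (intro AE_distr_iff env_measurable) (simp add: pred_def)

text \<open>Cylinders form a generator stable under intersection, and on a cylinder the product law
  is a finite product of measurable functions of the environment.\<close>

lemma quenched_measurable: "quenched_law \<eta> \<in> env_space \<rightarrow>\<^sub>M prob_algebra tree_space"
proof (rule measurable_prob_algebra_generated[OF sets_PiM Int_stable_prod_algebra prod_algebra_sets_into_space])
  fix e assume e: "e \<in> space env_space"
  show "prob_space (quenched_law \<eta> e)" "sets (quenched_law \<eta> e) = sets tree_space"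
    using environment.prob_space_Q[OF environment[OF e]] environment.sets_Q[OF environment[OF e]]
    by (simp_all add: quenched_law_def)
next
  fix A assume "A \<in> prod_algebra (UNIV :: nat list set) (\<lambda>_. offspring_space)"
  then obtain J F where A: "A = prod_emb UNIV (\<lambda>_. offspring_space) J (\<Pi>\<^sub>E j\<in>J. F j)"
    and J: "finite J" "\<And>j. j \<in> J \<Longrightarrow> F j \<in> sets offspring_space"
    by (rule prod_algebraE) blast
  have eq: "emeasure (quenched_law \<eta> e) A = (\<Prod>j\<in>J. emeasure (\<eta> (e (length j))) (F j))"
    if e: "e \<in> space env_space" for e
  proof -
    interpret environment "\<lambda>n. \<eta> (e n)" by (rule environment[OF e])
    have "space (\<eta> (e n)) = space offspring_space" for n by (rule sets_eq_imp_space_eq[OF sets_\<nu>])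
    then have "A = prod_emb UNIV (\<lambda>u :: nat list. \<eta> (e (length u))) J (\<Pi>\<^sub>E j\<in>J. F j)"
      by (simp add: A prod_emb_def)
    then show ?thesis unfolding quenched_law_def
      using J by (simp add: emeasure_PiM_emb sets_\<nu>)
  qed
  have "(\<lambda>e. emeasure (\<eta> (e (length j))) (F j)) \<in> borel_measurable env_space" if "j \<in> J" for j
    by (rule measurable_compose[OF measurable_compose[OF coordinate_measurable measurable_prob_algebraD[OF measurable_\<eta>]]
          measurable_emeasure_subprob_algebra[OF J(2)[OF that]]])
  then have "(\<lambda>e. \<Prod>j\<in>J. emeasure (\<eta> (e (length j))) (F j)) \<in> borel_measurable env_space"
    by (rule borel_measurable_prod_ennreal)
  then show "(\<lambda>e. emeasure (quenched_law \<eta> e) A) \<in> borel_measurable env_space"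
    by (rule measurable_cong[THEN iffD1, rotated]) (simp add: eq)
qed

lemma quenched_measurable_law: "quenched_law \<eta> \<in> env_law \<rightarrow>\<^sub>M subprob_algebra tree_space"
  unfolding measurable_cong_sets[OF sets_env_law refl]
  by (rule measurable_prob_algebraD[OF quenched_measurable])

text \<open>The joint law with no constraint on the environment: the tree is distributed as the
  mixture of the quenched laws.\<close>

lemma distr_tree: "distr M tree_space tree = env_law \<bind> quenched_law \<eta>"
proof (rule measure_eqI)
  have ne: "space env_law \<noteq> {}" by (rule prob_space.not_empty[OF prob_space_env_law])
  have sets: "sets (env_law \<bind> quenched_law \<eta>) = sets tree_space"
    by (rule sets_bind[OF _ ne]) (rule sets_kernel[OF quenched_measurable_law])
  then show "sets (distr M tree_space tree) = sets (env_law \<bind> quenched_law \<eta>)" by simp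
  fix B assume "B \<in> sets (distr M tree_space tree)"
  then have B: "B \<in> sets tree_space" by simp
  have "emeasure (distr M tree_space tree) B = emeasure M (tree -` B \<inter> space M)"
    by (rule emeasure_distr[OF tree_measurable B])
  also have "tree -` B \<inter> space M = {\<omega> \<in> space M. (\<lambda>n. \<xi> n \<omega>) \<in> space (\<Pi>\<^sub>M n\<in>UNIV. \<Theta>) \<and> (\<lambda>u. X u \<omega>) \<in> B}"
    using measurable_space[OF env_measurable] by (auto simp: tree_def env_def env_space_def)
  also have "emeasure M \<dots> = (\<integral>\<^sup>+\<omega>. indicator (space (\<Pi>\<^sub>M n\<in>UNIV. \<Theta>)) (\<lambda>n. \<xi> n \<omega>)
      * emeasure (quenched_law \<eta> (\<lambda>n. \<xi> n \<omega>)) B \<partial>M)"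
    using annealed B unfolding annealed_def by blast
  also have "\<dots> = (\<integral>\<^sup>+\<omega>. emeasure (quenched_law \<eta> (env \<omega>)) B \<partial>M)"
    using measurable_space[OF env_measurable]
    by (intro nn_integral_cong) (simp add: env_def env_space_def)
  also have "\<dots> = (\<integral>\<^sup>+e. emeasure (quenched_law \<eta> e) B \<partial>env_law)"
    unfolding env_law_def
    by (rule nn_integral_distr[OF env_measurable, symmetric], unfold measurable_distr_eq1)
      (rule measurable_compose[OF measurable_prob_algebraD[OF quenched_measurable] measurable_emeasure_subprob_algebra[OF B]])
  also have "\<dots> = emeasure (env_law \<bind> quenched_law \<eta>) B"
    by (rule emeasure_bind[OF ne quenched_measurable_law B, symmetric])
  finally show "emeasure (distr M tree_space tree) B = emeasure (env_law \<bind> quenched_law \<eta>) B" .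
qed

text \<open>The bridge between annealed and quenched statements. It suffices for events of the tree
  alone, such as growth at a deterministic rate.\<close>

lemma AE_tree_iff:
  assumes "Measurable.pred tree_space P"
  shows "(AE \<omega> in M. P (tree \<omega>)) \<longleftrightarrow> (AE e in env_law. AE x in quenched_law \<eta> e. P x)"
proof -
  have "(AE \<omega> in M. P (tree \<omega>)) \<longleftrightarrow> (AE x in distr M tree_space tree. P x)"
    using assms by (intro AE_distr_iff[symmetric] tree_measurable) (simp add: pred_def)
  then show ?thesis
    unfolding distr_tree using AE_bind[OF quenched_measurable_law assms] by simp
qed

lemma nn_integral_tree:
  assumes "f \<in> borel_measurable tree_space"
  shows "(\<integral>\<^sup>+\<omega>. f (tree \<omega>) \<partial>M) = (\<integral>\<^sup>+e. \<integral>\<^sup>+x. f x \<partial>quenched_law \<eta> e \<partial>env_law)"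
  using nn_integral_bind[OF assms quenched_measurable_law]
    nn_integral_distr[OF tree_measurable, of f, unfolded measurable_distr_eq1, OF assms]
  by (simp add: distr_tree)

lemma nn_integral_quenched_root:
  assumes "e \<in> space env_space" "f \<in> borel_measurable offspring_space"
  shows "(\<integral>\<^sup>+x. f (x []) \<partial>quenched_law \<eta> e) = (\<integral>\<^sup>+a. f a \<partial>\<eta> (e 0))"
  using environment.nn_integral_component[OF environment[OF assms(1)] assms(2), of "[]"]
  by (simp add: quenched_law_def)

lemma nn_integral_\<eta>_measurable:
  assumes "f \<in> borel_measurable offspring_space"
  shows "(\<lambda>e. \<integral>\<^sup>+a. f a \<partial>\<eta> (e 0)) \<in> borel_measurable env_space"
  by (rule measurable_compose[OF measurable_compose[OF coordinate_measurable measurable_prob_algebraD[OF measurable_\<eta>]]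
        nn_integral_measurable_subprob_algebra[OF assms]])

text \<open>Written as a function of the whole sequence although only \<open>e 0\<close> enters:
  composing with iterates of the shift then yields the means of all generations, and logarithms of
  products become Birkhoff sums.\<close>

definition mean :: "real \<Rightarrow> (nat \<Rightarrow> 'e) \<Rightarrow> ennreal" where
  "mean t e = (\<integral>\<^sup>+a. ennreal (child_sum t a) \<partial>\<eta> (e 0))"

definition trunc_mean :: "nat \<Rightarrow> real \<Rightarrow> (nat \<Rightarrow> 'e) \<Rightarrow> ennreal" where
  "trunc_mean K t e = (\<integral>\<^sup>+a. ennreal (offspring_sum K t a) \<partial>\<eta> (e 0))"

definition abs_displacement :: "(nat \<Rightarrow> 'e) \<Rightarrow> ennreal" where
  "abs_displacement e = (\<integral>\<^sup>+a. ennreal \<bar>snd a 0\<bar> \<partial>\<eta> (e 0))"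

lemma snd_measurable: "(\<lambda>a. snd a 0) \<in> borel_measurable offspring_space"
  unfolding offspring_space_def by measurable

lemma mean_measurable: "mean t \<in> borel_measurable env_space"
  unfolding mean_def[abs_def]
  by (rule nn_integral_\<eta>_measurable[OF measurable_compose[OF child_sum_measurable measurable_ennreal]])

lemma trunc_mean_measurable: "trunc_mean K t \<in> borel_measurable env_space"
  unfolding trunc_mean_def[abs_def]
  by (rule nn_integral_\<eta>_measurable[OF measurable_compose[OF offspring_sum_measurable measurable_ennreal]])

lemma abs_displacement_measurable: "abs_displacement \<in> borel_measurable env_space"
  unfolding abs_displacement_def[abs_def]
  by (rule nn_integral_\<eta>_measurable) (intro measurable_compose[OF _ measurable_ennreal] borel_measurable_abs snd_measurable)

lemma laplace_offspring_eq:
  assumes "e \<in> space env_space"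
  shows "laplace_offspring \<eta> e t = mean t e"
  unfolding laplace_offspring_def mean_def child_sum_def[symmetric]
  by (rule nn_integral_quenched_root[OF assms measurable_compose[OF child_sum_measurable measurable_ennreal]])

lemma mean_offspring_eq:
  assumes "e \<in> space env_space"
  shows "mean_offspring \<eta> e = mean 0 e"
proof -
  have "mean_offspring \<eta> e = laplace_offspring \<eta> e 0"
    unfolding mean_offspring_def laplace_offspring_def by (simp add: ennreal_of_nat_eq_real_of_nat)
  then show ?thesis by (simp add: laplace_offspring_eq[OF assms])
qed

end

text \<open>Descends from the tree to the law of the root vector; this direction needs a measurable
  predicate.\<close>

lemma (in environment) AE_component_0:
  assumes P: "Measurable.pred offspring_space P" and AE: "AE x in Q. P (x [])"
  shows "AE a in \<nu> 0. P a"
proof -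
  have "distr Q (\<nu> (length ([] :: nat list))) (\<lambda>x. x []) = \<nu> (length ([] :: nat list))"
    by (rule PiM_component) (rule UNIV_I)
  then have d: "distr Q (\<nu> 0) (\<lambda>x. x []) = \<nu> 0" by simp
  have m: "(\<lambda>x. x []) \<in> Q \<rightarrow>\<^sub>M \<nu> 0"
    unfolding measurable_cong_sets[OF refl sets_\<nu>] by (rule component_measurable)
  have "{a \<in> space (\<nu> 0). P a} \<in> sets (\<nu> 0)"
    using P unfolding sets_eq_imp_space_eq[OF sets_\<nu>] sets_\<nu> by (simp add: pred_def)
  from AE_distr_iff[OF m this] AE show ?thesis by (simp only: d)
qed

section \<open>Ergodic averages of log-means and the upper bound\<close>

locale brw_growth = brw_random_environment M \<Theta> \<eta> \<xi> X
  for M :: "'w measure" and \<Theta> :: "'e measure" and \<eta> \<xi> X +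
  assumes supercritical: "(\<integral>\<omega>. ln (enn2real (mean_offspring \<eta> (\<lambda>n. \<xi> n \<omega>))) \<partial>M) > 0"
    and nonempty: "AE \<omega> in M. fst (X [] \<omega>) \<ge> 1"
    and displacement_integrable: "integrable M (\<lambda>\<omega>. snd (X [] \<omega>) 0)"
    and laplace_log_integrable: "\<And>t. log_integrable M (\<lambda>\<omega>. laplace_offspring \<eta> (\<lambda>n. \<xi> n \<omega>) t)"
begin

definition ln_mean :: "real \<Rightarrow> (nat \<Rightarrow> 'e) \<Rightarrow> real" where
  "ln_mean t e = ln (enn2real (mean t e))"

definition ln_trunc_mean :: "nat \<Rightarrow> real \<Rightarrow> (nat \<Rightarrow> 'e) \<Rightarrow> real" where
  "ln_trunc_mean K t e = ln (enn2real (trunc_mean K t e))"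

abbreviation "L \<equiv> \<Lambda> M \<eta> \<xi>"

lemma env_in_space: "\<omega> \<in> space M \<Longrightarrow> env \<omega> \<in> space env_space"
  by (rule measurable_space[OF env_measurable])

lemma ln_mean_measurable: "ln_mean t \<in> borel_measurable env_space"
  unfolding ln_mean_def[abs_def]
  by (intro measurable_compose[OF mean_measurable] measurable_compose[OF borel_measurable_enn2real borel_measurable_ln]) simp_all

lemma ln_trunc_mean_measurable: "ln_trunc_mean K t \<in> borel_measurable env_space"
  unfolding ln_trunc_mean_def[abs_def]
  by (intro measurable_compose[OF trunc_mean_measurable] measurable_compose[OF borel_measurable_enn2real borel_measurable_ln]) simp_all

lemma AE_mean: "AE e in env_law. 0 < mean t e \<and> mean t e < \<infinity>"
proof -
  have p: "Measurable.pred env_space (\<lambda>e. 0 < mean t e \<and> mean t e < \<infinity>)"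
    using mean_measurable[of t] by measurable
  have "AE \<omega> in M. 0 < laplace_offspring \<eta> (env \<omega>) t \<and> laplace_offspring \<eta> (env \<omega>) t < \<infinity>"
    using laplace_log_integrable[of t] by (simp add: log_integrable_def env_def)
  then have "AE \<omega> in M. 0 < mean t (env \<omega>) \<and> mean t (env \<omega>) < \<infinity>"
    using AE_space by eventually_elim (simp only: laplace_offspring_eq[OF env_in_space])
  then show ?thesis unfolding AE_env_law_iff[OF p] .
qed

lemma
  shows integrable_ln_mean: "integrable env_law (ln_mean t)"
    and integral_ln_mean: "(\<integral>e. ln_mean t e \<partial>env_law) = L t"
proof -
  have eq: "ln_mean t (env \<omega>) = ln (enn2real (laplace_offspring \<eta> (\<lambda>n. \<xi> n \<omega>) t))" if "\<omega> \<in> space M" for \<omega>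
    using laplace_offspring_eq[OF env_in_space[OF that]] by (simp add: ln_mean_def env_def)
  have "integrable M (\<lambda>\<omega>. ln (enn2real (laplace_offspring \<eta> (\<lambda>n. \<xi> n \<omega>) t)))"
    using laplace_log_integrable[of t] by (simp add: log_integrable_def)
  then have "integrable M (\<lambda>\<omega>. ln_mean t (env \<omega>))"
    by (simp cong: Bochner_Integration.integrable_cong add: eq)
  then show "integrable env_law (ln_mean t)"
    unfolding env_law_def by (rule integrable_distr_eq[OF env_measurable ln_mean_measurable, THEN iffD2])
  show "(\<integral>e. ln_mean t e \<partial>env_law) = L t"
    unfolding env_law_def integral_distr[OF env_measurable ln_mean_measurable] \<Lambda>_def
    by (rule Bochner_Integration.integral_cong[OF refl eq])
qed

lemma L0_positive: "0 < L 0"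
proof -
  have "L 0 = (\<integral>\<omega>. ln (enn2real (mean_offspring \<eta> (\<lambda>n. \<xi> n \<omega>))) \<partial>M)"
    unfolding \<Lambda>_def
    using mean_offspring_eq[OF env_in_space] laplace_offspring_eq[OF env_in_space]
    by (intro Bochner_Integration.integral_cong) (auto simp: env_def)
  then show ?thesis using supercritical by simp
qed

lemma pred_fst: "Measurable.pred offspring_space (\<lambda>a. 1 \<le> fst a)"
  unfolding offspring_space_def by measurable

lemma root_measurable: "(\<lambda>x. x []) \<in> tree_space \<rightarrow>\<^sub>M offspring_space"
  by (rule measurable_component_singleton) (rule UNIV_I)

lemma AE_nonempty: "AE e in env_law. AE a in \<eta> (e 0). 1 \<le> fst a"
proof -
  have "AE \<omega> in M. 1 \<le> fst (tree \<omega> [])" using nonempty by (simp add: tree_def)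
  then have "AE e in env_law. AE x in quenched_law \<eta> e. 1 \<le> fst (x [])"
    by (rule AE_tree_iff[OF measurable_compose[OF root_measurable pred_fst], THEN iffD1])
  then show ?thesis using AE_env
  proof eventually_elim
    case (elim e)
    show ?case
      by (rule environment.AE_component_0[OF environment[OF elim(2)] pred_fst])
        (rule elim(1)[unfolded quenched_law_def])
  qed
qed

lemma
  shows AE_abs_displacement: "AE e in env_law. abs_displacement e < \<infinity>"
    and integrable_abs_displacement: "integrable env_law (\<lambda>e. enn2real (abs_displacement e))"
proof -
  have m: "abs_displacement \<in> borel_measurable env_law"
    unfolding measurable_cong_sets[OF sets_env_law refl] by (rule abs_displacement_measurable)
  have d: "(\<lambda>a. ennreal \<bar>snd a 0\<bar>) \<in> borel_measurable offspring_space"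
    by (intro measurable_compose[OF _ measurable_ennreal] borel_measurable_abs snd_measurable)
  have "(\<integral>\<^sup>+e. abs_displacement e \<partial>env_law) = (\<integral>\<^sup>+e. \<integral>\<^sup>+x. ennreal \<bar>snd (x []) 0\<bar> \<partial>quenched_law \<eta> e \<partial>env_law)"
    unfolding abs_displacement_def
    by (intro nn_integral_cong) (simp add: nn_integral_quenched_root[OF _ d] space_env_law)
  also have "\<dots> = (\<integral>\<^sup>+\<omega>. ennreal \<bar>snd (tree \<omega> []) 0\<bar> \<partial>M)"
    by (rule nn_integral_tree[symmetric, OF measurable_compose[OF root_measurable d]])
  also have "\<dots> < \<infinity>"
    using displacement_integrable unfolding integrable_iff_bounded by (simp add: tree_def)
  finally have fin: "(\<integral>\<^sup>+e. abs_displacement e \<partial>env_law) < \<infinity>" .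
  then have "AE e in env_law. abs_displacement e \<noteq> \<infinity>"
    by (intro nn_integral_PInf_AE m) (simp add: less_top)
  then show AE: "AE e in env_law. abs_displacement e < \<infinity>" by eventually_elim (simp add: less_top)
  show "integrable env_law (\<lambda>e. enn2real (abs_displacement e))"
  proof (rule integrableI_nonneg)
    show "(\<lambda>e. enn2real (abs_displacement e)) \<in> borel_measurable env_law"
      by (intro borel_measurable_enn2real m)
    have "(\<integral>\<^sup>+e. ennreal (enn2real (abs_displacement e)) \<partial>env_law) \<le> (\<integral>\<^sup>+e. abs_displacement e \<partial>env_law)"
      by (intro nn_integral_mono) (simp add: ennreal_enn2real_if)
    then show "(\<integral>\<^sup>+e. ennreal (enn2real (abs_displacement e)) \<partial>env_law) < \<infinity>"
      using fin by (rule le_less_trans)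
  qed simp
qed

text \<open>Collects the conditions on the current generation at one parameter. Imposed along the
  orbit of the shift, they hold for all generations outside a single null set.\<close>

definition regular :: "real \<Rightarrow> (nat \<Rightarrow> 'e) \<Rightarrow> bool" where
  "regular t e \<longleftrightarrow> e \<in> space env_space \<and> (AE a in \<eta> (e 0). 1 \<le> fst a) \<and> abs_displacement e < \<infinity> \<and>
     0 < mean t e \<and> mean t e < \<infinity>"

lemma AE_regular: "AE e in env_law. \<forall>k. regular t ((shift ^^ k) e)"
  by (rule E.AE_all_funpow)
    (use AE_env AE_nonempty AE_abs_displacement AE_mean[of t] in eventually_elim, simp add: regular_def)

lemma funpow_shift_0: "(shift ^^ k) e 0 = e k"
  by (simp add: funpow_shift)

lemma regular_environment: "regular t e \<Longrightarrow> environment (\<lambda>n. \<eta> (e n))"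
  by (rule environment) (simp add: regular_def)

lemma
  assumes "regular t e" "0 < K"
  shows trunc_mean_positive: "0 < trunc_mean K t e"
    and trunc_mean_finite: "trunc_mean K t e < \<infinity>"
    and ln_trunc_mean_le: "ln_trunc_mean K t e \<le> ln_mean t e"
    and ln_trunc_mean_bound: "\<bar>ln_trunc_mean K t e\<bar> \<le> \<bar>ln_mean t e\<bar> + \<bar>t\<bar> * enn2real (abs_displacement e)"
proof -
  have e: "e 0 \<in> space \<Theta>" using assms(1) by (simp add: regular_def space_env_space)
  have r: "AE a in \<eta> (e 0). 1 \<le> fst a" "(\<integral>\<^sup>+a. ennreal \<bar>snd a 0\<bar> \<partial>\<eta> (e 0)) < \<infinity>"
      "(\<integral>\<^sup>+a. ennreal (child_sum t a) \<partial>\<eta> (e 0)) < \<infinity>"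
    using assms(1) unfolding regular_def abs_displacement_def mean_def by blast+
  note hyp = prob_space_\<eta>[OF e] sets_\<eta>[OF e] r assms(2)
  show "0 < trunc_mean K t e" unfolding trunc_mean_def by (rule truncated_mean_positive[OF hyp])
  show "trunc_mean K t e < \<infinity>" unfolding trunc_mean_def by (rule truncated_mean_finite[OF hyp])
  show "ln_trunc_mean K t e \<le> ln_mean t e"
    unfolding ln_trunc_mean_def trunc_mean_def ln_mean_def mean_def by (rule ln_truncated_mean_le[OF hyp])
  show "\<bar>ln_trunc_mean K t e\<bar> \<le> \<bar>ln_mean t e\<bar> + \<bar>t\<bar> * enn2real (abs_displacement e)"
    unfolding ln_trunc_mean_def trunc_mean_def ln_mean_def mean_def abs_displacement_def
    by (rule ln_truncated_mean_bound[OF hyp])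
qed

lemma AE_regular_0: "AE e in env_law. regular t e"
  using AE_regular[of t] by eventually_elim (metis funpow_0)

lemma integrable_bound_ln: "integrable env_law (\<lambda>e. \<bar>ln_mean t e\<bar> + \<bar>t\<bar> * enn2real (abs_displacement e))"
  by (intro Bochner_Integration.integrable_add integrable_abs integrable_ln_mean
      integrable_mult_right integrable_abs_displacement)

lemma ln_trunc_mean_measurable_law: "ln_trunc_mean K t \<in> borel_measurable env_law"
  unfolding measurable_cong_sets[OF sets_env_law refl] by (rule ln_trunc_mean_measurable)

lemma integrable_ln_trunc_mean:
  assumes K: "0 < K"
  shows "integrable env_law (ln_trunc_mean K t)"
  by (rule Bochner_Integration.integrable_bound[OF integrable_bound_ln ln_trunc_mean_measurable_law])
    (use AE_regular_0[of t] in \<open>eventually_elim, use ln_trunc_mean_bound[OF _ K] in fastforce\<close>)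

text \<open>Dominated convergence with the bound that is uniform in the truncation. The level starts
  at \<open>Suc K\<close> because with no children kept the mean is 0, and that bound requires a
  positive level.\<close>

lemma integral_ln_trunc_mean_tendsto:
  "(\<lambda>K. \<integral>e. ln_trunc_mean (Suc K) t e \<partial>env_law) \<longlonglongrightarrow> L t"
  unfolding integral_ln_mean[symmetric]
proof (rule integral_dominated_convergence[OF _ _ integrable_bound_ln[of t]])
  show "ln_mean t \<in> borel_measurable env_law"
    unfolding measurable_cong_sets[OF sets_env_law refl] by (rule ln_mean_measurable)
  show "AE e in env_law. (\<lambda>K. ln_trunc_mean (Suc K) t e) \<longlonglongrightarrow> ln_mean t e"
    using AE_regular_0[of t]
  proof eventually_elim
    case (elim e)
    then have e: "e 0 \<in> space \<Theta>" and fin: "mean t e < \<infinity>" "0 < mean t e"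
      by (auto simp: regular_def space_env_space)
    have "(\<lambda>K. enn2real (trunc_mean K t e)) \<longlonglongrightarrow> enn2real (mean t e)"
      using truncated_mean_tendsto[OF sets_\<eta>[OF e]] fin(1) unfolding trunc_mean_def mean_def by blast
    then show ?case unfolding ln_trunc_mean_def ln_mean_def
      by (intro tendsto_ln LIMSEQ_Suc) (use fin in \<open>auto simp: enn2real_eq_0_iff\<close>)
  qed
  show "AE e in env_law. norm (ln_trunc_mean (Suc K) t e) \<le> \<bar>ln_mean t e\<bar> + \<bar>t\<bar> * enn2real (abs_displacement e)" for K
    using AE_regular_0[of t] by eventually_elim (use ln_trunc_mean_bound in simp)
qed (rule ln_trunc_mean_measurable_law)

lemma ennreal_mean_funpow:
  assumes "regular t ((shift ^^ k) e)"
  shows "(\<integral>\<^sup>+a. ennreal (child_sum t a) \<partial>\<eta> (e k)) = ennreal (enn2real (mean t ((shift ^^ k) e)))"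
    "0 < enn2real (mean t ((shift ^^ k) e))"
  using assms by (auto simp: mean_def funpow_shift_0 regular_def enn2real_positive_iff)

lemma AE_upper_bound:
  assumes c: "L t < c"
  shows "AE \<omega> in M. \<forall>\<^sub>F n in sequentially. partition_function (tree \<omega>) n t < exp (c * n)"
proof (rule AE_tree_iff[THEN iffD2])
  show "Measurable.pred tree_space (\<lambda>x. \<forall>\<^sub>F n in sequentially. partition_function x n t < exp (c * n))"
    unfolding eventually_sequentially by measurable
  show "AE e in env_law. AE x in quenched_law \<eta> e. \<forall>\<^sub>F n in sequentially. partition_function x n t < exp (c * n)"
    using AE_regular[of t] E.birkhoff[OF integrable_ln_mean[of t]]
  proof eventually_elim
    case (elim e)
    have "environment (\<lambda>n. \<eta> (e n))" using regular_environment[of t e] elim(1)[rule_format, of 0] by simp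
    then interpret environment "\<lambda>n. \<eta> (e n)" .
    show ?case unfolding quenched_law_def
    proof (rule AE_upper[where \<alpha>="L t"])
      show "(\<integral>\<^sup>+a. ennreal (\<Sum>i<fst a. exp (t * snd a i)) \<partial>\<eta> (e k)) = ennreal (enn2real (mean t ((shift ^^ k) e)))" for k
        using ennreal_mean_funpow(1)[OF elim(1)[rule_format]] by (simp only: child_sum_def)
      show "0 < enn2real (mean t ((shift ^^ k) e))" for k
        by (rule ennreal_mean_funpow(2)[OF elim(1)[rule_format]])
      show "(\<lambda>n. (\<Sum>k<n. ln (enn2real (mean t ((shift ^^ k) e)))) / n) \<longlonglongrightarrow> L t"
        using elim(2) by (simp only: ln_mean_def integral_ln_mean[unfolded ln_mean_def])
    qed (rule c)
  qed
qed

end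

section \<open>Zero-one law and convergence\<close>

context brw_growth
begin

lemma AE_not_AE_not_growing:
  assumes p: "1 < p" "p \<le> 2" and less: "L (p * t) < p * L t" and c: "c < L t"
  shows "AE e in env_law. \<not> (AE x in quenched_law \<eta> e. \<not> growing t c x)"
proof -
  define \<alpha> where "\<alpha> K = (\<integral>e. ln_trunc_mean (Suc K) t e \<partial>env_law)" for K
  have \<alpha>: "\<alpha> \<longlonglongrightarrow> L t" unfolding \<alpha>_def by (rule integral_ln_trunc_mean_tendsto)
  have "\<forall>\<^sub>F K in sequentially. max c (L (p * t) / p) < \<alpha> K"
    by (rule order_tendstoD(1)[OF \<alpha>]) (use p less c in \<open>simp add: pos_divide_less_eq mult.commute\<close>)
  \<comment> \<open>One truncation level has to serve both ends: its rate must exceed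
    \<open>c\<close> and also stay above \<open>L (p * t) / p\<close>. Truncation only lowers the
    rate at \<open>p * t\<close>, so strictness is preserved there.\<close>
  then obtain K0 where "max c (L (p * t) / p) < \<alpha> K0" by (auto simp: eventually_sequentially)
  then have K0: "c < \<alpha> K0" "L (p * t) < p * \<alpha> K0" using p by (auto simp: pos_divide_less_eq mult.commute)
  define K where "K = Suc K0"
  have K: "0 < K" by (simp add: K_def)
  define \<beta> where "\<beta> = (\<integral>e. ln_trunc_mean K (p * t) e \<partial>env_law)"
  have "\<beta> \<le> L (p * t)" unfolding \<beta>_def integral_ln_mean[symmetric]
  proof (rule integral_mono_AE[OF integrable_ln_trunc_mean[OF K] integrable_ln_mean])
    show "AE e in env_law. ln_trunc_mean K (p * t) e \<le> ln_mean (p * t) e"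
      using AE_regular_0[of "p * t"] by eventually_elim (rule ln_trunc_mean_le[OF _ K])
  qed
  then have \<beta>: "\<beta> < p * \<alpha> K0" using K0 by simp
  show ?thesis
    using AE_regular[of t] AE_regular[of "p * t"] AE_regular[of "2 * t"]
      E.birkhoff[OF integrable_ln_trunc_mean[OF K, of t]] E.birkhoff[OF integrable_ln_trunc_mean[OF K, of "p * t"]]
      E.birkhoff[OF integrable_ln_mean[of "2 * t"]]
  proof eventually_elim
    case (elim e)
    let ?e = "\<lambda>k. (shift ^^ k) e"
    define a where "a k = enn2real (trunc_mean K t (?e k))" for k
    define b where "b k = enn2real (trunc_mean K (p * t) (?e k))" for k
    define l where "l k = enn2real (mean (2 * t) (?e k))" for k
    have "environment (\<lambda>n. \<eta> (e n))" using regular_environment[of t e] elim(1)[rule_format, of 0] by simp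
    then interpret environment "\<lambda>n. \<eta> (e n)" .
    have tm: "truncated_mean K s k = trunc_mean K s (?e k)" for s k
      by (simp add: truncated_mean_def trunc_mean_def funpow_shift_0)
    have a: "truncated_mean K t k = ennreal (a k)" "0 < a k" for k
      unfolding tm a_def using trunc_mean_positive[OF elim(1)[rule_format] K, of k] trunc_mean_finite[OF elim(1)[rule_format] K, of k]
      by (simp_all add: enn2real_positive_iff)
    have b: "truncated_mean K (p * t) k = ennreal (b k)" "0 < b k" for k
      unfolding tm b_def using trunc_mean_positive[OF elim(2)[rule_format] K, of k] trunc_mean_finite[OF elim(2)[rule_format] K, of k]
      by (simp_all add: enn2real_positive_iff)
    have l: "0 < l k" for k unfolding l_def by (rule ennreal_mean_funpow(2)[OF elim(3)[rule_format]])
    have v: "(\<integral>\<^sup>+x. ennreal ((offspring_sum K t x)\<^sup>2) \<partial>\<eta> (e n)) \<le> ennreal (real K * l n)" for n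
    proof -
      have "(\<integral>\<^sup>+x. ennreal ((offspring_sum K t x)\<^sup>2) \<partial>\<eta> (e n)) \<le> (\<integral>\<^sup>+x. ennreal (real K) * ennreal (child_sum (2 * t) x) \<partial>\<eta> (e n))"
        by (intro nn_integral_mono) (simp add: ennreal_leI offspring_sum_square_le flip: ennreal_mult)
      also have "\<dots> = ennreal (real K) * (\<integral>\<^sup>+x. ennreal (child_sum (2 * t) x) \<partial>\<eta> (e n))"
        by (rule nn_integral_cmult, unfold measurable_cong_sets[OF sets_\<nu> refl])
          (rule measurable_compose[OF child_sum_measurable measurable_ennreal])
      also have "\<dots> = ennreal (real K * l n)"
        unfolding ennreal_mean_funpow(1)[OF elim(3)[rule_format]] l_def by (simp add: ennreal_mult)
      finally show ?thesis .
    qed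
    have lim_a: "(\<lambda>n. (\<Sum>k<n. ln (a k)) / n) \<longlonglongrightarrow> \<alpha> K0"
      using elim(4) by (simp add: a_def \<alpha>_def ln_trunc_mean_def K_def)
    have lim_b: "(\<lambda>n. (\<Sum>k<n. ln (b k)) / n) \<longlonglongrightarrow> \<beta>"
      using elim(5) by (simp add: b_def \<beta>_def ln_trunc_mean_def)
    have lim_l: "(\<lambda>n. (\<Sum>k<n. ln (l k)) / n) \<longlonglongrightarrow> (\<integral>e. ln_mean (2 * t) e \<partial>env_law)"
      using elim(6) by (simp only: l_def ln_mean_def)
    have lim_v: "\<forall>\<^sub>F n in sequentially. sqrt (real K * l n) / a n \<le> exp (\<epsilon> * real n)" if \<epsilon>: "0 < \<epsilon>" for \<epsilon>
    proof -
      \<comment> \<open>This is the logarithm of \<open>sqrt (K * l n) / a n\<close>, divided by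
        \<open>n\<close>; each of its three pieces is negligible.\<close>
      have "(\<lambda>n. 1 / 2 * (ln K / n + ln (l n) / n) - ln (a n) / n) \<longlonglongrightarrow> 1 / 2 * (0 + 0) - 0"
        by (intro tendsto_intros lim_const_over_n term_over_n_tendsto_0[OF lim_l] term_over_n_tendsto_0[OF lim_a])
      then have "\<forall>\<^sub>F n in sequentially. 1 / 2 * (ln K / n + ln (l n) / n) - ln (a n) / n < \<epsilon>"
        by (rule order_tendstoD) (use \<epsilon> in simp)
      then show ?thesis using eventually_gt_at_top[of 0]
      proof eventually_elim
        case (elim n)
        have "(1 / 2 * (ln K / n + ln (l n) / n) - ln (a n) / n) * n < \<epsilon> * n"
          using elim by (intro mult_strict_right_mono) auto
        moreover have "(1 / 2 * (ln K / n + ln (l n) / n) - ln (a n) / n) * n = 1 / 2 * (ln K + ln (l n)) - ln (a n)"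
          using elim(2) by (simp add: algebra_simps add_divide_distrib)
        ultimately have "1 / 2 * (ln K + ln (l n)) - ln (a n) \<le> \<epsilon> * n" by simp
        moreover have "ln (sqrt (real K * l n) / a n) = 1 / 2 * (ln K + ln (l n)) - ln (a n)"
          using K l[of n] a(2)[of n] by (simp add: ln_div ln_sqrt ln_mult)
        moreover have "0 < sqrt (real K * l n) / a n" using K l[of n] a(2)[of n] by simp
        ultimately show ?case by (metis exp_le_cancel_iff exp_ln)
      qed
    qed
    show ?case unfolding quenched_law_def
      by (rule not_AE_not_growing[OF a b v _ _ p(2) lim_a lim_b lim_v \<beta> K0(1)])
        (use l p in \<open>simp_all add: less_imp_le\<close>)
  qed
qed

lemma growing_zero_one:
  assumes "AE e in env_law. \<not> (AE x in quenched_law \<eta> e. \<not> growing t c x)"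
  shows "AE e in env_law. AE x in quenched_law \<eta> e. growing t c x"
proof -
  define B where "B = {x \<in> space tree_space. \<not> growing t c x}"
  have B: "B \<in> sets tree_space" unfolding B_def by measurable
  define q where "q e = measure (quenched_law \<eta> e) B" for e
  \<comment> \<open>\<open>h e\<close> is the weight of the quadratic term in the recursion for
    \<open>q\<close>, and thus the source of strict improvement.\<close>
  define h :: "(nat \<Rightarrow> 'e) \<Rightarrow> real" where "h e = measure (\<eta> (e 0)) {a \<in> space (\<eta> (e 0)). \<not> fst a < 2}" for e
  have ps: "prob_space (quenched_law \<eta> e)" "sets (quenched_law \<eta> e) = sets tree_space" if "e \<in> space env_space" for e
    using measurable_space[OF quenched_measurable that] by (auto simp: space_prob_algebra)
  have q01: "0 \<le> q e" "q e \<le> 1" if "e \<in> space env_space" for e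
    using prob_space.prob_le_1[OF ps(1)[OF that]] by (auto simp: q_def)
  have q_AE: "(AE x in quenched_law \<eta> e. growing t c x) \<longleftrightarrow> q e = 0"
      "(AE x in quenched_law \<eta> e. \<not> growing t c x) \<longleftrightarrow> q e = 1" if e: "e \<in> space env_space" for e
  proof -
    interpret Q: prob_space "quenched_law \<eta> e" by (rule ps[OF e])
    have sp: "space (quenched_law \<eta> e) = space tree_space" by (rule sets_eq_imp_space_eq[OF ps(2)[OF e]])
    have B': "B \<in> sets (quenched_law \<eta> e)" using B ps(2)[OF e] by simp
    have "(AE x in quenched_law \<eta> e. growing t c x) \<longleftrightarrow> (AE x in quenched_law \<eta> e. x \<notin> B)"
      by (rule AE_cong) (simp add: B_def sp)
    then show "(AE x in quenched_law \<eta> e. growing t c x) \<longleftrightarrow> q e = 0"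
      using Q.prob_eq_0[OF B'] by (simp add: q_def)
    have "(AE x in quenched_law \<eta> e. \<not> growing t c x) \<longleftrightarrow> (AE x in quenched_law \<eta> e. x \<in> B)"
      by (rule AE_cong) (simp add: B_def sp)
    then show "(AE x in quenched_law \<eta> e. \<not> growing t c x) \<longleftrightarrow> q e = 1"
      using Q.prob_eq_1[OF B'] by (simp add: q_def)
  qed
  have q_meas: "q \<in> borel_measurable env_law"
    unfolding measurable_cong_sets[OF sets_env_law refl] q_def[abs_def]
    by (rule measurable_compose[OF quenched_measurable measurable_measure_prob_algebra[OF B]])
  have int_q: "integrable env_law q"
  proof (rule E.integrable_const_bound[OF _ q_meas])
    show "AE e in env_law. norm (q e) \<le> 1" using AE_env by eventually_elim (simp add: q01)
  qed
  have step: "AE e in env_law. q e \<le> (1 - h e) * q (shift e) + h e * (q (shift e))\<^sup>2"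
    using AE_env AE_nonempty
  proof eventually_elim
    case (elim e)
    interpret environment "\<lambda>n. \<eta> (e n)" by (rule environment[OF elim(1)])
    interpret \<eta>: prob_space "\<eta> (e 0)" by (rule prob_space_\<nu>)
    have s: "shift e \<in> space env_space" using elim(1) by (simp add: shift_def space_env_space)
    interpret Q: prob_space "quenched_law \<eta> e" by (rule ps[OF elim(1)])
    interpret Q': prob_space "quenched_law \<eta> (shift e)" by (rule ps[OF s])
    have m2: "{a \<in> space (\<eta> (e 0)). \<not> fst a < 2} \<in> sets (\<eta> (e 0))"
      unfolding sets_eq_imp_space_eq[OF sets_\<nu>] sets_\<nu> unfolding offspring_space_def by measurable
    have "{a \<in> space (\<eta> (e 0)). fst a < 2} = space (\<eta> (e 0)) - {a \<in> space (\<eta> (e 0)). \<not> fst a < 2}" by auto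
    then have h': "measure (\<eta> (e 0)) {a \<in> space (\<eta> (e 0)). fst a < 2} = 1 - h e"
      unfolding h_def using \<eta>.prob_compl[OF m2] by simp
    have h1: "h e \<le> 1" "0 \<le> h e" by (simp_all add: h_def)
    have "emeasure (quenched_law \<eta> e) B
      \<le> emeasure (\<eta> (e 0)) {a \<in> space (\<eta> (e 0)). fst a < 2} * emeasure (quenched_law \<eta> (shift e)) B
        + emeasure (\<eta> (e 0)) {a \<in> space (\<eta> (e 0)). \<not> fst a < 2}
          * (emeasure (quenched_law \<eta> (shift e)) B * emeasure (quenched_law \<eta> (shift e)) B)"
      unfolding quenched_law_def shift_def B_def by (rule not_growing_le[OF elim(2)])
    then have "ennreal (q e) \<le> ennreal (1 - h e) * ennreal (q (shift e)) + ennreal (h e) * (ennreal (q (shift e)) * ennreal (q (shift e)))"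
      unfolding Q.emeasure_eq_measure Q'.emeasure_eq_measure \<eta>.emeasure_eq_measure h' q_def h_def .
    then have "ennreal (q e) \<le> ennreal ((1 - h e) * q (shift e) + h e * (q (shift e) * q (shift e)))"
      using h1 q01[OF s] by (simp add: ennreal_mult ennreal_plus)
    then show ?case
      using h1 q01[OF s] by (subst (asm) ennreal_le_iff) (auto simp: power2_eq_square)
  qed
  have mono: "AE e in env_law. q e \<le> q (shift e)"
    using step AE_env
  proof eventually_elim
    case (elim e)
    have s: "shift e \<in> space env_space" using elim(2) by (simp add: shift_def space_env_space)
    have "h e * (q (shift e))\<^sup>2 \<le> h e * q (shift e)"
      using q01[OF s] by (intro mult_left_mono) (auto simp: h_def power2_eq_square mult_left_le)
    then show ?case using elim(1) by (simp add: algebra_simps)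
  qed
  define C where "C = (\<integral>e. q e \<partial>env_law)"
  \<comment> \<open>Since \<open>q\<close> is nondecreasing along orbits, \<open>q e\<close> is
    below all its Birkhoff averages and hence below their limit \<open>C\<close>. A function that
    never exceeds its mean is almost surely equal to it.\<close>
  have "AE e in env_law. q e \<le> C"
    using E.AE_all_funpow[OF mono] E.birkhoff[OF int_q]
  proof eventually_elim
    case (elim e)
    have le: "q e \<le> q ((shift ^^ k) e)" for k
      by (induction k) (use elim(1) order_trans in auto)
    have "\<forall>\<^sub>F n in sequentially. q e \<le> (\<Sum>k<n. q ((shift ^^ k) e)) / n"
      using eventually_gt_at_top[of 0]
    proof eventually_elim
      case (elim n)
      have "(\<Sum>k<n. q e) \<le> (\<Sum>k<n. q ((shift ^^ k) e))" by (intro sum_mono le)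
      then show ?case using elim by (simp add: pos_le_divide_eq mult.commute)
    qed
    then show ?case unfolding C_def by (intro tendsto_lowerbound[OF elim(2)]) auto
  qed
  moreover have "(\<integral>e. C - q e \<partial>env_law) = 0"
    using int_q by (simp add: C_def E.prob_space)
  ultimately have "AE e in env_law. C - q e = 0"
    using int_q by (subst integral_nonneg_eq_0_iff_AE[symmetric]) auto
  then have qC: "AE e in env_law. q e = C" by eventually_elim simp
  have C01: "0 \<le> C" "C < 1"
  proof -
    have "AE e in env_law. 0 \<le> C \<and> C < 1"
      using qC assms AE_env
    proof eventually_elim
      case (elim e)
      then show ?case using q01[OF elim(3)] q_AE[OF elim(3)] by auto
    qed
    then show "0 \<le> C" "C < 1" by (simp_all add: E.AE_const)
  qed
  have "C = 0"
  proof (rule ccontr)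
    assume "C \<noteq> 0"
    then have C0: "0 < C" using C01 by simp
    have "AE e in env_law. ln_mean 0 e = 0"
      using step qC E.AE_funpow[OF qC, of 1] AE_regular_0[of 0]
    proof eventually_elim
      case (elim e)
      interpret environment "\<lambda>n. \<eta> (e n)" by (rule regular_environment[OF elim(4)])
      interpret \<eta>: prob_space "\<eta> (e 0)" by (rule prob_space_\<nu>)
      have m2: "{a \<in> space (\<eta> (e 0)). \<not> fst a < 2} \<in> sets (\<eta> (e 0))"
        unfolding sets_eq_imp_space_eq[OF sets_\<nu>] sets_\<nu> unfolding offspring_space_def by measurable
      have "C \<le> (1 - h e) * C + h e * C\<^sup>2" using elim(1-3) by simp
      then have "h e * (C * (1 - C)) \<le> 0" by (simp add: algebra_simps power2_eq_square)
      moreover have "0 \<le> h e" by (simp add: h_def)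
      moreover have "0 < C * (1 - C)" using C0 C01 by simp
      ultimately have "h e = 0" by (metis mult_le_0_iff not_le order_antisym)
      then have "AE a in \<eta> (e 0). a \<notin> {a \<in> space (\<eta> (e 0)). \<not> fst a < 2}"
        using \<eta>.prob_eq_0[OF m2] by (simp add: h_def)
      moreover have "AE a in \<eta> (e 0). 1 \<le> fst a" using elim(4) by (simp add: regular_def)
      ultimately have "AE a in \<eta> (e 0). ennreal (child_sum 0 a) = 1"
        using AE_space by eventually_elim (auto simp: child_sum_def not_less ennreal_eq_1)
      then have "mean 0 e = 1"
        unfolding mean_def by (subst nn_integral_cong_AE) (auto simp: \<eta>.emeasure_space_1)
      then show ?case by (simp add: ln_mean_def)
    qed
    then have "(\<integral>e. ln_mean 0 e \<partial>env_law) = 0"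
      by (rule integral_eq_zero_AE)
    then show False using L0_positive by (simp add: integral_ln_mean)
  qed
  with qC have "AE e in env_law. q e = 0" by simp
  then show ?thesis using AE_env by eventually_elim (simp add: q_AE)
qed

lemma AE_growing:
  assumes "1 < p" "p \<le> 2" "L (p * t) < p * L t" "c < L t"
  shows "AE \<omega> in M. growing t c (tree \<omega>)"
  by (rule AE_tree_iff[OF growing_measurable, THEN iffD2, OF growing_zero_one[OF AE_not_AE_not_growing[OF assms]]])

end

section \<open>From countably many parameters to all of them\<close>

lemma partition_function_positive:
  assumes "\<And>u. 1 \<le> num_children x u"
  shows "0 < partition_function x n t"
proof -
  have "replicate n 0 \<in> generation x n"
  proof (induction n)
    case (Suc n)
    have "replicate (Suc n) (0::nat) = replicate n 0 @ [0]" by (simp only: replicate_append_same replicate_Suc)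
    moreover have "0 < num_children x (replicate n 0)" using assms[of "replicate n 0"] by simp
    ultimately show ?case using Suc by auto
  qed simp
  then show ?thesis unfolding partition_function_def by (intro sum_pos) auto
qed

lemma convex_ln_partition_function:
  assumes "\<And>u. 1 \<le> num_children x u"
  shows "convex_on UNIV (\<lambda>t. ln (partition_function x n t) / n)"
proof -
  have "convex_on UNIV (\<lambda>t. ln (partition_function x n t))"
  proof (rule convex_on_ln[OF _ partition_function_positive[where x=x, OF assms]])
    fix c
    have "exp (t * c) * partition_function x n t = (\<Sum>u\<in>generation x n. exp (t * (c + position x u) + 0))" for t
      by (simp add: partition_function_def sum_distrib_left algebra_simps exp_add)
    moreover have "convex_on UNIV (\<lambda>t. \<Sum>u\<in>generation x n. exp (t * (c + position x u) + 0))"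
      by (intro convex_on_sum_fun convex_on_exp_linear) auto
    ultimately show "convex_on UNIV (\<lambda>t. exp (t * c) * partition_function x n t)" by (simp only:)
  qed
  then show ?thesis by (intro convex_on_cdiv) auto
qed

lemma ln_partition_function_scale:
  assumes "\<And>u. 1 \<le> num_children x u" "1 \<le> q"
  shows "ln (partition_function x n (q * t)) / n \<le> q * (ln (partition_function x n t) / n)"
proof -
  have "partition_function x n (q * t) = (\<Sum>u\<in>generation x n. exp (t * position x u) powr q)"
    by (simp add: partition_function_def exp_powr_real algebra_simps)
  also have "\<dots> \<le> partition_function x n t powr q"
    unfolding partition_function_def using assms(2) by (intro sum_powr_le_powr_sum) auto
  finally have "partition_function x n (q * t) \<le> partition_function x n t powr q" .
  moreover have "0 < partition_function x n s" for s
    by (rule partition_function_positive[where x=x, OF assms(1)])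
  ultimately have "ln (partition_function x n (q * t)) \<le> ln (partition_function x n t powr q)"
    by (intro ln_mono)
  also have "\<dots> = q * ln (partition_function x n t)"
    by (rule ln_powr)
  finally have "ln (partition_function x n (q * t)) \<le> q * ln (partition_function x n t)" .
  from divide_right_mono[OF this, of "real n"] show ?thesis by simp
qed

text \<open>The multiplier in \<open>growing\<close> contributes only \<open>ln j / n\<close>, which
  the strict inequality \<open>d < c\<close> absorbs.\<close>

lemma growing_eventually_less:
  assumes "\<And>u. 1 \<le> num_children x u" and grow: "growing t c x" and d: "d < c"
  shows "\<forall>\<^sub>F n in sequentially. d < ln (partition_function x n t) / n"
proof -
  obtain j :: nat and N where N: "\<And>n. N \<le> n \<Longrightarrow> exp (c * n) \<le> real j * partition_function x n t"
    using grow unfolding growing_def by blast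
  have "0 < real j * partition_function x N t" using less_le_trans[OF exp_gt_zero N[of N]] by simp
  then have j: "0 < real j" by (cases "j = 0") auto
  have "(\<lambda>n. c - ln j / n) \<longlonglongrightarrow> c - 0" by (intro tendsto_intros lim_const_over_n)
  then have "\<forall>\<^sub>F n in sequentially. d < c - ln j / n" by (rule order_tendstoD) (use d in simp)
  then show ?thesis using eventually_ge_at_top[of N] eventually_gt_at_top[of 0]
  proof eventually_elim
    case (elim n)
    have Z: "0 < partition_function x n t" by (rule partition_function_positive[where x=x, OF assms(1)])
    have "ln (exp (c * n)) \<le> ln (real j * partition_function x n t)"
      using N[OF elim(2)] j Z by (intro ln_mono) auto
    then have "c * n \<le> ln j + ln (partition_function x n t)" using j Z by (simp add: ln_mult)
    then have "c * n / n \<le> (ln j + ln (partition_function x n t)) / n" by (rule divide_right_mono) simp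
    then have "c - ln j / n \<le> ln (partition_function x n t) / n"
      using elim(3) by (simp add: add_divide_distrib)
    then show ?case using elim(1) by linarith
  qed
qed

context brw_growth
begin

text \<open>Covers every label, also outside the tree, so that the deterministic lemmas can use the
  condition without tracking membership in a generation.\<close>

lemma AE_num_children: "AE \<omega> in M. \<forall>u. 1 \<le> num_children (tree \<omega>) u"
proof (rule AE_tree_iff[THEN iffD2])
  have "(\<lambda>x. x u) \<in> tree_space \<rightarrow>\<^sub>M offspring_space" for u :: "nat list"
    by (rule measurable_component_singleton) (rule UNIV_I)
  from measurable_compose[OF this pred_fst]
  have "Measurable.pred tree_space (\<lambda>x. 1 \<le> fst (x u))" for u :: "nat list" .
  then show "Measurable.pred tree_space (\<lambda>x. \<forall>u :: nat list. 1 \<le> fst (x u))"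
    by (rule pred_intros_countable)
  show "AE e in env_law. AE x in quenched_law \<eta> e. \<forall>u. 1 \<le> fst (x u)"
    using AE_regular[of 0]
  proof eventually_elim
    case (elim e)
    have "environment (\<lambda>n. \<eta> (e n))" using regular_environment[of 0 e] elim[rule_format, of 0] by simp
    then interpret environment "\<lambda>n. \<eta> (e n)" .
    have "AE a in \<eta> (e n). 1 \<le> fst a" for n
      using elim[rule_format, of n] unfolding regular_def funpow_shift_0 by blast
    then show ?case unfolding quenched_law_def by (rule AE_nodes)
  qed
qed

lemma L_eq: "L = (\<lambda>t. \<integral>e. ln_mean t e \<partial>env_law)"
  by (simp add: fun_eq_iff integral_ln_mean)

text \<open>Regularity at the integers gives finite means at all real parameters, so the properties
  of the whole function of \<open>t\<close> hold outside one null set.\<close>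

lemma AE_ln_mean_convex:
  "AE e in env_law. convex_on UNIV (\<lambda>t. ln_mean t e) \<and> (\<forall>t. (\<lambda>t. ln_mean t e) differentiable (at t))"
proof -
  have "AE e in env_law. \<forall>n. regular (real_of_int n) e"
    by (simp add: AE_all_countable AE_regular_0)
  then show ?thesis
  proof eventually_elim
    case (elim e)
    then have e: "e 0 \<in> space \<Theta>" and one: "AE a in \<eta> (e 0). 1 \<le> fst a"
      and fin: "\<And>n. (\<integral>\<^sup>+a. ennreal (child_sum (real_of_int n) a) \<partial>\<eta> (e 0)) < \<infinity>"
      unfolding regular_def space_env_space mean_def by blast+
    note m = sets_\<eta>[OF e] child_mean_finite[OF fin sets_\<eta>[OF e]] child_mean_positive[OF prob_space_\<eta>[OF e] sets_\<eta>[OF e] one]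
    show ?case
      unfolding ln_mean_def mean_def
      using convex_on_ln_child_mean[OF m] differentiable_ln_child_mean[OF m] by blast
  qed
qed

sublocale L: convex_differentiable L
proof
  show "convex_on UNIV L" unfolding L_eq
    by (rule convex_on_integral[OF integrable_ln_mean]) (use AE_ln_mean_convex in eventually_elim, simp)
  show "L differentiable (at t)" for t unfolding L_eq
    by (rule differentiable_integral_convex[OF integrable_ln_mean])
      (use AE_ln_mean_convex in eventually_elim, simp)+
qed (rule L0_positive)

theorem AE_tendsto_linearized:
  "AE \<omega> in M. \<forall>t. (\<lambda>n. ln (partition_function (tree \<omega>) n t) / real n) \<longlonglongrightarrow> linearized L t"
proof -
  have up: "AE \<omega> in M. \<forall>(r::rat) (j::nat). \<forall>\<^sub>F n in sequentially.
      partition_function (tree \<omega>) n (of_rat r) < exp ((L (of_rat r) + 1 / Suc j) * n)"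
    unfolding AE_all_countable by (intro allI AE_upper_bound) simp
  \<comment> \<open>The existence of \<open>p\<close> is a deterministic condition on
    \<open>r\<close>; placing it inside as a premise avoids an uncountable quantifier over
    \<open>p\<close> under the almost sure statement.\<close>
  have low: "AE \<omega> in M. \<forall>(r::rat) (j::nat). (\<exists>p>1. p \<le> 2 \<and> L (p * of_rat r) < p * L (of_rat r)) \<longrightarrow>
      growing (of_rat r) (L (of_rat r) - 1 / Suc j) (tree \<omega>)"
    unfolding AE_all_countable
  proof (intro allI)
    fix r :: rat and j :: nat
    show "AE \<omega> in M. (\<exists>p>1. p \<le> 2 \<and> L (p * of_rat r) < p * L (of_rat r)) \<longrightarrow>
      growing (of_rat r) (L (of_rat r) - 1 / Suc j) (tree \<omega>)"
    proof (cases "\<exists>p>1. p \<le> 2 \<and> L (p * of_rat r) < p * L (of_rat r)")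
      case True
      then obtain p where "1 < p" "p \<le> 2" "L (p * of_rat r) < p * L (of_rat r)" by blast
      from AE_growing[OF this, of "L (of_rat r) - 1 / Suc j"] show ?thesis by simp
    next
      case False
      then show ?thesis by (intro AE_I2) blast
    qed
  qed
  show ?thesis using up low AE_num_children
  proof eventually_elim
    case (elim \<omega>)
    let ?x = "tree \<omega>"
    note one = elim(3)[rule_format]
    show ?case
    proof (rule allI, rule L.tendsto_linearized)
      show "convex_on UNIV (\<lambda>t. ln (partition_function ?x n t) / n)" for n
        by (rule convex_ln_partition_function[OF one])
      show "ln (partition_function ?x n (q * t)) / n \<le> q * (ln (partition_function ?x n t) / n)" if "1 \<le> q" for n t q
        by (rule ln_partition_function_scale[OF one that])
    next
      fix t c assume "t \<in> \<rat>" and c: "L t < c"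
      then obtain r where r: "t = of_rat r" by (auto elim: Rats_cases)
      obtain j where j: "1 / real (Suc j) < c - L t" using nat_approx_posE[of "c - L t"] c by auto
      have "\<forall>\<^sub>F n in sequentially. partition_function ?x n t < exp ((L t + 1 / Suc j) * n)"
        using elim(1) unfolding r by blast
      then show "\<forall>\<^sub>F n in sequentially. ln (partition_function ?x n t) / n < c"
        using eventually_gt_at_top[of 0]
      proof eventually_elim
        case (elim n)
        have "ln (partition_function ?x n t) < (L t + 1 / Suc j) * n"
          using elim(1) partition_function_positive[where x="?x", OF one] by (metis exp_gt_zero ln_exp ln_less_cancel_iff)
        then have "ln (partition_function ?x n t) / n < L t + 1 / Suc j"
          using elim(2) by (simp add: pos_divide_less_eq)
        then show ?case using j by linarith
      qed
    next
      fix t p c assume "t \<in> \<rat>" and p: "1 < p" "p \<le> 2" "L (p * t) < p * L t" and c: "c < L t"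
      then obtain r where r: "t = of_rat r" by (auto elim: Rats_cases)
      obtain j where j: "1 / real (Suc j) < L t - c" using nat_approx_posE[of "L t - c"] c by auto
      have "growing t (L t - 1 / Suc j) ?x"
        using elim(2) p unfolding r by blast
      then show "\<forall>\<^sub>F n in sequentially. c < ln (partition_function ?x n t) / n"
        by (rule growing_eventually_less[OF one]) (use j in linarith)
    qed
  qed
qed

end

theorem theorem3p1:
  fixes M :: "'w measure" and \<Theta> :: "'e measure"
    and \<eta> :: "'e \<Rightarrow> (nat \<times> (nat \<Rightarrow> real)) measure"
    and \<xi> :: "nat \<Rightarrow> 'w \<Rightarrow> 'e"
    and X :: "nat list \<Rightarrow> 'w \<Rightarrow> nat \<times> (nat \<Rightarrow> real)"
  defines "m \<equiv> (\<lambda>\<omega>. mean_offspring \<eta> (\<lambda>n. \<xi> n \<omega>))"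
    and "m\<^sub>t \<equiv> (\<lambda>\<omega>. laplace_offspring \<eta> (\<lambda>n. \<xi> n \<omega>))"
  assumes "brw_random_environment M \<Theta> \<eta> \<xi> X"
    and "log_integrable M m" and "(\<integral>\<omega>. ln (enn2real (m \<omega>)) \<partial>M) > 0"
    and "integrable M (\<lambda>\<omega>. real (fst (X [] \<omega>)) / enn2real (m \<omega>) * max 0 (ln (real (fst (X [] \<omega>)))))"
    and "AE \<omega> in M. fst (X [] \<omega>) \<ge> 1"
    and "integrable M (\<lambda>\<omega>. snd (X [] \<omega>) 0)"
    and "\<And>t. log_integrable M (\<lambda>\<omega>. m\<^sub>t \<omega> t)"
    and "\<And>t. integrable M (\<lambda>\<omega>. deriv (\<lambda>s. enn2real (m\<^sub>t \<omega> s)) t / enn2real (m\<^sub>t \<omega> t))"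
  shows "AE \<omega> in M. \<forall>t. (\<lambda>n. ln (partition_function (\<lambda>u. X u \<omega>) n t) / real n)
           \<longlonglongrightarrow> linearized (\<Lambda> M \<eta> \<xi>) t"
proof -
  interpret brw_random_environment M \<Theta> \<eta> \<xi> X by fact
  interpret brw_growth M \<Theta> \<eta> \<xi> X
    by unfold_locales (use assms in \<open>simp_all add: m_def m\<^sub>t_def\<close>)
  show ?thesis using AE_tendsto_linearized unfolding tree_def .
qed

end
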